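(* There exist $\mathbb{F}_{23^2}$-maximal hyperelliptic curves of genus $4$ defined over $\mathbb{F}_{23}$, and there also exists an $\mathbb{F}_{23^2}$-minimal hyperelliptic curve of genus $4$ over $\mathbb{F}_{23}$. Specifically, the following $11$ hyperelliptic curves over $\mathbb{F}_{23}$ are $\mathbb{F}_{23^2}$-maximal: $y^2 = x^{10} + x^7 + 3 x^4 + 10 x$; $y^2 = x^{10} + x^7 + 18 x^4 + 6 x$; $y^2 = x^{10} + x^7 + 5 x^6 + 3 x^5 + 21 x^4 + 3 x^3 + 9 x^2 + 4 x + 21$; $y^2 = x^{10} + x^7 + 9 x^6 + 11 x^5 + 19 x^4 + 10 x^3 + 16 x^2 + 8 x + 21$; $y^2 = x^{10} + x^7 + 16 x^6 + 9 x^5 + 14 x^4 + 2 x^3 + 5 x^2 + 6 x + 1$; $y^2 = x^{10} + x^7 + 18 x^6 + 21 x^4 + x^3 + 8 x^2 + 20 x + 21$; $y^2 = x^{10} + x^8 + 3 x^6 + 2 x^4 + 2 x^2 + 6$; $y^2 = x^{10} + x^8 + 6 x^6 + 22 x^4 + 4 x^2 + 3$; $y^2 = x^{10} + x^8 + 8 x^6 + 7 x^4 + 15 x^2 + 14$; $y^2 = x^{10} + x^8 + 4 x^7 + 12 x^6 + 2 x^5 + 12 x^2 + 11 x + 18$; $y^2 = x^{10} + x^8 + 5 x^7 + 15 x^6 + 22 x^5 + 11 x^4 + 7 x^2 + 18 x + 17$. On the other hand, the following curve over $\mathbb{F}_{23}$ is $\mathbb{F}_{23^2}$-minimal: $y^2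 = x^{10} + x^8 + 2 x^7 + 6 x^6 + 3 x^5 + 14 x^4 + 16 x^3 + 11 x^2 + 19$.
   Context: A curve over a field $K$ is a projective, geometrically irreducible, non-singular algebraic curve over $K$. A hyperelliptic curve over $K$ is a curve over $K$ admitting a morphism over $K$ of degree $2$ to $\mathbf{P}^1$. An equation $y^2=f(x)$ with $f\in K[x]$ of degree $2g+2$ and non-zero discriminant denotes the hyperelliptic curve of genus $g$ that is the desingularization of the projective closure (homogenization) of the affine curve $y^2=f(x)$. A curve $C$ of genus $g$ defined over (a subfield of) $\mathbb{F}_{p^2}$ is $\mathbb{F}_{p^2}$-maximal (resp. $\mathbb{F}_{p^2}$-minimal) if its number of $\mathbb{F}_{p^2}$-rational points attains the Hasse--Weil upper (resp. lower) bound, i.e. $\#C(\mathbb{F}_{p^2}) = p^2+1+2gp$ (resp. $\#C(\mathbb{F}_{p^2}) = p^2+1-2gp$). Integer coefficients are read modulo $23$. *)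

theory Defs
  imports "HOL-Algebra.Algebraic_Closure_Type" "HOL-Algebra.Generated_Fields"
    "HOL-Algebra.Finite_Extensions" "HOL-Library.FuncSet"
begin

text \<open>
  A projective non-singular curve over a field \<open>k\<close> is encoded by its function field, in the
  classical way: the curve attached to a function field \<open>F\<close> in one variable over \<open>k\<close> has the
  valuation rings of \<open>F\<close> over \<open>k\<close> as its closed points, and in particular the desingularization
  of the projective closure of an affine curve is the curve attached to the function field of the
  affine curve.  All fields are subfields of one algebraically closed field, whose carrier is the
  whole type \<open>'a\<close> (a universal domain).
\<close>

abbreviation Omega :: "'a::field ring"
  where "Omega \<equiv> ring_of_type_algebra"

text \<open>If \<open>q > 1\<close> is a power of the (prime) characteristic of an algebraically closed field, the
  following is its unique subfield with \<open>q\<close> elements.\<close>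

definition GF :: "nat \<Rightarrow> 'a::field set"
  where "GF q = {z. z ^ q = z}"

abbreviation adjoin :: "'a::field set \<Rightarrow> 'a set \<Rightarrow> 'a set"
  where "adjoin k S \<equiv> generate_field Omega (k \<union> S)"


section \<open>Curves\<close>

text \<open>The last conjunct (\<open>k\<close> is algebraically closed in \<open>F\<close>) is geometric irreducibility, and
  regularity of the curve is the same as smoothness, provided that \<open>k\<close> is perfect; here \<open>k\<close> is
  always finite.\<close>

definition curve :: "'a::field set \<Rightarrow> 'a set \<Rightarrow> bool"
  where "curve k F \<longleftrightarrow>
    subfield k Omega \<and> subfield F Omega \<and> k \<subseteq> F \<and>
    (\<exists>t\<in>F. (ring.transcendental Omega over k) t \<and>
           (ring.finite_dimension Omega over adjoin k {t}) F) \<and>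
    (\<forall>z\<in>F. (ring.algebraic Omega over k) z \<longrightarrow> z \<in> k)"

text \<open>A non-constant morphism to the projective line is an element \<open>t\<close> of \<open>F\<close> outside \<open>k\<close>, and
  its degree is the degree of \<open>F\<close> over \<open>k(t)\<close>.\<close>

definition hyperelliptic_curve :: "'a::field set \<Rightarrow> 'a set \<Rightarrow> bool"
  where "hyperelliptic_curve k F \<longleftrightarrow>
    curve k F \<and>
    (\<exists>t\<in>F. (ring.transcendental Omega over k) t \<and>
           (ring.dimension Omega 2 over adjoin k {t}) F)"

text \<open>The function field of \<open>y\<^sup>2 = f(x)\<close> over \<open>k\<close>, generated by a generic point \<open>(x, y)\<close> of the
  affine curve; \<open>x\<close> is meant to be transcendental over \<open>k\<close>.  The two square roots \<open>y\<close> of \<open>f(x)\<close>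
  differ by a sign, so adjoining both or one of them is the same.\<close>

definition double_cover :: "'a::field set \<Rightarrow> 'a \<Rightarrow> 'a poly \<Rightarrow> 'a set"
  where "double_cover k x f = adjoin k ({x} \<union> {y. y ^ 2 = poly f x})"


section \<open>Points\<close>

definition places :: "'a::field set \<Rightarrow> 'a set \<Rightarrow> 'a set set"
  where "places k F =
    {A. subring A Omega \<and> k \<subset> A \<and> A \<subset> F \<and> (\<forall>z\<in>F. z \<in> A \<or> inverse z \<in> A)}"

text \<open>The non-units of the ring \<open>A\<close>; if \<open>A\<close> is a valuation ring, this is its maximal ideal.\<close>

definition nonunits :: "'a::field set \<Rightarrow> 'a set"
  where "nonunits A = {z \<in> A. z = 0 \<or> inverse z \<notin> A}"

text \<open>The \<open>K\<close>-rational points of a curve over \<open>k\<close> with function field \<open>F\<close>, where \<open>K\<close> is an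
  algebraic extension of \<open>k\<close>: the closed points with residue field \<open>K\<close> of the base change to
  \<open>K\<close>, whose function field is the compositum of \<open>F\<close> and \<open>K\<close>.\<close>

definition rational_points :: "'a::field set \<Rightarrow> 'a set \<Rightarrow> 'a set set"
  where "rational_points K F =
    {A \<in> places K (adjoin K F). \<forall>z\<in>A. \<exists>c\<in>K. z - c \<in> nonunits A}"


section \<open>Genus\<close>

definition derivations :: "'a::field set \<Rightarrow> 'a set \<Rightarrow> ('a \<Rightarrow> 'a) set"
  where "derivations k F =
    {D \<in> F \<rightarrow>\<^sub>E F. (\<forall>c\<in>k. D c = 0) \<and>
       (\<forall>u\<in>F. \<forall>v\<in>F. D (u + v) = D u + D v \<and> D (u * v) = u * D v + v * D u)}"

text \<open>For \<open>A = F\<close> these are the differentials of \<open>F\<close> over \<open>k\<close>, and for a valuation ring \<open>A\<close> the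
  differentials that are regular at the corresponding point.  The differential \<open>h dt\<close> is
  represented by the functional that sends a derivation \<open>D\<close> to \<open>h D(t)\<close>; this loses nothing, as
  the module of differentials of \<open>F\<close> has finite dimension and hence is the dual of its dual.\<close>

definition differentials ::
    "'a::field set \<Rightarrow> 'a set \<Rightarrow> 'a set \<Rightarrow> (('a \<Rightarrow> 'a) \<Rightarrow> 'a) set"
  where "differentials k F A =
    {(\<lambda>D\<in>derivations k F. \<Sum>i<n. h i * D (t i)) | (n::nat) h t. \<forall>i<n. h i \<in> A \<and> t i \<in> A}"

definition regular_differentials ::
    "'a::field set \<Rightarrow> 'a set \<Rightarrow> (('a \<Rightarrow> 'a) \<Rightarrow> 'a) set"
  where "regular_differentials k F =
    {w \<in> differentials k F F. \<forall>A\<in>places k F. w \<in> differentials k F A}"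

text \<open>The genus is the dimension over \<open>k\<close> of the space of regular differentials: there are \<open>g\<close> of
  them such that each one is a unique \<open>k\<close>-linear combination of these.\<close>

definition has_genus :: "'a::field set \<Rightarrow> 'a set \<Rightarrow> nat \<Rightarrow> bool"
  where "has_genus k F g \<longleftrightarrow>
    (\<exists>w :: nat \<Rightarrow> ('a \<Rightarrow> 'a) \<Rightarrow> 'a.
       bij_betw (\<lambda>c. \<lambda>D\<in>derivations k F. \<Sum>i<g. c i * w i D)
         ({..<g} \<rightarrow>\<^sub>E k) (regular_differentials k F))"


section \<open>Maximal and minimal curves\<close>

text \<open>Maximality and minimality over the field with \<open>p\<^sup>2\<close> elements of a curve over its subfield
  \<open>k\<close>, where \<open>p\<close> is the characteristic.\<close>

definition maximal_curve :: "nat \<Rightarrow> 'a::field set \<Rightarrow> 'a set \<Rightarrow> bool"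
  where "maximal_curve p k F \<longleftrightarrow>
    curve k F \<and> k \<subseteq> GF (p ^ 2) \<and>
    (\<exists>g. has_genus k F g \<and>
         int (card (rational_points (GF (p ^ 2)) F)) = int p ^ 2 + 1 + 2 * int g * int p)"

definition minimal_curve :: "nat \<Rightarrow> 'a::field set \<Rightarrow> 'a set \<Rightarrow> bool"
  where "minimal_curve p k F \<longleftrightarrow>
    curve k F \<and> k \<subseteq> GF (p ^ 2) \<and>
    (\<exists>g. has_genus k F g \<and>
         int (card (rational_points (GF (p ^ 2)) F)) = int p ^ 2 + 1 - 2 * int g * int p)"

abbreviation \<X> :: "'a::comm_ring_1 poly"
  where "\<X> \<equiv> [:0, 1:]"

end

(*
  Points.  The local ring of the affine model at a point (alpha, beta) is a discrete valuation
  ring with uniformizer x - alpha if beta is non-zero and y if beta = 0.  In a rational place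
  with x finite, x and y have residues alpha and beta, so the place dominates, hence equals, the
  local ring of (alpha, beta).  The places with x infinite are those over s = 0 in the chart
  s = 1/x, w = y/x^5, and there are two of them because f is monic.  So the number of rational
  points is 2 more than the number of affine solutions, and the latter are counted over
  GF(529) = GF(23)(i): a non-zero element v = a + b i is a square if and only if
  v^264 = (a^2 + b^2)^11 = 1.

  Genus.  Let delta be the derivation with delta(x) = y; it preserves the coordinate ring of each
  affine chart (up to the factor -s^(g-1) in the chart at infinity) and so all its local rings.
  Hence a regular differential takes a value at delta that has no affine poles over the algebraic
  closure of GF(23), and thus is a(x) + b(x) y with polynomials a, b; the same holds at infinity,
  which forces b = 0 and deg a < g.  So the regular differentials are the a(x) dx/y with
  deg a < g.
*)
theory Submission
  imports Defs
begin

section \<open>Subfields of the universal domain\<close>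

text \<open>The genus is defined by all places of the function field F over GF 23, and their residue
  fields can be arbitrarily large, so that the local rings of coordinate pairs over GF 23 do not
  describe them. The two halves of the genus computation get around this differently. To bound the
  regular differentials, the local rings at points over an algebraic closure L are intersected with
  F; this gives enough places of F, but the coefficients found lie in L, and have to be brought down
  to GF 23 because the value also lies in F. To show that the forms are regular, an arbitrary
  valuation ring is treated without coordinates: at a ramified place a Bezout identity u f + v f' =
  1 over GF 23 replaces the argument that f' does not vanish at a root of f. The same identity shows
  that f has no multiple root in any extension. Taking values at \<delta> loses nothing since every
  derivation of F over GF 23 is an F-multiple of \<delta>.\<close>

locale subrng =
  fixes A :: "'a::field set"
  assumes one_mem: "1 \<in> A"
    and add_mem: "a \<in> A \<Longrightarrow> b \<in> A \<Longrightarrow> a + b \<in> A"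
    and uminus_mem: "a \<in> A \<Longrightarrow> - a \<in> A"
    and mult_mem: "a \<in> A \<Longrightarrow> b \<in> A \<Longrightarrow> a * b \<in> A"
begin

lemma diff_mem: "a \<in> A \<Longrightarrow> b \<in> A \<Longrightarrow> a - b \<in> A"
  using add_mem[of a "- b"] uminus_mem by simp

lemma zero_mem: "0 \<in> A"
  using diff_mem[OF one_mem one_mem] by simp

lemma power_mem: "a \<in> A \<Longrightarrow> a ^ n \<in> A"
  by (induction n) (auto simp: one_mem mult_mem)

lemma of_nat_mem: "of_nat n \<in> A"
  by (induction n) (auto simp: one_mem zero_mem add_mem)

lemma of_int_mem: "of_int n \<in> A"
  by (cases n) (auto simp: of_nat_mem uminus_mem simp del: of_nat_Suc)

lemma numeral_mem: "numeral n \<in> A"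
  using of_nat_mem[of "numeral n"] by simp

lemma sum_mem: "(\<And>i. i \<in> I \<Longrightarrow> h i \<in> A) \<Longrightarrow> sum h I \<in> A"
  by (induction I rule: infinite_finite_induct) (auto simp: zero_mem add_mem)

lemmas ring_mems = zero_mem one_mem add_mem diff_mem uminus_mem mult_mem power_mem of_nat_mem
  of_int_mem numeral_mem

end

locale subfld = subrng +
  assumes inverse_mem: "a \<in> A \<Longrightarrow> inverse a \<in> A"
begin

lemma divide_mem: "a \<in> A \<Longrightarrow> b \<in> A \<Longrightarrow> a / b \<in> A"
  by (simp add: divide_inverse inverse_mem mult_mem)

lemmas mems = ring_mems inverse_mem divide_mem

end

section \<open>Translation of the algebraic structure of \<open>Omega\<close> into type class
  operations\<close>

lemma carrier_Omega: "carrier Omega = UNIV"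
  and mult_Omega: "a \<otimes>\<^bsub>Omega\<^esub> b = a * b"
  and add_Omega: "a \<oplus>\<^bsub>Omega\<^esub> b = a + b"
  and one_Omega: "\<one>\<^bsub>Omega\<^esub> = 1"
  and zero_Omega: "\<zero>\<^bsub>Omega\<^esub> = 0"
  by (simp_all add: ring_of_type_algebra_def)

lemma uminus_Omega: "\<ominus>\<^bsub>Omega\<^esub> a = - (a :: 'a::field)"
proof -
  interpret Omega: Ring.field "Omega :: 'a ring" by (rule field_from_type_algebra)
  show ?thesis
    using Omega.minus_equality[of "- a" a] by (simp add: carrier_Omega add_Omega zero_Omega)
qed

lemma inv_Omega:
  assumes "a \<noteq> 0"
  shows "inv\<^bsub>Omega\<^esub> a = inverse (a :: 'a::field)"
proof -
  interpret Omega: Ring.field "Omega :: 'a ring" by (rule field_from_type_algebra)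
  show ?thesis
    using assms Omega.comm_inv_char[of a "inverse a"] by (simp add: carrier_Omega mult_Omega one_Omega)
qed

lemmas Omega_simps = carrier_Omega mult_Omega add_Omega one_Omega zero_Omega uminus_Omega inv_Omega

lemma subring_Omega_iff: "subring A (Omega :: 'a::field ring) \<longleftrightarrow> subrng A"
proof
  assume "subring A (Omega :: 'a::field ring)"
  from subringE[OF this] show "subrng A"
    by unfold_locales (auto simp: Omega_simps)
next
  assume "subrng A"
  then interpret subrng A .
  interpret Omega: Ring.field "Omega :: 'a ring" by (rule field_from_type_algebra)
  show "subring A (Omega :: 'a::field ring)"
    by (rule Omega.subringI) (auto simp: Omega_simps ring_mems)
qed

lemma subfield_Omega_iff: "subfield A (Omega :: 'a::field ring) \<longleftrightarrow> subfld A"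
proof -
  interpret Omega: Ring.field "Omega :: 'a ring" by (rule field_from_type_algebra)
  show ?thesis
  proof
  assume *: "subfield A (Omega :: 'a::field ring)"
  have "subrng A"
    using subfieldE(1)[OF *] subring_Omega_iff by blast
  moreover have "inverse a \<in> A" if "a \<in> A" for a
    using Omega.subfield_m_inv(1)[OF *, of a] that by (cases "a = 0") (auto simp: Omega_simps)
  ultimately show "subfld A"
    by (simp add: subfld_def subfld_axioms_def)
next
  assume "subfld A"
  then interpret subfld A .
  show "subfield A (Omega :: 'a::field ring)"
    by (rule Omega.subfieldI')
       (use subring_Omega_iff subrng_axioms in \<open>auto simp: Omega_simps mems\<close>)
  qed
qed

lemma subfld_adjoin: "subfld (adjoin (k :: 'a::field set) S)"
proof -
  interpret Omega: Ring.field "Omega :: 'a ring" by (rule field_from_type_algebra)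
  show ?thesis
    using Omega.generate_field_is_subfield[of "k \<union> S"]
    by (simp add: subfield_Omega_iff carrier_Omega)
qed

lemma adjoin_supset: "k \<subseteq> adjoin k S" "S \<subseteq> adjoin k S"
  by (auto intro: generate_field.incl)

lemma adjoin_least:
  fixes E :: "'a::field set"
  assumes "subfld E" "k \<subseteq> E" "S \<subseteq> E"
  shows "adjoin k S \<subseteq> E"
proof -
  interpret Omega: Ring.field "Omega :: 'a ring" by (rule field_from_type_algebra)
  show ?thesis
    using Omega.generate_field_min_subfield1[of "k \<union> S" E] assms
    by (simp add: subfield_Omega_iff carrier_Omega)
qed

text \<open>For the degree of the function field over k(x): the line K has dimension one, and a
  vector y outside it adds one more.\<close>

lemma dimension_two:
  fixes K :: "'a::field set"
  assumes "subfld K" "y \<notin> K"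
  shows "ring.dimension Omega 2 K {a + b * y | a b. a \<in> K \<and> b \<in> K}"
proof -
  interpret subfld K by fact
  interpret Omega: Ring.field "Omega :: 'a ring" by (rule field_from_type_algebra)
  have sf: "subfield K Omega"
    using assms by (simp add: subfield_Omega_iff)
  have "Omega.line_extension K y K = {a + b * y | a b. a \<in> K \<and> b \<in> K}"
    unfolding Omega.line_extension_def set_add_def' r_coset_def
    by (auto simp: Omega_simps) (metis add.commute)+
  moreover have "Omega.dimension (Suc 1) K (Omega.line_extension K y K)"
    using Omega.dimension_one[OF sf] assms by (intro Omega.Suc_dim) (auto simp: carrier_Omega)
  ultimately show ?thesis by (simp add: numeral_2_eq_2)
qed

section \<open>Polynomials with coefficients in a subfield\<close>

text \<open>This is K[X] inside the polynomials over the whole type. Subfields are sets and not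
  types, so polynomials over different fields of constants can be compared directly.\<close>

definition polys :: "'a::field set \<Rightarrow> 'a poly set"
  where "polys K = {p. \<forall>i. coeff p i \<in> K}"

definition transc :: "'a::field set \<Rightarrow> 'a \<Rightarrow> bool"
  where "transc K x \<longleftrightarrow> (\<forall>p\<in>polys K. poly p x = 0 \<longrightarrow> p = 0)"

lemma transcD: "transc K x \<Longrightarrow> p \<in> polys K \<Longrightarrow> poly p x = 0 \<Longrightarrow> p = 0"
  by (auto simp: transc_def)

lemma polys_mono: "K \<subseteq> L \<Longrightarrow> polys K \<subseteq> polys L"
  by (auto simp: polys_def)

lemma transc_mono: "K \<subseteq> L \<Longrightarrow> transc L x \<Longrightarrow> transc K x"
  using polys_mono[of K L] by (auto simp: transc_def subset_iff)

text \<open>The lists of HOL-Algebra begin with the leading coefficient, those of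
  \<open>Poly\<close> with the constant term.\<close>

lemma eval_Omega: "ring.eval Omega p x = poly (Poly (rev p)) (x :: 'a::field)"
proof (induction p)
  case Nil
  interpret Omega: Ring.field "Omega :: 'a ring" by (rule field_from_type_algebra)
  show ?case by (simp add: Omega_simps)
next
  case (Cons a p)
  interpret Omega: Ring.field "Omega :: 'a ring" by (rule field_from_type_algebra)
  have pow: "x [^]\<^bsub>Omega\<^esub> n = x ^ n" for n :: nat
    by (induction n) (auto simp: Omega_simps Omega.nat_pow_Suc)
  have "poly (Poly (xs @ [a])) x = poly (Poly xs) x + a * x ^ length xs" for xs
    by (induction xs) (auto simp: algebra_simps)
  then show ?case
    using Cons by (simp add: Omega_simps pow)
qed

lemma transcendental_Omega_iff:
  fixes x :: "'a::field"
  assumes "subfld K"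
  shows "(ring.transcendental Omega over K) x \<longleftrightarrow> transc K x"
proof
  interpret Omega: Ring.field "Omega :: 'a ring" by (rule field_from_type_algebra)
  assume *: "(ring.transcendental Omega over K) x"
  show "transc K x"
    unfolding transc_def
  proof safe
    fix p assume p: "p \<in> polys K" "poly p x = 0"
    show "p = 0"
    proof (rule ccontr)
      assume "p \<noteq> 0"
      then have "rev (coeffs p) \<noteq> []" "lead_coeff p \<noteq> 0" by auto
      moreover have "hd (rev (coeffs p)) = lead_coeff p"
        using \<open>p \<noteq> 0\<close> by (simp add: hd_rev last_coeffs_eq_coeff_degree)
      ultimately have "polynomial\<^bsub>Omega\<^esub> K (rev (coeffs p))"
        using p by (auto simp: polynomial_def polys_def Omega_simps coeffs_def)
      then have "rev (coeffs p) \<in> carrier (K[X]\<^bsub>Omega\<^esub>)"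
        by (simp add: univ_poly_carrier)
      moreover have "ring.eval Omega (rev (coeffs p)) x = \<zero>\<^bsub>Omega\<^esub>"
        using p by (simp add: eval_Omega Omega_simps)
      ultimately show False
        using Omega.eval_transcendental[OF *] \<open>rev (coeffs p) \<noteq> []\<close> by blast
    qed
  qed
next
  assume *: "transc K x"
  interpret Omega: Ring.field "Omega :: 'a ring" by (rule field_from_type_algebra)
  interpret subfld K by fact
  show "(ring.transcendental Omega over K) x"
  proof (rule ccontr)
    assume alg: "\<not> (ring.transcendental Omega over K) x"
    have "(ring.algebraic Omega over K) x"
      using alg by (simp add: over_def)
    from Omega.algebraicE[OF _ _ this] obtain p where
      p: "p \<in> carrier (K[X]\<^bsub>Omega\<^esub>)" "p \<noteq> []" "ring.eval Omega p x = \<zero>\<^bsub>Omega\<^esub>"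
      using subring_Omega_iff subrng_axioms carrier_Omega by (metis UNIV_I)
    then have "set p \<subseteq> K" "hd p \<noteq> 0"
      by (auto simp: univ_poly_def polynomial_def Omega_simps)
    have "coeff (Poly (rev p)) i \<in> K" for i
      using \<open>set p \<subseteq> K\<close> zero_mem
      by (cases "i < length p") (auto simp: coeff_Poly_eq nth_default_def rev_nth)
    then have "Poly (rev p) \<in> polys K" by (simp add: polys_def)
    moreover have "poly (Poly (rev p)) x = 0"
      using p(3) by (simp add: eval_Omega Omega_simps)
    ultimately have "Poly (rev p) = 0" using * by (auto simp: transc_def)
    then have "coeff (Poly (rev p)) (length p - 1) = 0" by simp
    then show False
      using \<open>p \<noteq> []\<close> \<open>hd p \<noteq> 0\<close> by (cases p) (auto simp: coeff_Poly_eq nth_default_def nth_append)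
  qed
qed

context subrng
begin

lemma polys_0: "0 \<in> polys A" and polys_1: "1 \<in> polys A"
  by (auto simp: polys_def zero_mem one_mem coeff_eq_0 one_pCons coeff_pCons split: nat.split)

lemma polys_pCons: "a \<in> A \<Longrightarrow> p \<in> polys A \<Longrightarrow> pCons a p \<in> polys A"
  by (auto simp: polys_def coeff_pCons split: nat.split)

lemma polys_add: "p \<in> polys A \<Longrightarrow> q \<in> polys A \<Longrightarrow> p + q \<in> polys A"
  by (auto simp: polys_def add_mem)

lemma polys_uminus: "p \<in> polys A \<Longrightarrow> - p \<in> polys A"
  by (auto simp: polys_def uminus_mem)

lemma polys_diff: "p \<in> polys A \<Longrightarrow> q \<in> polys A \<Longrightarrow> p - q \<in> polys A"
  by (auto simp: polys_def diff_mem)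

lemma polys_smult: "a \<in> A \<Longrightarrow> p \<in> polys A \<Longrightarrow> smult a p \<in> polys A"
  by (auto simp: polys_def mult_mem)

lemma polys_mult: "p \<in> polys A \<Longrightarrow> q \<in> polys A \<Longrightarrow> p * q \<in> polys A"
  by (auto simp: polys_def coeff_mult intro!: sum_mem mult_mem)

lemma polys_power: "p \<in> polys A \<Longrightarrow> p ^ n \<in> polys A"
  by (induction n) (auto simp: polys_1 polys_mult)

lemma polys_pderiv: "p \<in> polys A \<Longrightarrow> pderiv p \<in> polys A"
  by (auto simp: polys_def coeff_pderiv simp del: of_nat_Suc intro!: mult_mem of_nat_mem)

lemma polys_monom: "a \<in> A \<Longrightarrow> monom a n \<in> polys A"
  by (auto simp: polys_def zero_mem)

lemma polys_numeral: "numeral n \<in> polys A"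
  using polys_pCons[OF numeral_mem polys_0] by (simp add: numeral_poly)

lemma polys_reflect: "p \<in> polys A \<Longrightarrow> reflect_poly p \<in> polys A"
  by (auto simp: polys_def coeff_reflect_poly zero_mem)

lemma poly_mem: "p \<in> polys A \<Longrightarrow> a \<in> A \<Longrightarrow> poly p a \<in> A"
  by (auto simp: poly_altdef polys_def intro!: sum_mem mult_mem power_mem)

lemma polys_synthetic_div: "p \<in> polys A \<Longrightarrow> a \<in> A \<Longrightarrow> synthetic_div p a \<in> polys A"
proof (induction p)
  case (pCons c p)
  then have "p \<in> polys A"
    by (auto simp: polys_def coeff_pCons split: nat.splits)
  then show ?case
    using pCons polys_pCons poly_mem by simp
qed (auto simp: polys_0)

lemmas polys_mems = polys_0 polys_1 polys_pCons polys_add polys_uminus polys_diff polys_smult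
  polys_mult polys_power polys_pderiv polys_monom polys_numeral polys_reflect

lemma polys_root_factor:
  assumes "p \<in> polys A" "a \<in> A" "poly p a = 0"
  obtains q where "q \<in> polys A" "p = [:-a, 1:] * q"
  using synthetic_div_correct'[of a p] polys_synthetic_div[OF assms(1,2)] assms(3) that by simp

text \<open>A factorization over the whole type would not show that the cofactor has coefficients in
  A. Hence the linear factors are split off one at a time, by synthetic division inside A.\<close>

lemma polys_root_order_factor:
  assumes "p \<in> polys A" "a \<in> A" "p \<noteq> 0"
  obtains q n where "q \<in> polys A" "p = [:-a, 1:] ^ n * q" "poly q a \<noteq> 0"
  using assms
proof (induction "degree p" arbitrary: p thesis rule: less_induct)
  case less
  show ?case
  proof (cases "poly p a = 0")
    case True
    with less.prems obtain r where r: "r \<in> polys A" "p = [:-a, 1:] * r"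
      using polys_root_factor by metis
    with less.prems have "r \<noteq> 0" by auto
    then have "degree r < degree p" unfolding r(2) by (subst degree_mult_eq) auto
    from less.hyps[OF this _ r(1) less.prems(3) \<open>r \<noteq> 0\<close>] obtain q n where
      "q \<in> polys A" "r = [:-a, 1:] ^ n * q" "poly q a \<noteq> 0" by metis
    then show ?thesis
      using less.prems(1)[of q "Suc n"] r(2) by (simp add: algebra_simps)
  qed (use less.prems(1)[of p 0] less.prems in auto)
qed

end

section \<open>Valuation rings\<close>

locale place = K: subfld K + F: subfld F for K F :: "'a::field set" +
  fixes A :: "'a set"
  assumes place: "A \<in> places K F"
begin

sublocale subrng A
  using place by (simp add: places_def subring_Omega_iff)

lemma K_sub: "K \<subseteq> A" and sub_F: "A \<subseteq> F" and val: "z \<in> F \<Longrightarrow> z \<in> A \<or> inverse z \<in> A"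
  using place by (auto simp: places_def)

lemma nonunits_sub: "z \<in> nonunits A \<Longrightarrow> z \<in> A"
  by (simp add: nonunits_def)

lemma nonunits_K: "c \<in> K \<Longrightarrow> c \<in> nonunits A \<Longrightarrow> c = 0"
  using K_sub K.inverse_mem by (auto simp: nonunits_def)

lemma nonunits_mult:
  assumes "u \<in> nonunits A" "v \<in> A"
  shows "u * v \<in> nonunits A"
proof -
  have inv: "inverse u = v * inverse (u * v)" if "u * v \<noteq> 0"
    using that by (simp add: field_simps)
  have "inverse (u * v) \<notin> A" if "u * v \<noteq> 0"
  proof
    assume "inverse (u * v) \<in> A"
    then have "inverse u \<in> A" using inv[OF that] assms mult_mem by metis
    then show False using assms that by (auto simp: nonunits_def)
  qed
  then show ?thesis
    using assms mult_mem by (auto simp: nonunits_def)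
qed

lemma nonunits_uminus: "u \<in> nonunits A \<Longrightarrow> - u \<in> nonunits A"
  using nonunits_mult[of u "- 1"] ring_mems by simp

text \<open>One of u/v and v/u is in A, so the sum is a multiple of v or of u by an element of
  A.\<close>

lemma nonunits_add:
  assumes "u \<in> nonunits A" "v \<in> nonunits A"
  shows "u + v \<in> nonunits A"
proof -
  have *: "u + v \<in> nonunits A" if "v \<in> nonunits A" "u / v \<in> A" "v \<noteq> 0" for u v
  proof -
    have "u + v = v * (u / v + 1)" using that by (simp add: algebra_simps)
    then show ?thesis using nonunits_mult[of v "u / v + 1"] that add_mem one_mem by metis
  qed
  show ?thesis
  proof (cases "u = 0 \<or> v = 0")
    case False
    have "u / v \<in> F"
      using assms sub_F nonunits_sub F.divide_mem by blast
    then show ?thesis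
      using val[of "u / v"] *[of u v] *[of v u] assms False by (auto simp: add.commute)
  qed (use assms in auto)
qed

lemma nonunits_diff: "u \<in> nonunits A \<Longrightarrow> v \<in> nonunits A \<Longrightarrow> u - v \<in> nonunits A"
  using nonunits_add[of u "- v"] nonunits_uminus by simp

text \<open>X - a divides p - p(a). In terms of residues: if u has residue a, then p(u) has residue
  p(a).\<close>

lemma nonunits_poly_diff:
  assumes "p \<in> polys K" "a \<in> K" "u - a \<in> nonunits A"
  shows "poly p u - poly p a \<in> nonunits A"
proof -
  obtain q where q: "q \<in> polys K" "p - [:poly p a:] = [:-a, 1:] * q"
    by (rule K.polys_root_factor[of "p - [:poly p a:]" a])
       (use assms in \<open>auto intro!: K.polys_mems K.poly_mem\<close>)
  have "u \<in> A"
    using assms nonunits_sub[OF assms(3)] K_sub add_mem[of "u - a" a] by auto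
  then have "poly q u \<in> A"
    using q K_sub polys_mono[OF K_sub] poly_mem by blast
  moreover have "poly p u - poly p a = (u - a) * poly q u"
    using arg_cong[OF q(2), of "\<lambda>p. poly p u"] by (simp add: algebra_simps)
  ultimately show ?thesis
    using nonunits_mult assms by simp
qed

text \<open>An instance of integral closedness of valuation rings: if y were outside A, then 1/y and
  so y^2 * (1/y) = y would be inside.\<close>

lemma square_mem:
  assumes "y ^ 2 \<in> A" "y \<in> F"
  shows "y \<in> A"
proof (rule ccontr)
  assume *: "y \<notin> A"
  then have "y ^ 2 * inverse y \<in> A"
    using val assms mult_mem by blast
  moreover have "y ^ 2 * inverse y = y"
    by (cases "y = 0") (auto simp: power2_eq_square)
  ultimately show False using * by simp
qed

lemma unit_inverse: "u \<in> A \<Longrightarrow> u \<notin> nonunits A \<Longrightarrow> inverse u \<in> A"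
  by (auto simp: nonunits_def)

lemma nonunit_inverse: "z \<in> F \<Longrightarrow> z \<notin> A \<Longrightarrow> inverse z \<in> nonunits A"
  using val[of z] by (auto simp: nonunits_def)

end

text \<open>Valuation rings are maximal under domination: for z in B outside A, the inverse of z is
  a nonunit of A, hence of B, which contradicts z in B.\<close>

lemma subset_place_eq:
  assumes A: "place K F A" and B: "place K F B" and "A \<subseteq> B" "nonunits A \<subseteq> nonunits B"
  shows "A = B"
proof -
  interpret A: place K F A by fact
  interpret B: place K F B by fact
  have "z \<in> A" if "z \<in> B" for z
  proof (rule ccontr)
    assume "z \<notin> A"
    then have "inverse z \<in> nonunits B"
      using A.nonunit_inverse[of z] B.sub_F that assms by blast
    then show False using that \<open>z \<notin> A\<close> A.zero_mem by (auto simp: nonunits_def)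
  qed
  with assms show ?thesis by blast
qed

section \<open>The function field of a smooth double cover of the line\<close>

text \<open>Only a positive degree is required of f, so that the reversed polynomial of the chart at
  infinity, whose degree drops if f(0) = 0, gives another instance. \<open>smooth\<close> ranges
  over the whole universal domain, so the same condition serves every field of constants L.\<close>

locale double_cover_field = subfld L for L :: "'a::alg_closed_field set" +
  fixes x y :: 'a and f :: "'a poly"
  assumes transc: "transc L x"
    and f_mem: "f \<in> polys L" and deg_f: "degree f > 0"
    and y_sq: "y ^ 2 = poly f x"
    and smooth: "poly f a = 0 \<Longrightarrow> poly (pderiv f) a \<noteq> 0"
    and two_nz: "(2::'a) \<noteq> 0"
begin

lemma f_nz: "f \<noteq> 0"
  using deg_f by auto

text \<open>A root of \<open>f\<close> occurs in \<open>b\<^sup>2 f\<close> to an odd order.\<close>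

lemma not_square_mult:
  assumes "a ^ 2 = b ^ 2 * f"
  shows "b = 0"
proof (rule ccontr)
  assume "b \<noteq> 0"
  obtain r where r: "poly f r = 0"
    using alg_closed_imp_poly_has_root[OF deg_f] by blast
  obtain q where q: "f = [:-r, 1:] * q"
    using r by (auto simp: poly_eq_0_iff_dvd)
  have "poly q r \<noteq> 0"
    using smooth[OF r] unfolding q pderiv_mult by (simp add: pderiv_pCons del: mult_pCons_left)
  then have "order r q = 0" by (rule order_0I)
  have "q \<noteq> 0" using \<open>poly q r \<noteq> 0\<close> by auto
  then have "order r f = 1"
    unfolding q using order_mult[of "[:-r, 1:]" q r] \<open>order r q = 0\<close> order_power_n_n[of r 1]
    by (simp del: mult_pCons_left)
  moreover have "a \<noteq> 0"
    using assms \<open>b \<noteq> 0\<close> f_nz by auto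
  ultimately have "2 * order r a = 2 * order r b + 1"
    using arg_cong[OF assms, of "order r"] \<open>b \<noteq> 0\<close> f_nz
    by (simp add: power2_eq_square order_mult)
  then show False by presburger
qed

section \<open>The coordinate ring L[x, y] of the affine curve\<close>

definition elt :: "'a poly \<Rightarrow> 'a poly \<Rightarrow> 'a"
  where "elt a b = poly a x + poly b x * y"

definition R :: "'a set"
  where "R = {elt a b | a b. a \<in> polys L \<and> b \<in> polys L}"

lemma elt_add: "elt a b + elt c d = elt (a + c) (b + d)"
  and elt_uminus: "- elt a b = elt (- a) (- b)"
  and elt_diff: "elt a b - elt c d = elt (a - c) (b - d)"
  by (simp_all add: elt_def algebra_simps)

lemma elt_mult: "elt a b * elt c d = elt (a * c + b * d * f) (a * d + b * c)"
proof -
  have "elt a b * elt c d = poly a x * poly c x + poly b x * poly d x * y ^ 2 +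
    (poly a x * poly d x + poly b x * poly c x) * y"
    by (simp add: elt_def algebra_simps power2_eq_square)
  then show ?thesis by (simp add: y_sq elt_def)
qed

text \<open>1 and y are independent over L[x]: a + b y = 0 implies a^2 = b^2 f as polynomials,
  because x is transcendental, and \<open>not_square_mult\<close> then gives b = 0.\<close>

lemma elt_eq_0:
  assumes "a \<in> polys L" "b \<in> polys L" "elt a b = 0"
  shows "a = 0 \<and> b = 0"
proof -
  have "poly a x = - (poly b x * y)"
    using assms by (simp add: elt_def add_eq_0_iff2)
  then have "poly a x ^ 2 = poly b x ^ 2 * poly f x"
    by (simp add: power_mult_distrib y_sq)
  then have "poly (a ^ 2 - b ^ 2 * f) x = 0" by simp
  then have "a ^ 2 - b ^ 2 * f = 0"
    using assms f_mem by (intro transcD[OF transc]) (auto intro!: polys_mems)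
  then have "b = 0" using not_square_mult by simp
  with assms show ?thesis using transcD[OF transc] by (simp add: elt_def)
qed

lemma elt_inj:
  assumes "a \<in> polys L" "b \<in> polys L" "c \<in> polys L" "d \<in> polys L" "elt a b = elt c d"
  shows "a = c \<and> b = d"
  using elt_eq_0[of "a - c" "b - d"] assms by (simp add: polys_mems elt_diff[symmetric])

lemma elt_mem: "a \<in> polys L \<Longrightarrow> b \<in> polys L \<Longrightarrow> elt a b \<in> R"
  by (auto simp: R_def)

lemma R_E:
  assumes "r \<in> R"
  obtains a b where "a \<in> polys L" "b \<in> polys L" "r = elt a b"
  using assms by (auto simp: R_def)

lemma elt_0_0 [simp]: "elt 0 0 = 0"
  and elt_const: "elt [:c:] 0 = c" and elt_x: "elt [:0, 1:] 0 = x" and elt_y: "elt 0 1 = y"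
  by (simp_all add: elt_def)

sublocale R: subrng R
proof
  show "1 \<in> R"
    using elt_mem[of 1 0] polys_mems by (simp add: elt_def)
qed (auto elim!: R_E simp: elt_add elt_uminus elt_mult intro!: elt_mem polys_mems f_mem)

lemma L_sub_R: "L \<subseteq> R"
  using elt_mem[of "[:_:]" 0] polys_mems by (auto simp: elt_const)

lemma x_mem_R: "x \<in> R" and y_mem_R: "y \<in> R"
  using elt_mem[of "[:0, 1:]" 0] elt_mem[of 0 1] by (auto simp: elt_x elt_y polys_mems zero_mem one_mem)

section \<open>The function field as the field of fractions of the coordinate ring\<close>

definition E :: "'a set"
  where "E = {r / s | r s. r \<in> R \<and> s \<in> R \<and> s \<noteq> 0}"

lemma E_I: "r \<in> R \<Longrightarrow> s \<in> R \<Longrightarrow> r / s \<in> E"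
  using R.zero_mem R.one_mem by (cases "s = 0") (force simp: E_def)+

lemma E_E:
  assumes "z \<in> E"
  obtains r s where "r \<in> R" "s \<in> R" "s \<noteq> 0" "z = r / s"
  using assms by (auto simp: E_def)

lemma R_sub_E: "R \<subseteq> E"
  using E_I[OF _ R.one_mem] by auto

sublocale E: subfld E
proof
  show "1 \<in> E" using R_sub_E R.one_mem by blast
next
  fix a b assume "a \<in> E" "b \<in> E"
  then obtain r s t u where *: "r \<in> R" "s \<in> R" "s \<noteq> 0" "a = r / s" "t \<in> R" "u \<in> R" "u \<noteq> 0" "b = t / u"
    by (auto elim!: E_E)
  then have "a + b = (r * u + t * s) / (s * u)" "a * b = (r * t) / (s * u)"
    by (auto simp: field_simps)
  then show "a + b \<in> E" "a * b \<in> E"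
    using * by (auto intro!: E_I R.ring_mems)
next
  fix a assume "a \<in> E"
  then obtain r s where *: "r \<in> R" "s \<in> R" "s \<noteq> 0" "a = r / s"
    by (auto elim!: E_E)
  then have eq: "- a = (- r) / s" "inverse a = s / r" by auto
  show "- a \<in> E" "inverse a \<in> E"
    unfolding eq using * by (auto intro!: E_I R.uminus_mem simp del: divide_minus_left)
qed

lemma E_least:
  assumes "subfld S" "L \<subseteq> S" "x \<in> S" "y \<in> S"
  shows "E \<subseteq> S"
proof -
  interpret S: subfld S by fact
  have "R \<subseteq> S"
    using assms polys_mono[OF assms(2)]
    by (auto elim!: R_E simp: elt_def intro!: S.add_mem S.mult_mem S.poly_mem)
  then show ?thesis by (auto elim!: E_E intro!: S.divide_mem)
qed

lemma adjoin_eq_E: "adjoin L {x, y} = E"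
proof
  show "adjoin L {x, y} \<subseteq> E"
    using L_sub_R x_mem_R y_mem_R R_sub_E by (intro adjoin_least E.subfld_axioms) auto
  show "E \<subseteq> adjoin L {x, y}"
    using adjoin_supset[where k = L and S = "{x, y}"] by (intro E_least subfld_adjoin) auto
qed

text \<open>The denominator c + d y is made a polynomial in x by multiplying with its conjugate c -
  d y; the product is the norm c^2 - d^2 f.\<close>

lemma E_E_poly:
  assumes "z \<in> E"
  obtains a b c where "a \<in> polys L" "b \<in> polys L" "c \<in> polys L" "c \<noteq> 0" "z * poly c x = elt a b"
proof -
  obtain r s where *: "r \<in> R" "s \<in> R" "s \<noteq> 0" "z = r / s"
    using assms by (elim E_E)
  obtain a b c d where r: "a \<in> polys L" "b \<in> polys L" "r = elt a b"
    and s: "c \<in> polys L" "d \<in> polys L" "s = elt c d"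
    using * by (elim R_E)
  define N where "N = c ^ 2 - d ^ 2 * f"
  have N: "N \<in> polys L" using s by (auto simp: N_def intro!: polys_mems f_mem)
  have "elt c d * elt c (- d) = elt N 0"
    by (simp add: elt_mult N_def power2_eq_square)
  then have sN: "s * elt c (- d) = poly N x" by (simp add: elt_def s)
  have "elt c (- d) \<noteq> 0"
    using elt_eq_0[of c "- d"] s *(3) by (auto simp: polys_mems)
  then have "N \<noteq> 0" using sN *(3) by auto
  obtain a' b' where ab: "a' \<in> polys L" "b' \<in> polys L" "elt a b * elt c (- d) = elt a' b'"
    using R.mult_mem[OF elt_mem elt_mem] r(1,2) s(1,2) polys_mems by (metis R_E)
  have "z * poly N x = elt a' b'"
    using *(3,4) ab(3) unfolding sN[symmetric] r by (simp add: algebra_simps)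
  with that N ab \<open>N \<noteq> 0\<close> show ?thesis by blast
qed

end

section \<open>The valuation ring of a point\<close>

locale point = double_cover_field L x y f for L :: "'a::alg_closed_field set" and x y f +
  fixes \<alpha> \<beta> :: 'a
  assumes pt_mem: "\<alpha> \<in> L" "\<beta> \<in> L" and pt: "\<beta> ^ 2 = poly f \<alpha>"
begin

text \<open>The value at the point (\<alpha>, \<beta>) of an element of the coordinate ring; the
  description is unique because an element determines its coordinates a and b.\<close>

definition ev :: "'a \<Rightarrow> 'a"
  where "ev r = (THE v. \<exists>a\<in>polys L. \<exists>b\<in>polys L. r = elt a b \<and> v = poly a \<alpha> + poly b \<alpha> * \<beta>)"

lemma ev_elt:
  assumes "a \<in> polys L" "b \<in> polys L"
  shows "ev (elt a b) = poly a \<alpha> + poly b \<alpha> * \<beta>"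
  unfolding ev_def by (rule the_equality) (use assms elt_inj in blast)+

lemma ev_mem: "r \<in> R \<Longrightarrow> ev r \<in> L"
  by (auto elim!: R_E simp: ev_elt intro!: ring_mems poly_mem pt_mem)

lemma ev_add: "r \<in> R \<Longrightarrow> s \<in> R \<Longrightarrow> ev (r + s) = ev r + ev s"
  and ev_uminus: "r \<in> R \<Longrightarrow> ev (- r) = - ev r"
  by (auto elim!: R_E simp: elt_add elt_uminus ev_elt polys_mems algebra_simps)

lemma ev_mult:
  assumes "r \<in> R" "s \<in> R"
  shows "ev (r * s) = ev r * ev s"
proof -
  obtain a b c d where r: "a \<in> polys L" "b \<in> polys L" "r = elt a b"
    and s: "c \<in> polys L" "d \<in> polys L" "s = elt c d"
    using assms by (elim R_E)
  have "ev r * ev s = poly a \<alpha> * poly c \<alpha> + poly b \<alpha> * poly d \<alpha> * \<beta> ^ 2 +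
    (poly a \<alpha> * poly d \<alpha> + poly b \<alpha> * poly c \<alpha>) * \<beta>"
    using r s by (simp add: ev_elt algebra_simps power2_eq_square)
  also have "\<dots> = ev (r * s)"
    unfolding r s elt_mult pt using r s f_mem by (subst ev_elt) (auto intro!: polys_mems)
  finally show ?thesis by simp
qed

lemma ev_const: "c \<in> L \<Longrightarrow> ev c = c"
  using ev_elt[of "[:c:]" 0] by (simp add: polys_mems elt_const)

lemma ev_x: "ev x = \<alpha>" and ev_y: "ev y = \<beta>"
  using ev_elt[of "[:0, 1:]" 0] ev_elt[of 0 1]
  by (simp_all add: polys_mems elt_x elt_y zero_mem one_mem)

lemma ev_0 [simp]: "ev 0 = 0" and ev_1 [simp]: "ev 1 = 1"
  using ev_const ring_mems by auto

lemma ev_diff: "r \<in> R \<Longrightarrow> s \<in> R \<Longrightarrow> ev (r - s) = ev r - ev s"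
  using ev_add[of r "- s"] ev_uminus R.ring_mems by auto

lemma ev_power: "r \<in> R \<Longrightarrow> ev (r ^ n) = ev r ^ n"
  by (induction n) (auto simp: ev_mult R.ring_mems)

text \<open>As \<open>e\<close> and \<open>c\<close> are units of the local ring, \<open>u\<close> is a power of \<open>\<tau>\<close> up to a unit; if this holds
  for all \<open>u\<close>, the local ring is a discrete valuation ring.\<close>

definition uniformizes :: "'a \<Rightarrow> 'a \<Rightarrow> bool"
  where "uniformizes \<tau> u \<longleftrightarrow> (\<exists>e\<in>R. \<exists>c\<in>R. \<exists>n. ev e \<noteq> 0 \<and> ev c \<noteq> 0 \<and> e * u = \<tau> ^ n * c)"

text \<open>X - \<alpha> is divided out of a and b as long as it divides both. If a + b y then still
  vanishes at the point, its conjugate a - b y does not, as \<beta> and 2 are non-zero; the product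
  of the two is a polynomial in x, whose order at \<alpha> is the exponent sought.\<close>

lemma uniformizes_unramified:
  assumes "\<beta> \<noteq> 0" "u \<in> R" "u \<noteq> 0"
  shows "uniformizes (x - \<alpha>) u"
proof -
  have *: "uniformizes (x - \<alpha>) (elt a b)"
    if "a \<in> polys L" "b \<in> polys L" "elt a b \<noteq> 0" for a b
    using that
  proof (induction "degree a + degree b" arbitrary: a b rule: less_induct)
    case less
    show ?case
    proof (cases "poly a \<alpha> = 0 \<and> poly b \<alpha> = 0")
      case True
      obtain a' where a': "a' \<in> polys L" "a = [:-\<alpha>, 1:] * a'"
        using polys_root_factor less.prems(1) pt_mem(1) True by blast
      obtain b' where b': "b' \<in> polys L" "b = [:-\<alpha>, 1:] * b'"
        using polys_root_factor less.prems(2) pt_mem(1) True by blast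
      have eq: "elt a b = (x - \<alpha>) * elt a' b'"
        unfolding a' b' by (simp add: elt_def algebra_simps)
      have deg: "degree ([:-\<alpha>, 1:] * p) = (if p = 0 then 0 else Suc (degree p))" for p
        using degree_mult_eq[of "[:-\<alpha>, 1:]" p] by (auto simp del: mult_pCons_left)
      have "a' \<noteq> 0 \<or> b' \<noteq> 0"
        using less.prems(3) unfolding eq by auto
      then have "degree a' + degree b' < degree a + degree b"
        unfolding a' b' deg by auto
      from less.hyps[OF this a'(1) b'(1)] obtain e c n where
        *: "e \<in> R" "c \<in> R" "ev e \<noteq> 0" "ev c \<noteq> 0" "e * elt a' b' = (x - \<alpha>) ^ n * c"
        using less.prems(3) eq by (auto simp: uniformizes_def)
      then have "e * elt a b = (x - \<alpha>) ^ Suc n * c"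
        unfolding eq by (simp add: algebra_simps)
      with * show ?thesis unfolding uniformizes_def by blast
    next
      case False
      show ?thesis
      proof (cases "ev (elt a b) = 0")
        case True
        define N where "N = a ^ 2 - b ^ 2 * f"
        have N: "N \<in> polys L" using less.prems by (auto simp: N_def intro!: polys_mems f_mem)
        have eN: "elt a (- b) * elt a b = poly N x"
          by (simp add: elt_mult N_def power2_eq_square) (simp add: elt_def algebra_simps)
        have "elt a (- b) \<noteq> 0"
          using elt_eq_0[of a "- b"] less.prems by (auto simp: polys_mems)
        then have "N \<noteq> 0" using eN less.prems by auto
        then obtain q n where q: "q \<in> polys L" "N = [:-\<alpha>, 1:] ^ n * q" "poly q \<alpha> \<noteq> 0"
          using polys_root_order_factor[OF N pt_mem(1)] by metis
        have "elt a (- b) * elt a b = (x - \<alpha>) ^ n * elt q 0"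
          unfolding eN q(2) by (simp add: elt_def)
        moreover have "ev (elt q 0) \<noteq> 0"
          using q by (simp add: ev_elt polys_mems)
        moreover have "ev (elt a (- b)) \<noteq> 0"
        proof
          assume ev0: "ev (elt a (- b)) = 0"
          have minus: "poly a \<alpha> - poly b \<alpha> * \<beta> = 0"
            using ev0 less.prems by (simp add: ev_elt polys_mems)
          have plus: "poly a \<alpha> + poly b \<alpha> * \<beta> = 0"
            using True less.prems by (simp add: ev_elt polys_mems)
          have "2 * poly a \<alpha> = (poly a \<alpha> - poly b \<alpha> * \<beta>) + (poly a \<alpha> + poly b \<alpha> * \<beta>)"
            by (simp add: algebra_simps)
          then have "2 * poly a \<alpha> = 0" unfolding minus plus by simp
          then have "poly a \<alpha> = 0" using two_nz by (metis mult_eq_0_iff)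
          then have "poly b \<alpha> = 0" using plus \<open>\<beta> \<noteq> 0\<close> by (metis add_0 mult_eq_0_iff)
          then show False using False \<open>poly a \<alpha> = 0\<close> by blast
        qed
        ultimately show ?thesis
          using q less.prems unfolding uniformizes_def
          by (intro bexI[of _ "elt a (- b)"] bexI[of _ "elt q 0"] exI[of _ n])
             (auto intro!: elt_mem polys_mems)
      next
        case False
        then show ?thesis
          using elt_mem less.prems R.one_mem unfolding uniformizes_def
          by (intro bexI[of _ 1] bexI[of _ "elt a b"] exI[of _ 0]) auto
      qed
    qed
  qed
  then show ?thesis using assms by (auto elim!: R_E)
qed

text \<open>Here f = (X - \<alpha>) q with q(\<alpha>) non-zero, so x - \<alpha> is y^2 up to the
  unit Q = q(x). Thus a(x) has even order and b(x) y odd order in y. The orders differ, and the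
  smaller one is the order of the sum.\<close>

lemma uniformizes_ramified:
  assumes "\<beta> = 0" "u \<in> R" "u \<noteq> 0"
  shows "uniformizes y u"
proof -
  have "poly f \<alpha> = 0" using pt assms by simp
  obtain q where q: "q \<in> polys L" "f = [:-\<alpha>, 1:] * q"
    using polys_root_factor f_mem pt_mem(1) \<open>poly f \<alpha> = 0\<close> by blast
  have q\<alpha>: "poly q \<alpha> \<noteq> 0"
    using smooth[OF \<open>poly f \<alpha> = 0\<close>] unfolding q pderiv_mult
    by (simp add: pderiv_pCons del: mult_pCons_left)
  define Q where "Q = poly q x"
  have "Q = elt q 0" by (simp add: Q_def elt_def)
  then have Q: "Q \<in> R" "ev Q \<noteq> 0"
    using q q\<alpha> by (auto simp: elt_mem ev_elt polys_mems)
  have yQ: "y ^ 2 = Q * (x - \<alpha>)"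
    unfolding y_sq q(2) by (simp add: Q_def algebra_simps)
  have pol: "\<exists>m. \<exists>c\<in>R. ev c \<noteq> 0 \<and> Q ^ m * poly a x = y ^ (2 * m) * c"
    if "a \<in> polys L" "a \<noteq> 0" for a
  proof -
    obtain c m where c: "c \<in> polys L" "a = [:-\<alpha>, 1:] ^ m * c" "poly c \<alpha> \<noteq> 0"
      using polys_root_order_factor[OF \<open>a \<in> polys L\<close> pt_mem(1) \<open>a \<noteq> 0\<close>] by metis
    have "Q ^ m * poly a x = y ^ (2 * m) * elt c 0"
      unfolding power_mult yQ c(2) by (simp add: elt_def power_mult_distrib)
    moreover have "ev (elt c 0) \<noteq> 0"
      using c by (simp add: ev_elt polys_mems)
    ultimately show ?thesis using c elt_mem polys_0 by blast
  qed
  obtain a b where u: "a \<in> polys L" "b \<in> polys L" "u = elt a b"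
    using assms by (elim R_E)
  have "\<not> (a = 0 \<and> b = 0)" using u assms elt_0_0 by blast
  then consider "a = 0" "b \<noteq> 0" | "a \<noteq> 0" "b = 0" | "a \<noteq> 0" "b \<noteq> 0"
    by blast
  then show ?thesis
  proof cases
    case 1
    obtain m c where c: "c \<in> R" "ev c \<noteq> 0" "Q ^ m * poly b x = y ^ (2 * m) * c"
      using pol[OF u(2) 1(2)] by blast
    have "Q ^ m * u = y ^ (2 * m + 1) * c"
      using c 1 by (simp add: u elt_def mult.assoc[symmetric])
    then show ?thesis
      using c Q unfolding uniformizes_def
      by (intro bexI[of _ "Q ^ m"] bexI[of _ c] exI[of _ "2 * m + 1"]) (auto simp: ev_power R.ring_mems)
  next
    case 2
    obtain m c where c: "c \<in> R" "ev c \<noteq> 0" "Q ^ m * poly a x = y ^ (2 * m) * c"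
      using pol[OF u(1) 2(1)] by blast
    have "Q ^ m * u = y ^ (2 * m) * c"
      using c 2 by (simp add: u elt_def)
    then show ?thesis
      using c Q unfolding uniformizes_def
      by (intro bexI[of _ "Q ^ m"] bexI[of _ c] exI[of _ "2 * m"]) (auto simp: ev_power R.ring_mems)
  next
    case 3
    obtain m c where c: "c \<in> R" "ev c \<noteq> 0" "Q ^ m * poly a x = y ^ (2 * m) * c"
      using pol[OF u(1) 3(1)] by blast
    obtain n d where d: "d \<in> R" "ev d \<noteq> 0" "Q ^ n * poly b x = y ^ (2 * n) * d"
      using pol[OF u(2) 3(2)] by blast
    have "Q ^ (m + n) * u = Q ^ n * (Q ^ m * poly a x) + Q ^ m * (Q ^ n * poly b x) * y"
      by (simp add: u elt_def power_add algebra_simps)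
    then have eq: "Q ^ (m + n) * u = y ^ (2 * m) * (Q ^ n * c) + y ^ (2 * n + 1) * (Q ^ m * d)"
      unfolding c d by (simp add: algebra_simps)
    have y0: "ev (y ^ k) = 0" if "k > 0" for k
    proof -
      have "ev (y ^ k) = \<beta> ^ k" using y_mem_R by (simp add: ev_power ev_y)
      also have "\<dots> = 0" using that assms(1) by simp
      finally show ?thesis .
    qed
    \<comment> \<open>2 m and 2 n + 1 have different parity, so their difference k is positive in
      either case and the term with y^k vanishes at the point.\<close>
    show ?thesis
    proof (cases "m \<le> n")
      case True
      define k where "k = 2 * n + 1 - 2 * m"
      have k: "2 * n + 1 = 2 * m + k" "k > 0" using True by (auto simp: k_def)
      have "Q ^ (m + n) * u = y ^ (2 * m) * (Q ^ n * c + y ^ k * (Q ^ m * d))"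
        unfolding eq k(1) by (simp add: algebra_simps power_add)
      moreover have "ev (Q ^ n * c + y ^ k * (Q ^ m * d)) \<noteq> 0"
        using c d Q k(2) y0[OF k(2)] y_mem_R
        by (simp add: ev_add ev_mult ev_power R.ring_mems power_0_left)
      ultimately show ?thesis
        using c d Q y_mem_R unfolding uniformizes_def
        by (intro bexI[of _ "Q ^ (m + n)"] bexI[of _ "Q ^ n * c + y ^ k * (Q ^ m * d)"] exI[of _ "2 * m"])
           (auto simp: ev_power R.ring_mems)
    next
      case False
      define k where "k = 2 * m - (2 * n + 1)"
      have k: "2 * m = 2 * n + 1 + k" "k > 0" using False by (auto simp: k_def)
      have "Q ^ (m + n) * u = y ^ (2 * n + 1) * (y ^ k * (Q ^ n * c) + Q ^ m * d)"
        unfolding eq k(1) by (simp add: algebra_simps power_add)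
      moreover have "ev (y ^ k * (Q ^ n * c) + Q ^ m * d) \<noteq> 0"
        using c d Q k(2) y0[OF k(2)] y_mem_R
        by (simp add: ev_add ev_mult ev_power R.ring_mems power_0_left)
      ultimately show ?thesis
        using c d Q y_mem_R unfolding uniformizes_def
        by (intro bexI[of _ "Q ^ (m + n)"] bexI[of _ "y ^ k * (Q ^ n * c) + Q ^ m * d"] exI[of _ "2 * n + 1"])
           (auto simp: ev_power R.ring_mems)
    qed
  qed
qed

section \<open>The local ring of a point\<close>

definition O_pt :: "'a set"
  where "O_pt = {r / s | r s. r \<in> R \<and> s \<in> R \<and> ev s \<noteq> 0}"

lemma O_I: "r \<in> R \<Longrightarrow> s \<in> R \<Longrightarrow> ev s \<noteq> 0 \<Longrightarrow> r / s \<in> O_pt"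
  by (auto simp: O_pt_def)

lemma O_E:
  assumes "z \<in> O_pt"
  obtains r s where "r \<in> R" "s \<in> R" "ev s \<noteq> 0" "s \<noteq> 0" "z = r / s"
  using assms ev_0 unfolding O_pt_def by blast

lemma R_sub_O: "R \<subseteq> O_pt"
  using O_I[OF _ R.one_mem] by auto

lemma O_sub_E: "O_pt \<subseteq> E"
  by (auto elim!: O_E intro!: E_I)

lemma subrng_O: "subrng O_pt"
proof
  show "1 \<in> O_pt" using R_sub_O R.one_mem by blast
next
  fix a b assume "a \<in> O_pt" "b \<in> O_pt"
  then obtain r s t u where *: "r \<in> R" "s \<in> R" "ev s \<noteq> 0" "s \<noteq> 0" "a = r / s"
    "t \<in> R" "u \<in> R" "ev u \<noteq> 0" "u \<noteq> 0" "b = t / u"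
    by (elim O_E) blast
  then have "a + b = (r * u + t * s) / (s * u)" "a * b = (r * t) / (s * u)"
    by (auto simp: field_simps)
  then show "a + b \<in> O_pt" "a * b \<in> O_pt"
    using * by (auto intro!: O_I R.ring_mems simp: ev_mult)
next
  fix a assume "a \<in> O_pt"
  then obtain r s where *: "r \<in> R" "s \<in> R" "ev s \<noteq> 0" "a = r / s"
    by (auto elim!: O_E)
  then have "- a = (- r) / s" by auto
  then show "- a \<in> O_pt"
    using * by (metis O_I R.uminus_mem)
qed

text \<open>Up to units, numerator and denominator are powers of the same \<tau>, which is y at a
  ramified point and x - \<alpha> at any other. The comparison of the two exponents tells which of z
  and 1/z is in the local ring.\<close>

lemma val_O:
  assumes "z \<in> E"
  shows "z \<in> O_pt \<or> inverse z \<in> O_pt"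
proof (cases "z = 0")
  case False
  obtain \<tau> where \<tau>: "\<tau> \<in> R" "\<And>u. u \<in> R \<Longrightarrow> u \<noteq> 0 \<Longrightarrow> uniformizes \<tau> u"
    using uniformizes_ramified uniformizes_unramified y_mem_R R.diff_mem[OF x_mem_R] L_sub_R pt_mem
    by (metis subsetD)
  obtain r s where rs: "r \<in> R" "s \<in> R" "s \<noteq> 0" "z = r / s"
    using assms by (elim E_E)
  then have "r \<noteq> 0" using False by auto
  obtain e c n where r: "e \<in> R" "c \<in> R" "ev e \<noteq> 0" "ev c \<noteq> 0" "e * r = \<tau> ^ n * c"
    using \<tau>(2)[OF rs(1) \<open>r \<noteq> 0\<close>] by (auto simp: uniformizes_def)
  obtain e' c' m where s: "e' \<in> R" "c' \<in> R" "ev e' \<noteq> 0" "ev c' \<noteq> 0" "e' * s = \<tau> ^ m * c'"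
    using \<tau>(2)[OF rs(2,3)] by (auto simp: uniformizes_def)
  have nz: "e \<noteq> 0" "c \<noteq> 0" "e' \<noteq> 0" "c' \<noteq> 0"
    using r s by auto
  then have "\<tau> ^ m \<noteq> 0" "\<tau> ^ n \<noteq> 0"
    using r s rs \<open>r \<noteq> 0\<close> by (metis mult_eq_0_iff)+
  have r': "r = \<tau> ^ n * c / e" and s': "s = \<tau> ^ m * c' / e'"
    using r s nz by (simp_all add: field_simps)
  show ?thesis
  proof (cases "m \<le> n")
    case True
    then have "\<tau> ^ n = \<tau> ^ m * \<tau> ^ (n - m)" by (simp add: power_add[symmetric])
    then have "z = (\<tau> ^ (n - m) * c * e') / (c' * e)"
      unfolding rs(4) r' s' using \<open>\<tau> ^ m \<noteq> 0\<close> nz by (simp add: field_simps del: power_eq_0_iff)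
    moreover have "\<dots> \<in> O_pt"
      by (rule O_I) (use r s \<tau> in \<open>auto simp: ev_mult intro!: R.ring_mems\<close>)
    ultimately show ?thesis by simp
  next
    case False
    then have "\<tau> ^ m = \<tau> ^ n * \<tau> ^ (m - n)" by (simp add: power_add[symmetric])
    then have "inverse z = (\<tau> ^ (m - n) * c' * e) / (c * e')"
      unfolding rs(4) r' s' using \<open>\<tau> ^ n \<noteq> 0\<close> nz by (simp add: field_simps del: power_eq_0_iff)
    moreover have "\<dots> \<in> O_pt"
      by (rule O_I) (use r s \<tau> in \<open>auto simp: ev_mult intro!: R.ring_mems\<close>)
    ultimately show ?thesis by simp
  qed
qed (use R_sub_O R.zero_mem in auto)

lemma inverse_notin_O:
  assumes "r \<in> R" "ev r = 0" "r \<noteq> 0"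
  shows "inverse r \<notin> O_pt"
proof
  assume "inverse r \<in> O_pt"
  then obtain u s where *: "u \<in> R" "s \<in> R" "ev s \<noteq> 0" "s \<noteq> 0" "inverse r = u / s"
    by (elim O_E)
  then have "s = u * r" using assms by (simp add: field_simps)
  then show False using * assms by (simp add: ev_mult)
qed

lemma nonunits_O_I: "r \<in> R \<Longrightarrow> ev r = 0 \<Longrightarrow> r \<in> nonunits O_pt"
  using inverse_notin_O R_sub_O by (auto simp: nonunits_def)

lemma x_diff_nz: "c \<in> L \<Longrightarrow> x - c \<noteq> 0"
  using transcD[OF transc, of "[:-c, 1:]"] polys_mems ring_mems by auto

lemma x_diff_nonunit: "x - \<alpha> \<in> nonunits O_pt"
  using pt_mem L_sub_R by (auto intro!: nonunits_O_I R.ring_mems x_mem_R simp: ev_diff ev_x x_mem_R ev_const)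

lemma y_diff_nonunit: "y - \<beta> \<in> nonunits O_pt"
  using pt_mem L_sub_R by (auto intro!: nonunits_O_I R.ring_mems y_mem_R simp: ev_diff ev_y y_mem_R ev_const)

lemma O_place: "O_pt \<in> places L E"
proof -
  have "x \<notin> L" using x_diff_nz by force
  moreover have "inverse (x - \<alpha>) \<notin> O_pt"
    using x_diff_nonunit x_diff_nz pt_mem by (auto simp: nonunits_def)
  moreover have "inverse (x - \<alpha>) \<in> E"
    using x_mem_R L_sub_R R_sub_E pt_mem by (intro E.inverse_mem E.diff_mem) auto
  ultimately show ?thesis
    using val_O O_sub_E L_sub_R R_sub_O x_mem_R subrng_O
    by (auto simp: places_def subring_Omega_iff)
qed

sublocale O: place L E O_pt
  by unfold_locales (rule O_place)

lemma O_residue: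
  assumes "z \<in> O_pt"
  shows "\<exists>c\<in>L. z - c \<in> nonunits O_pt"
proof -
  obtain r s where *: "r \<in> R" "s \<in> R" "ev s \<noteq> 0" "s \<noteq> 0" "z = r / s"
    using assms by (elim O_E)
  define c where "c = ev r / ev s"
  have "c \<in> L" using * by (simp add: c_def divide_mem ev_mem)
  have "ev (r - c * s) = 0"
  proof -
    have "c \<in> R" using \<open>c \<in> L\<close> L_sub_R by blast
    then have "ev (r - c * s) = ev r - c * ev s"
      using * \<open>c \<in> L\<close> by (simp add: ev_diff ev_mult ev_const R.mult_mem)
    then show ?thesis using * by (simp add: c_def)
  qed
  then have "(r - c * s) \<in> nonunits O_pt"
    using * \<open>c \<in> L\<close> L_sub_R by (intro nonunits_O_I) (auto intro!: R.ring_mems)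
  moreover have "inverse s \<in> O_pt"
    using O_I[OF R.one_mem *(2,3)] by (simp add: inverse_eq_divide)
  ultimately have "(r - c * s) * inverse s \<in> nonunits O_pt"
    by (rule O.nonunits_mult)
  moreover have "(r - c * s) * inverse s = z - c"
    using *(4,5) by (simp add: field_simps)
  ultimately show ?thesis
    using \<open>c \<in> L\<close> by metis
qed

lemma place_eq_O:
  assumes "A \<in> places L E" "x - \<alpha> \<in> nonunits A" "y - \<beta> \<in> nonunits A"
  shows "A = O_pt"
proof -
  interpret A: place L E A by unfold_locales fact
  have xy: "x \<in> A" "y \<in> A"
    using A.add_mem[of "x - \<alpha>" \<alpha>] A.add_mem[of "y - \<beta>" \<beta>] A.nonunits_sub assms pt_mem A.K_sub
    by auto
  have diff: "r - ev r \<in> nonunits A" if "r \<in> R" for r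
  proof -
    obtain a b where r: "a \<in> polys L" "b \<in> polys L" "r = elt a b"
      using \<open>r \<in> R\<close> by (elim R_E)
    have "poly b \<alpha> \<in> A" using poly_mem r pt_mem A.K_sub by blast
    have "y \<in> A" by fact
    \<comment> \<open>The term b(x) y - b(\<alpha>) \<beta> is split so that each summand has a
      factor that is a nonunit by hypothesis. Once all residues on R are known, every s with
      \<open>ev s\<close> non-zero is a unit of A.\<close>
    have "poly a x - poly a \<alpha> + ((poly b x - poly b \<alpha>) * y + (y - \<beta>) * poly b \<alpha>) \<in> nonunits A"
      using r pt_mem assms \<open>y \<in> A\<close> \<open>poly b \<alpha> \<in> A\<close>
      by (intro A.nonunits_add A.nonunits_mult A.nonunits_poly_diff)
    then show ?thesis
      using r by (simp add: ev_elt) (simp add: elt_def algebra_simps)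
  qed
  have R: "r \<in> A" if "r \<in> R" for r
    using A.add_mem[of "r - ev r" "ev r"] A.nonunits_sub[OF diff[OF that]] A.K_sub ev_mem[OF that]
    by auto
  have inv: "inverse s \<in> A" if "s \<in> R" "ev s \<noteq> 0" for s
  proof (rule A.unit_inverse)
    show "s \<in> A" using R that by blast
    show "s \<notin> nonunits A"
    proof
      assume "s \<in> nonunits A"
      then have "ev s \<in> nonunits A"
        using A.nonunits_diff[OF _ diff[OF that(1)], of s] by simp
      then show False using A.nonunits_K ev_mem that by blast
    qed
  qed
  have "O_pt \<subseteq> A"
    using A.mult_mem[OF R inv] by (auto elim!: O_E simp: divide_inverse)
  moreover have "nonunits O_pt \<subseteq> nonunits A"
  proof
    fix z assume z: "z \<in> nonunits O_pt"
    then obtain r s where *: "r \<in> R" "s \<in> R" "ev s \<noteq> 0" "s \<noteq> 0" "z = r / s"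
      using O.nonunits_sub[OF z] by (elim O_E)
    have "ev r = 0"
    proof (rule ccontr)
      assume "ev r \<noteq> 0"
      then have "inverse z \<in> O_pt" using * O_I[of s r] by simp
      then have "z = 0" using z by (auto simp: nonunits_def)
      then show False using \<open>ev r \<noteq> 0\<close> * by simp
    qed
    then have "r \<in> nonunits A" using diff[OF *(1)] by simp
    then show "z \<in> nonunits A"
      using A.nonunits_mult[OF _ inv[OF *(2,3)], of r] * by (simp add: divide_inverse)
  qed
  ultimately show ?thesis
    using subset_place_eq[of L E O_pt A] O.place_axioms A.place_axioms by simp
qed

end

section \<open>The derivation with value \<open>y\<close> at \<open>x\<close>\<close>

text \<open>In contrast to \<open>derivations\<close>, this prescribes neither a codomain nor values
  outside E, so that one function can be considered on several fields and multiplied by arbitrary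
  scalars.\<close>

definition derivation_on :: "'a::field set \<Rightarrow> ('a \<Rightarrow> 'a) \<Rightarrow> bool"
  where "derivation_on E d \<longleftrightarrow> (\<forall>u\<in>E. \<forall>v\<in>E. d (u + v) = d u + d v \<and> d (u * v) = u * d v + v * d u)"

lemma derivation_on_subset: "derivation_on E d \<Longrightarrow> F \<subseteq> E \<Longrightarrow> derivation_on F d"
  by (auto simp: derivation_on_def subset_iff)

context subfld
begin

lemma derivation_inverse:
  assumes "derivation_on A d" "u \<in> A" "d 1 = 0" "u \<noteq> 0"
  shows "d (inverse u) = - d u / u ^ 2"
proof -
  have "u * d (inverse u) + inverse u * d u = d (u * inverse u)"
    using assms inverse_mem unfolding derivation_on_def by metis
  also have "\<dots> = 0" using assms by simp
  finally show ?thesis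
    using \<open>u \<noteq> 0\<close> by (simp add: field_simps power2_eq_square add_eq_0_iff2)
qed

lemma derivation_uminus:
  assumes "derivation_on A d" "d 1 = 0" "u \<in> A"
  shows "d (- u) = - d u"
proof -
  have "d 0 = 0"
    using assms zero_mem unfolding derivation_on_def by (metis add_cancel_right_left)
  then have "d (- u) + d u = 0"
    using assms uminus_mem unfolding derivation_on_def by (metis add.left_inverse)
  then show ?thesis by (simp add: add_eq_0_iff2)
qed

text \<open>By the sum, product and inverse rules, the elements of A at which d and d' agree form a
  subfield. It contains K and S.\<close>

lemma derivations_eqI:
  assumes "derivation_on A d" "derivation_on A d'" "subfld K" "K \<subseteq> A" "S \<subseteq> A" "A \<subseteq> adjoin K S"
    and "\<And>c. c \<in> K \<Longrightarrow> d c = 0" "\<And>c. c \<in> K \<Longrightarrow> d' c = 0" "\<And>z. z \<in> S \<Longrightarrow> d z = d' z" "z \<in> A"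
  shows "d z = d' z"
proof -
  interpret K: subfld K by fact
  have 1: "d 1 = 0" "d' 1 = 0"
    using assms K.one_mem by auto
  have add: "d (a + b) = d a + d b" "d' (a + b) = d' a + d' b"
    and mult: "d (a * b) = a * d b + b * d a" "d' (a * b) = a * d' b + b * d' a"
    if "a \<in> A" "b \<in> A" for a b
    using assms(1,2) that by (simp_all add: derivation_on_def)
  have "subfld {z \<in> A. d z = d' z}"
  proof
    show "1 \<in> {z \<in> A. d z = d' z}"
      using 1 one_mem by simp
    show "inverse a \<in> {z \<in> A. d z = d' z}" if "a \<in> {z \<in> A. d z = d' z}" for a
      using that derivation_inverse[OF assms(1), of a] derivation_inverse[OF assms(2), of a] 1
      by (cases "a = 0") (auto simp: inverse_mem)
    show "- a \<in> {z \<in> A. d z = d' z}" if "a \<in> {z \<in> A. d z = d' z}" for a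
      using that derivation_uminus[OF assms(1), of a] derivation_uminus[OF assms(2), of a] 1
      by (auto simp: uminus_mem)
    show "a + b \<in> {z \<in> A. d z = d' z}" "a * b \<in> {z \<in> A. d z = d' z}"
      if "a \<in> {z \<in> A. d z = d' z}" "b \<in> {z \<in> A. d z = d' z}" for a b
      using that add[of a b] mult[of a b] by (auto simp: add_mem mult_mem)
  qed
  then have "adjoin K S \<subseteq> {z \<in> A. d z = d' z}"
    by (rule adjoin_least) (use assms(4,5,7-9) in \<open>auto simp: subset_iff\<close>)
  then show ?thesis using assms(6,10) by blast
qed

end

context double_cover_field
begin

text \<open>From \<open>x' = y\<close> and \<open>y\<^sup>2 = f(x)\<close> one gets \<open>y' = f'(x)/2\<close>, hence
  \<open>(a(x) + b(x) y)' = b'(x) f(x) + b(x) f'(x)/2 + a'(x) y\<close>.  So this derivation preserves the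
  coordinate ring, hence also all its localizations.\<close>

definition dR :: "'a \<Rightarrow> 'a"
  where "dR r = (THE v. \<exists>a\<in>polys L. \<exists>b\<in>polys L. r = elt a b \<and>
    v = elt (pderiv b * f + smult (1 / 2) (b * pderiv f)) (pderiv a))"

lemma dR_elt:
  assumes "a \<in> polys L" "b \<in> polys L"
  shows "dR (elt a b) = elt (pderiv b * f + smult (1 / 2) (b * pderiv f)) (pderiv a)"
  unfolding dR_def by (rule the_equality) (use assms elt_inj in blast)+

lemma dR_mem: "r \<in> R \<Longrightarrow> dR r \<in> R"
  by (auto elim!: R_E simp: dR_elt intro!: elt_mem polys_mems f_mem mems)

lemma dR_add: "r \<in> R \<Longrightarrow> s \<in> R \<Longrightarrow> dR (r + s) = dR r + dR s"
  by (auto elim!: R_E simp: elt_add dR_elt polys_mems pderiv_add algebra_simps smult_add_right)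

lemma dR_mult:
  assumes "r \<in> R" "s \<in> R"
  shows "dR (r * s) = r * dR s + s * dR r"
proof -
  obtain a b c d where r: "a \<in> polys L" "b \<in> polys L" "r = elt a b"
    and s: "c \<in> polys L" "d \<in> polys L" "s = elt c d"
    using assms by (elim R_E)
  have half: "(1 / 2 :: 'a) + 1 / 2 = 1" using two_nz by (simp add: field_simps)
  \<comment> \<open>Writing f' as h + h removes the scalar 1/2, so that the product rule becomes an
    identity of commutative rings.\<close>
  define h where "h = smult (1 / 2) (pderiv f)"
  have ff: "pderiv f = h + h"
    using half by (metis h_def smult_add_left smult_1_left)
  have dR': "dR (elt a b) = elt (pderiv b * f + b * h) (pderiv a)"
    if "a \<in> polys L" "b \<in> polys L" for a b
    using dR_elt[OF that] by (simp add: h_def mult_smult_right)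
  have "dR (r * s) = elt (pderiv (a * d + b * c) * f + (a * d + b * c) * h) (pderiv (a * c + b * d * f))"
    unfolding r s elt_mult by (rule dR') (use r s f_mem in \<open>auto intro!: polys_mems\<close>)
  also have "\<dots> = r * dR s + s * dR r"
    unfolding r s using r s
    by (simp add: dR' pderiv_add pderiv_mult ff elt_add elt_mult algebra_simps)
  finally show ?thesis .
qed

section \<open>Extension of the derivation to the function field by the quotient rule\<close>

definition \<delta> :: "'a \<Rightarrow> 'a"
  where "\<delta> z = (THE v. \<exists>r\<in>R. \<exists>s\<in>R. s \<noteq> 0 \<and> z = r / s \<and> v = (s * dR r - r * dR s) / s ^ 2)"

text \<open>Independence of the fraction: if r/s = r'/s', then applying \<open>dR\<close> to r s' =
  r' s yields a relation that turns one quotient rule into the other.\<close>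

lemma \<delta>_quotient:
  assumes "r \<in> R" "s \<in> R" "s \<noteq> 0"
  shows "\<delta> (r / s) = (s * dR r - r * dR s) / s ^ 2"
  unfolding \<delta>_def
proof (rule the_equality)
  show "\<exists>r'\<in>R. \<exists>s'\<in>R. s' \<noteq> 0 \<and> r / s = r' / s' \<and>
      (s * dR r - r * dR s) / s ^ 2 = (s' * dR r' - r' * dR s') / s' ^ 2"
    using assms by blast
next
  fix v assume "\<exists>r'\<in>R. \<exists>s'\<in>R. s' \<noteq> 0 \<and> r / s = r' / s' \<and> v = (s' * dR r' - r' * dR s') / s' ^ 2"
  then obtain r' s' where *: "r' \<in> R" "s' \<in> R" "s' \<noteq> 0" "r / s = r' / s'"
    "v = (s' * dR r' - r' * dR s') / s' ^ 2" by blast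
  have eq: "r * s' = r' * s"
    using * assms by (simp add: field_simps)
  then have d: "r * dR s' + s' * dR r = r' * dR s + s * dR r'"
    using dR_mult[OF assms(1) *(2)] dR_mult[OF *(1) assms(2)] by simp
  have "(s' * dR r' - r' * dR s') * s ^ 2 = s' * s * (s * dR r') - (r' * s) * dR s' * s"
    by (simp add: algebra_simps power2_eq_square)
  also have "s * dR r' = r * dR s' + s' * dR r - r' * dR s"
    using d by (simp add: algebra_simps)
  also have "s' * s * (r * dR s' + s' * dR r - r' * dR s) - (r' * s) * dR s' * s =
      s' * s * (s' * dR r) - s' * dR s * (r' * s) + s * dR s' * (r * s') - s * dR s' * (r' * s)"
    by (simp add: algebra_simps)
  also have "\<dots> = (s * dR r - r * dR s) * s' ^ 2"
    unfolding eq[symmetric] by (simp add: algebra_simps power2_eq_square)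
  finally show "v = (s * dR r - r * dR s) / s ^ 2"
    unfolding *(5) using * assms by (simp add: frac_eq_eq)
qed

lemma dR_1 [simp]: "dR 1 = 0" and dR_x: "dR x = y"
  and dR_y: "dR y = poly (pderiv f) x / 2"
  and dR_const: "c \<in> L \<Longrightarrow> dR c = 0"
  using dR_elt[of 1 0] dR_elt[of "[:0, 1:]" 0] dR_elt[of 0 1] dR_elt[of "[:c:]" 0]
  by (simp_all add: elt_x elt_y elt_const polys_mems ring_mems pderiv_pCons)
     (simp_all add: elt_def)

lemma \<delta>_R: "r \<in> R \<Longrightarrow> \<delta> r = dR r"
  using \<delta>_quotient[of r 1] R.one_mem by simp

lemma \<delta>_x: "\<delta> x = y" and \<delta>_y: "\<delta> y = poly (pderiv f) x / 2"
  and \<delta>_const: "c \<in> L \<Longrightarrow> \<delta> c = 0"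
  using L_sub_R by (auto simp: \<delta>_R dR_x dR_y dR_const x_mem_R y_mem_R)

lemma \<delta>_mem: "z \<in> E \<Longrightarrow> \<delta> z \<in> E"
  by (auto elim!: E_E simp: \<delta>_quotient intro!: E_I R.ring_mems dR_mem)

lemma derivation_\<delta>: "derivation_on E \<delta>"
  unfolding derivation_on_def
proof safe
  fix a b assume "a \<in> E" "b \<in> E"
  then obtain r s t u where *: "r \<in> R" "s \<in> R" "s \<noteq> 0" "a = r / s" "t \<in> R" "u \<in> R" "u \<noteq> 0" "b = t / u"
    by (auto elim!: E_E)
  then have eq: "a + b = (r * u + t * s) / (s * u)" "a * b = (r * t) / (s * u)"
    by (auto simp: field_simps)
  have \<delta>: "\<delta> (a + b) = (s * u * dR (r * u + t * s) - (r * u + t * s) * dR (s * u)) / (s * u) ^ 2"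
    "\<delta> (a * b) = (s * u * dR (r * t) - r * t * dR (s * u)) / (s * u) ^ 2"
    unfolding eq by (rule \<delta>_quotient; use * in \<open>simp add: R.ring_mems\<close>)+
  have dab: "\<delta> a = (s * dR r - r * dR s) / s ^ 2" "\<delta> b = (u * dR t - t * dR u) / u ^ 2"
    using * by (simp_all add: \<delta>_quotient)
  have d: "dR (r * u + t * s) = r * dR u + u * dR r + (t * dR s + s * dR t)"
    "dR (s * u) = s * dR u + u * dR s" "dR (r * t) = r * dR t + t * dR r"
    using * by (simp_all add: dR_add dR_mult R.mult_mem)
  show "\<delta> (a + b) = \<delta> a + \<delta> b"
    unfolding \<delta> dab d using *(3,7)
    by (simp add: divide_simps) (simp add: algebra_simps power2_eq_square)
  show "\<delta> (a * b) = a * \<delta> b + b * \<delta> a"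
    unfolding \<delta> dab d unfolding *(4,8) using *(3,7)
    by (simp add: divide_simps) (simp add: algebra_simps power2_eq_square)
qed

end

text \<open>The denominator s^2 of the quotient rule is non-zero at the point if s is.\<close>

lemma (in point) \<delta>_O:
  assumes "z \<in> O_pt"
  shows "\<delta> z \<in> O_pt"
proof -
  obtain r s where *: "r \<in> R" "s \<in> R" "ev s \<noteq> 0" "s \<noteq> 0" "z = r / s"
    using assms by (elim O_E)
  then show ?thesis
    by (auto simp: \<delta>_quotient ev_power intro!: O_I R.ring_mems dR_mem)
qed

section \<open>Integrality\<close>

text \<open>The coordinate ring is the intersection of its local rings. In h c(x) = a + b y the
  roots \<alpha> of the denominator c are removed one by one: the right-hand side vanishes at both
  points over \<alpha>, so a(\<alpha>) = 0 and b(\<alpha>) \<beta> = 0. Either X - \<alpha> cancels,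
  or \<beta> = 0 and y would be a unit at a ramified point.\<close>

lemma (in double_cover_field) mem_R_if_regular:
  assumes closed: "\<And>p z. p \<in> polys L \<Longrightarrow> p \<noteq> 0 \<Longrightarrow> poly p z = 0 \<Longrightarrow> z \<in> L"
    and "h \<in> E"
    and reg: "\<And>\<alpha> \<beta>. point L x y f \<alpha> \<beta> \<Longrightarrow> h \<in> point.O_pt L x y \<alpha> \<beta>"
  shows "h \<in> R"
proof -
  have "h \<in> R" if "a \<in> polys L" "b \<in> polys L" "c \<in> polys L" "c \<noteq> 0" "h * poly c x = elt a b" for a b c
    using that
  proof (induction "degree c" arbitrary: a b c rule: less_induct)
    case less
    show ?case
    proof (cases "degree c = 0")
      case True
      then obtain c0 where c: "c = [:c0:]" by (metis degree_eq_zeroE)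
      then have "c0 \<noteq> 0" "c0 \<in> L"
        using less.prems by (auto simp: polys_def split: nat.splits dest: spec[of _ 0])
      then have "h = inverse c0 * elt a b"
        using less.prems(5) c by (simp add: field_simps)
      then show ?thesis
        using less.prems \<open>c0 \<in> L\<close> L_sub_R by (auto intro!: R.mult_mem elt_mem inverse_mem)
    next
      case False
      then obtain \<alpha> where \<alpha>: "poly c \<alpha> = 0"
        using alg_closed_imp_poly_has_root by blast
      then have "\<alpha> \<in> L" using closed less.prems by blast
      obtain \<beta> where \<beta>: "\<beta> ^ 2 = poly f \<alpha>"
        using nth_root_exists[of 2 "poly f \<alpha>"] by auto
      have "poly [:- poly f \<alpha>, 0, 1:] \<beta> = 0"
        using \<beta> by (simp add: power2_eq_square)
      then have "\<beta> \<in> L"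
        by (rule closed[rotated 2]) (use \<open>\<alpha> \<in> L\<close> f_mem in \<open>auto intro!: polys_mems mems poly_mem\<close>)
      interpret P: point L x y f \<alpha> \<beta>
        by unfold_locales fact+
      \<comment> \<open>The conjugate point over \<alpha>; it coincides with the first one if
        \<beta> = 0.\<close>
      interpret P': point L x y f \<alpha> "- \<beta>"
        by unfold_locales (use \<open>\<alpha> \<in> L\<close> \<open>\<beta> \<in> L\<close> \<beta> in \<open>auto simp: uminus_mem\<close>)
      obtain c1 where c1: "c1 \<in> polys L" "c = [:-\<alpha>, 1:] * c1"
        using polys_root_factor[OF less.prems(3) \<open>\<alpha> \<in> L\<close> \<alpha>] by metis
      have "c1 \<noteq> 0" using c1 less.prems(4) by auto
      then have deg: "degree c1 < degree c"
        unfolding c1(2) by (subst degree_mult_eq) auto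
      have h: "elt a b = (x - \<alpha>) * (h * poly c1 x)"
        using less.prems(5) unfolding c1(2) by (simp add: algebra_simps)
      have xa: "x - \<alpha> \<noteq> 0" using P.x_diff_nz \<open>\<alpha> \<in> L\<close> by blast
      have c1R: "poly c1 x \<in> R"
        using elt_mem[OF c1(1) polys_0] by (simp add: elt_def)
      have hc1: "h * poly c1 x \<in> P.O_pt" "h * poly c1 x \<in> P'.O_pt"
        using reg[OF P.point_axioms] reg[OF P'.point_axioms] c1R P.R_sub_O P'.R_sub_O
          P.O.mult_mem P'.O.mult_mem by blast+
      have ab: "elt a b \<in> R" using less.prems elt_mem by blast
      have "P.ev (elt a b) = 0"
      proof (rule ccontr)
        assume *: "P.ev (elt a b) \<noteq> 0"
        then have "inverse (elt a b) \<in> P.O_pt"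
          using P.O_I[OF R.one_mem ab] by (simp add: inverse_eq_divide)
        moreover have "elt a b \<in> nonunits P.O_pt"
          unfolding h by (rule P.O.nonunits_mult[OF P.x_diff_nonunit hc1(1)])
        ultimately show False using * by (auto simp: nonunits_def)
      qed
      then have 1: "poly a \<alpha> + poly b \<alpha> * \<beta> = 0"
        using less.prems P.ev_elt by simp
      have "P'.ev (elt a b) = 0"
      proof (rule ccontr)
        assume *: "P'.ev (elt a b) \<noteq> 0"
        then have "inverse (elt a b) \<in> P'.O_pt"
          using P'.O_I[OF R.one_mem ab] by (simp add: inverse_eq_divide)
        moreover have "elt a b \<in> nonunits P'.O_pt"
          unfolding h by (rule P'.O.nonunits_mult[OF P'.x_diff_nonunit hc1(2)])
        ultimately show False using * by (auto simp: nonunits_def)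
      qed
      then have 2: "poly a \<alpha> - poly b \<alpha> * \<beta> = 0"
        using less.prems P'.ev_elt by simp
      have "2 * poly a \<alpha> = (poly a \<alpha> + poly b \<alpha> * \<beta>) + (poly a \<alpha> - poly b \<alpha> * \<beta>)"
        by (simp add: algebra_simps)
      then have "2 * poly a \<alpha> = 0" unfolding 1 2 by simp
      then have a0: "poly a \<alpha> = 0" using two_nz by (metis mult_eq_0_iff)
      then obtain a1 where a1: "a1 \<in> polys L" "a = [:-\<alpha>, 1:] * a1"
        using polys_root_factor less.prems(1) \<open>\<alpha> \<in> L\<close> by blast
      show ?thesis
      proof (cases "poly b \<alpha> = 0")
        case True
        then obtain b1 where b1: "b1 \<in> polys L" "b = [:-\<alpha>, 1:] * b1"
          using polys_root_factor less.prems(2) \<open>\<alpha> \<in> L\<close> by blast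
        have "elt a b = (x - \<alpha>) * elt a1 b1"
          unfolding a1(2) b1(2) by (simp add: elt_def algebra_simps)
        then have "h * poly c1 x = elt a1 b1" using h xa by simp
        then show ?thesis using less.hyps[OF deg a1(1) b1(1) c1(1) \<open>c1 \<noteq> 0\<close>] by blast
      next
        case False
        then have "\<beta> = 0" using 1 a0 by simp
        then have "poly f \<alpha> = 0" using \<beta> by simp
        obtain q where q: "q \<in> polys L" "f = [:-\<alpha>, 1:] * q"
          using polys_root_factor f_mem \<open>\<alpha> \<in> L\<close> \<open>poly f \<alpha> = 0\<close> by blast
        have q\<alpha>: "poly q \<alpha> \<noteq> 0"
          using smooth[OF \<open>poly f \<alpha> = 0\<close>] unfolding q pderiv_mult
          by (simp add: pderiv_pCons del: mult_pCons_left)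
        \<comment> \<open>Multiplying the equation by q(x) and cancelling y gives (h c1 - a1) y = b
          q, whose right-hand side is a unit of the local ring; so 1/y would be regular at a point
          where y vanishes.\<close>
        have y2: "y * y = (x - \<alpha>) * poly q x"
          using y_sq unfolding q(2) by (simp add: power2_eq_square algebra_simps)
        have "y \<noteq> 0" using elt_eq_0[of 0 1] by (auto simp: elt_y polys_mems)
        have bq: "elt (b * q) 0 \<in> R" "P.ev (elt (b * q) 0) \<noteq> 0"
          using less.prems q q\<alpha> False by (auto simp: elt_mem P.ev_elt polys_mems)
        have "h * poly c1 x * (x - \<alpha>) = poly a1 x * (x - \<alpha>) + poly b x * y"
          using h unfolding a1(2) by (simp add: elt_def algebra_simps)
        then have "(h * poly c1 x - poly a1 x) * (x - \<alpha>) = poly b x * y"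
          by (simp add: algebra_simps)
        then have "(h * poly c1 x - poly a1 x) * (y * y) = poly b x * y * poly q x"
          unfolding y2 by (metis mult.assoc)
        then have "(h * poly c1 x - poly a1 x) * y = elt (b * q) 0"
          using \<open>y \<noteq> 0\<close> by (simp add: elt_def mult.assoc[symmetric])
        then have "inverse y = (h * poly c1 x - poly a1 x) * inverse (elt (b * q) 0)"
          using \<open>y \<noteq> 0\<close> bq by (auto simp: field_simps)
        moreover have "poly a1 x \<in> P.O_pt"
          using elt_mem[OF a1(1) polys_0] P.R_sub_O by (auto simp: elt_def)
        moreover have "inverse (elt (b * q) 0) \<in> P.O_pt"
          using P.O_I[OF R.one_mem bq] by (simp add: inverse_eq_divide)
        ultimately have "inverse y \<in> P.O_pt"
          using hc1 by (simp add: P.O.mult_mem P.O.diff_mem)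
        then show ?thesis
          using P.inverse_notin_O[OF y_mem_R _ \<open>y \<noteq> 0\<close>] P.ev_y \<open>\<beta> = 0\<close> by simp
      qed
    qed
  qed
  then show ?thesis using \<open>h \<in> E\<close> by (metis E_E_poly)
qed

section \<open>The chart at infinity\<close>

text \<open>If (X - t)^2 divides the reversed polynomial, then reversing again shows that (1 - t
  X)^2 divides f. Double reversal loses the factors X of f, so these are split off first. The root t
  is non-zero because the constant term of the reversed polynomial is the leading coefficient of
  f.\<close>

lemma reflect_poly_double_root:
  fixes f :: "'a::field poly"
  assumes "poly (reflect_poly f) t = 0" "poly (pderiv (reflect_poly f)) t = 0" "f \<noteq> 0"
  shows "poly f (1 / t) = 0 \<and> poly (pderiv f) (1 / t) = 0"
proof -
  define G where "G = reflect_poly f"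
  have "t \<noteq> 0" using assms by auto
  obtain q where q: "G = [:-t, 1:] * q"
    using assms(1) by (auto simp: poly_eq_0_iff_dvd G_def)
  have "poly q t = 0"
    using assms(2) unfolding G_def[symmetric] q pderiv_mult
    by (simp add: pderiv_pCons del: mult_pCons_left)
  then obtain r where r: "q = [:-t, 1:] * r"
    by (auto simp: poly_eq_0_iff_dvd)
  obtain f0 where f0: "f = [:- 0, 1:] ^ order 0 f * f0" "\<not> [:- 0, 1:] dvd f0"
    using order_decomp[OF assms(3)] by blast
  have "coeff f0 0 \<noteq> 0"
    using f0(2) unfolding poly_eq_0_iff_dvd[symmetric] by (simp add: poly_0_coeff_0)
  have X: "reflect_poly [:0, 1:] = (1 :: 'a poly)"
    by (simp add: reflect_poly_pCons' numeral_eq_Suc reflect_poly_simps)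
  have "G = reflect_poly f0"
    unfolding G_def by (subst f0(1)) (simp add: reflect_poly_mult reflect_poly_power X del: mult_pCons_left)
  then have "f0 = reflect_poly G"
    using \<open>coeff f0 0 \<noteq> 0\<close> by simp
  also have "\<dots> = reflect_poly [:-t, 1:] * (reflect_poly [:-t, 1:] * reflect_poly r)"
    unfolding q r by (simp only: reflect_poly_mult)
  also have "reflect_poly [:-t, 1:] = [:1, -t:]"
    using \<open>t \<noteq> 0\<close> by (simp add: reflect_poly_pCons)
  finally have f0': "f0 = [:1, -t:] * ([:1, -t:] * reflect_poly r)" .
  obtain u where u: "f = [:1, -t:] * ([:1, -t:] * u)"
  proof
    show "f = [:1, -t:] * ([:1, -t:] * (reflect_poly r * [:- 0, 1:] ^ order 0 f))"
      by (subst f0(1), subst f0') (simp only: mult_ac)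
  qed
  show ?thesis
    unfolding u pderiv_mult using \<open>t \<noteq> 0\<close> by (simp del: mult_pCons_left)
qed

lemma poly_reflect: "t \<noteq> 0 \<Longrightarrow> poly (reflect_poly p) t = t ^ degree p * poly p (1 / t)" for t :: "'a::field"
  by (simp add: poly_reflect_poly_nz inverse_eq_divide)

lemma transc_inverse:
  assumes "subfld L" "transc L x" "x \<noteq> 0"
  shows "transc L (1 / x)"
  unfolding transc_def
proof safe
  fix p assume p: "p \<in> polys L" "poly p (1 / x) = 0"
  then have "poly (reflect_poly p) x = 0"
    using assms by (simp add: poly_reflect)
  moreover have "reflect_poly p \<in> polys L"
    using p assms subrng.polys_reflect subfld_def by blast
  ultimately show "p = 0"
    using transcD[OF assms(2)] by fastforce
qed

text \<open>As the degree is even, the square of y / x^(g+1) is exactly the reversed polynomial at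
  1/x, without an additional factor 1/x. \<open>g_pos\<close> makes g - 1 in later exponents a true
  difference.\<close>

locale hyperelliptic_model = double_cover_field L x y f for L x y f +
  fixes g :: nat
  assumes degree_f: "degree f = 2 * g + 2" and g_pos: "g > 0"
begin

definition s :: 'a where "s = 1 / x"
definition w :: 'a where "w = y / x ^ (g + 1)"

lemma x_nz: "x \<noteq> 0"
  using transcD[OF transc, of "[:0, 1:]"] polys_mems ring_mems by auto

lemma y_nz: "y \<noteq> 0"
  using elt_eq_0[of 0 1] by (auto simp: elt_y polys_mems)

lemma s_nz: "s \<noteq> 0"
  by (simp add: s_def x_nz)

text \<open>The reversed polynomial is constant only if f is a monomial, and then 0 would be a
  multiple root of f.\<close>

lemma degree_reflect_pos: "degree (reflect_poly f) > 0"
proof (rule ccontr)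
  assume "\<not> ?thesis"
  then have "coeff (reflect_poly f) i = 0" if "i > 0" for i
    using that coeff_eq_0[of "reflect_poly f" i] by simp
  from this[of "degree f"] this[of "degree f - 1"] have "coeff f 0 = 0" "coeff f 1 = 0"
    using deg_f degree_f by (simp_all add: coeff_reflect_poly)
  then have "poly f 0 = 0" "poly (pderiv f) 0 = 0"
    by (simp_all add: poly_0_coeff_0 coeff_pderiv)
  then show False using smooth by blast
qed

sublocale inf: double_cover_field L s w "reflect_poly f"
proof
  show "transc L s"
    unfolding s_def using transc_inverse transc x_nz subfld_axioms by blast
  show "reflect_poly f \<in> polys L"
    by (rule polys_reflect[OF f_mem])
  show "degree (reflect_poly f) > 0" by (rule degree_reflect_pos)
  show "w ^ 2 = poly (reflect_poly f) s"
  proof -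
    have "poly (reflect_poly f) s = s ^ (2 * g + 2) * poly f x"
      using poly_reflect[of s f] s_nz by (simp add: s_def degree_f)
    moreover have "w = y * s ^ (g + 1)"
      by (simp add: w_def s_def power_one_over)
    moreover have "(s ^ (g + 1)) ^ 2 = s ^ (2 * g + 2)"
      unfolding power_mult[symmetric] by (simp add: algebra_simps)
    ultimately show ?thesis
      by (simp only: power_mult_distrib y_sq mult.commute)
  qed
  show "poly (pderiv (reflect_poly f)) a \<noteq> 0" if "poly (reflect_poly f) a = 0" for a
    using reflect_poly_double_root[OF that _ f_nz] smooth by blast
qed (rule two_nz)

lemma inf_E: "inf.E = E"
proof
  have "x \<in> E" "y \<in> E" using x_mem_R y_mem_R R_sub_E by auto
  then show "inf.E \<subseteq> E"
    using L_sub_R R_sub_E unfolding s_def w_def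
    by (intro inf.E_least[unfolded s_def w_def] E.subfld_axioms) (auto simp: E.mems)
  have sw: "s \<in> inf.E" "w \<in> inf.E" using inf.x_mem_R inf.y_mem_R inf.R_sub_E by auto
  have "x = 1 / s" "y = w / s ^ (g + 1)"
    using x_nz by (simp_all add: s_def w_def field_simps)
  then show "E \<subseteq> inf.E"
    using inf.L_sub_R inf.R_sub_E sw inf.E.divide_mem inf.E.power_mem inf.E.one_mem
    by (intro E_least inf.E.subfld_axioms) (blast, metis, metis)
qed

lemma derivation_s:
  assumes "derivation_on E d" "d 1 = 0"
  shows "d s = - (s ^ 2 * d x)"
  using E.derivation_inverse[OF assms(1) _ assms(2) x_nz] x_mem_R R_sub_E
  by (auto simp: s_def inverse_eq_divide power_divide)

end

section \<open>Extending the constants\<close>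

text \<open>L is an algebraic closure of k within the universal domain. Both function fields are
  generated by the same x and y, since x remains transcendental over L.\<close>

locale constant_extension =
  k: double_cover_field k x y f + L: double_cover_field L x y f
  for k L :: "'a::alg_closed_field set" and x y f +
  assumes k_sub_L: "k \<subseteq> L"
    and alg: "z \<in> L \<Longrightarrow> \<exists>p\<in>polys k. p \<noteq> 0 \<and> poly p z = 0"
    and closed: "p \<in> polys L \<Longrightarrow> p \<noteq> 0 \<Longrightarrow> poly p z = 0 \<Longrightarrow> z \<in> L"
begin

abbreviation F :: "'a set" where "F \<equiv> k.E"

lemma R_sub: "k.R \<subseteq> L.R"
  using polys_mono[OF k_sub_L] by (auto simp: k.R_def L.R_def)

lemma F_sub: "F \<subseteq> L.E"
  using R_sub by (auto simp: k.E_def L.E_def)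

lemma xy_mem: "x \<in> F" "y \<in> F"
  using k.x_mem_R k.y_mem_R k.R_sub_E by auto

lemma k_sub_F: "k \<subseteq> F"
  using k.L_sub_R k.R_sub_E by blast

text \<open>The contraction to F must not be all of F. As \<alpha> is algebraic over k, there is a
  non-zero p in k[X] with p(\<alpha>) = 0, and 1 / p(x) is an element of F with a pole at the
  point.\<close>

lemma restrict_place:
  assumes "point L x y f \<alpha> \<beta>"
  shows "point.O_pt L x y \<alpha> \<beta> \<inter> F \<in> places k F"
proof -
  interpret P: point L x y f \<alpha> \<beta> by fact
  have "subrng (P.O_pt \<inter> F)"
    by unfold_locales (auto simp: P.O.ring_mems k.E.ring_mems)
  moreover have "x \<notin> k" using k.elt_inj[of "[:0,1:]" 0 "[:x:]" 0]
    by (auto simp: k.elt_x k.elt_const k.polys_mems k.ring_mems)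
  moreover have "x \<in> P.O_pt" using L.x_mem_R P.R_sub_O by auto
  moreover have "k \<subseteq> P.O_pt" using L.L_sub_R P.R_sub_O k_sub_L by blast
  moreover have "\<exists>z\<in>F. z \<notin> P.O_pt"
  proof -
    obtain p where p: "p \<in> polys k" "p \<noteq> 0" "poly p \<alpha> = 0"
      using alg P.pt_mem by blast
    then have "poly p x \<noteq> 0" using k.transc transcD by blast
    have pL: "p \<in> polys L" using p polys_mono[OF k_sub_L] by blast
    have "poly p x = L.elt p 0" by (simp add: L.elt_def)
    then have "inverse (poly p x) \<notin> P.O_pt"
      using P.inverse_notin_O[of "poly p x"] pL p \<open>poly p x \<noteq> 0\<close>
      by (simp add: L.elt_mem P.ev_elt L.polys_mems)
    moreover have "poly p x \<in> F"
      using k.elt_mem[OF p(1) k.polys_0] k.R_sub_E by (auto simp: k.elt_def)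
    ultimately show ?thesis using k.E.inverse_mem by blast
  qed
  moreover have "z \<in> P.O_pt \<inter> F \<or> inverse z \<in> P.O_pt \<inter> F" if "z \<in> F" for z
    using P.val_O that F_sub k.E.inverse_mem by blast
  ultimately show ?thesis
    using k_sub_F xy_mem by (auto simp: places_def subring_Omega_iff)
qed

lemma \<delta>_eq:
  assumes "z \<in> F"
  shows "L.\<delta> z = k.\<delta> z"
proof (rule k.E.derivations_eqI[OF _ _ k.subfld_axioms k_sub_F, of L.\<delta> k.\<delta> "{x, y}"])
  show "derivation_on F L.\<delta>" using derivation_on_subset[OF L.derivation_\<delta> F_sub] .
  show "derivation_on F k.\<delta>" by (rule k.derivation_\<delta>)
  show "{x, y} \<subseteq> F" using xy_mem by simp
  show "F \<subseteq> adjoin k {x, y}" by (rule equalityD2[OF k.adjoin_eq_E])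
qed (use k_sub_L assms in \<open>auto simp: L.\<delta>_const k.\<delta>_const L.\<delta>_x k.\<delta>_x L.\<delta>_y k.\<delta>_y\<close>)

lemma \<delta>_derivation: "restrict k.\<delta> F \<in> derivations k F"
  using k.derivation_\<delta> k.\<delta>_mem k_sub_F
  by (auto simp: derivations_def derivation_on_def k.\<delta>_const k.E.ring_mems subset_iff)

text \<open>At the place that a point over L cuts out on F, the differential is a sum of terms h dt
  with h and t regular there; \<delta> keeps t regular, so the value at \<delta> is regular at every
  point over L.\<close>

lemma regular_value_mem:
  assumes "\<omega> \<in> regular_differentials k F"
  shows "\<omega> (restrict k.\<delta> F) \<in> L.R"
proof (rule L.mem_R_if_regular)
  \<comment> \<open>Used twice: with A = F and B the function field over L, and with A the
    contraction of the local ring B of a point.\<close>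
  have *: "\<omega> (restrict k.\<delta> F) \<in> B"
    if as: "\<omega> \<in> differentials k F A" "A \<subseteq> F" "A \<subseteq> B" "subrng B" "\<And>z. z \<in> A \<Longrightarrow> k.\<delta> z \<in> B" for A B
  proof -
    interpret B: subrng B by fact
    obtain n :: nat and h t where \<omega>: "\<omega> = (\<lambda>D\<in>derivations k F. \<Sum>i<n. h i * D (t i))"
      "\<forall>i<n. h i \<in> A \<and> t i \<in> A"
      using as(1) unfolding differentials_def by blast
    have "\<omega> (restrict k.\<delta> F) = (\<Sum>i<n. h i * k.\<delta> (t i))"
      using \<omega> \<delta>_derivation that(2) by (auto intro!: sum.cong)
    also have "\<dots> \<in> B"
      using \<omega>(2) that by (intro B.sum_mem B.mult_mem) auto
    finally show ?thesis .
  qed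
  show "\<omega> (restrict k.\<delta> F) \<in> L.E"
    by (rule *[of F]) (use assms F_sub k.\<delta>_mem L.E.subrng_axioms in \<open>auto simp: regular_differentials_def\<close>)
  fix \<alpha> \<beta> assume P: "point L x y f \<alpha> \<beta>"
  then interpret P: point L x y f \<alpha> \<beta> .
  have "k.\<delta> z \<in> P.O_pt" if "z \<in> P.O_pt \<inter> F" for z
    using P.\<delta>_O[of z] \<delta>_eq[of z] that by simp
  then show "\<omega> (restrict k.\<delta> F) \<in> P.O_pt"
    by (intro *[of "P.O_pt \<inter> F"])
       (use assms restrict_place[OF P] P.O.subrng_axioms in
         \<open>auto simp: regular_differentials_def\<close>)
qed (use closed in blast)

end

text \<open>The leading coefficient of a is a quotient of two leading coefficients in A; after
  subtraction of the leading term the induction continues.\<close>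

lemma (in subfld) polys_quotient:
  assumes "a * q \<in> polys A" "q \<in> polys A" "q \<noteq> 0"
  shows "a \<in> polys A"
  using assms(1)
proof (induction "degree a" arbitrary: a rule: less_induct)
  case less
  show ?case
  proof (cases "a = 0")
    case False
    have "lead_coeff a * lead_coeff q \<in> A"
      using less.prems by (simp add: polys_def flip: lead_coeff_mult)
    then have "lead_coeff a * lead_coeff q / lead_coeff q \<in> A"
      using assms(2) by (intro divide_mem) (auto simp: polys_def)
    then have lc: "lead_coeff a \<in> A" using assms(3) by simp
    define b where "b = a - monom (lead_coeff a) (degree a)"
    have a: "a = b + monom (lead_coeff a) (degree a)" by (simp add: b_def)
    have bq: "b * q \<in> polys A"
      using less.prems assms(2) lc by (auto simp: b_def left_diff_distrib intro!: polys_mems)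
    have "b \<in> polys A"
    proof (cases "degree a = 0")
      case True
      then have "b = 0"
        by (auto simp: b_def monom_0 elim: degree_eq_zeroE)
      then show ?thesis by (simp add: polys_0)
    next
      case False
      have "degree b < degree a"
        unfolding b_def using False
        by (intro degree_lessI) (auto simp: coeff_eq_0)
      then show ?thesis using less.hyps bq by blast
    qed
    then show ?thesis
      using lc by (subst a) (auto intro!: polys_mems)
  qed (simp add: polys_0)
qed

context constant_extension
begin

text \<open>With a(x) written as a fraction over k, the uniqueness of coordinates over L gives a c =
  a' with a' and c in k[X], and an exact division of polynomials does not leave k[X].\<close>

lemma poly_descent:
  assumes "a \<in> polys L" "poly a x \<in> F"
  shows "a \<in> polys k"
proof -
  obtain a' b' c where *: "a' \<in> polys k" "b' \<in> polys k" "c \<in> polys k" "c \<noteq> 0"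
    "poly a x * poly c x = k.elt a' b'"
    using k.E_E_poly[OF assms(2)] by blast
  have "L.elt (a * c) 0 = L.elt a' b'"
    unfolding *(5)[symmetric] by (simp add: k.elt_def)
  then have "a * c = a'"
    using L.elt_inj[of "a * c" 0 a' b'] *(1-3) assms(1) polys_mono[OF k_sub_L]
      L.polys_0 L.polys_mult[of a c] by (auto simp: subset_iff)
  then show ?thesis
    using k.polys_quotient * by blast
qed

text \<open>The case of constant polynomials. As an element algebraic over k lies in L, this makes k
  algebraically closed in F.\<close>

lemma constants:
  assumes "z \<in> F" "z \<in> L"
  shows "z \<in> k"
proof -
  have "[:z:] \<in> polys k"
    using assms by (intro poly_descent) (auto intro!: L.polys_mems)
  then show ?thesis by (auto simp: polys_def dest!: spec[of _ 0])
qed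

end

section \<open>The genus\<close>

lemma differentials_single:
  "h \<in> A \<Longrightarrow> t \<in> A \<Longrightarrow> (\<lambda>D\<in>derivations k F. h * D t) \<in> differentials k F A"
  unfolding differentials_def
  by (intro CollectI exI[of _ "1::nat"] exI[of _ "\<lambda>_. h"] exI[of _ "\<lambda>_. t"]) auto

text \<open>\<open>bezout\<close> has its cofactors over k so that it can be used at every place of
  F over k, whatever its residue field.\<close>

locale hyperelliptic_extension =
  k: hyperelliptic_model k x y f g + L: hyperelliptic_model L x y f g
  for k L :: "'a::alg_closed_field set" and x y f g +
  assumes k_sub_L: "k \<subseteq> L"
    and alg: "z \<in> L \<Longrightarrow> \<exists>p\<in>polys k. p \<noteq> 0 \<and> poly p z = 0"
    and closed: "p \<in> polys L \<Longrightarrow> p \<noteq> 0 \<Longrightarrow> poly p z = 0 \<Longrightarrow> z \<in> L"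
    and bezout: "\<exists>u\<in>polys k. \<exists>v\<in>polys k. u * f + v * pderiv f = 1"
begin

sublocale constant_extension k L x y f
  by unfold_locales (fact k_sub_L alg closed)+

sublocale inf: constant_extension k L k.s k.w "reflect_poly f"
  by unfold_locales (fact k_sub_L alg closed)+

lemma inf_F: "inf.F = F"
  by (rule k.inf_E)

section \<open>The derivations of F over k as multiples of \<delta>\<close>

lemma derivationsD:
  assumes "D \<in> derivations k F"
  shows "derivation_on F D" "c \<in> k \<Longrightarrow> D c = 0" "z \<in> F \<Longrightarrow> D z \<in> F" "D \<in> extensional F"
  using assms by (auto simp: derivations_def derivation_on_def PiE_def)

lemma derivation_poly:
  assumes "D \<in> derivations k F" "p \<in> polys k"
  shows "D (poly p x) = poly (pderiv p) x * D x"
  using assms(2)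
proof (induction p)
  case 0
  then show ?case using derivationsD(2)[OF assms(1)] k.zero_mem by simp
next
  case (pCons a p)
  have ap: "a \<in> k" "p \<in> polys k"
    using pCons.prems by (auto simp: polys_def coeff_pCons split: nat.splits)
  then have "a \<in> F" "poly p x \<in> F"
    using k_sub_F xy_mem polys_mono[OF k_sub_F] k.E.poly_mem by auto
  then show ?case
    using pCons.IH[OF ap(2)] ap derivationsD(1,2)[OF assms(1)] xy_mem k.E.mult_mem
    by (simp add: derivation_on_def pderiv_pCons algebra_simps)
qed

lemma derivation_y:
  assumes "D \<in> derivations k F"
  shows "2 * y * D y = poly (pderiv f) x * D x"
proof -
  have "D (y * y) = y * D y + y * D y"
    using derivationsD(1)[OF assms] xy_mem by (simp add: derivation_on_def)
  moreover have "y * y = poly f x"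
    using k.y_sq by (simp add: power2_eq_square)
  ultimately show ?thesis
    using derivation_poly[OF assms k.f_mem] by simp
qed

text \<open>D is determined by D x, for differentiating y^2 = f(x) gives D y; the factor D x / y
  makes both sides agree at x and y.\<close>

lemma derivation_eq:
  assumes "D \<in> derivations k F" "z \<in> F"
  shows "D z = D x / y * k.\<delta> z"
proof (rule k.E.derivations_eqI[OF _ _ k.subfld_axioms k_sub_F, of D "\<lambda>z. D x / y * k.\<delta> z" "{x, y}"])
  show "derivation_on F D" by (rule derivationsD[OF assms(1)])
  show "derivation_on F (\<lambda>z. D x / y * k.\<delta> z)"
    using k.derivation_\<delta> by (auto simp: derivation_on_def algebra_simps add_divide_distrib)
  show "{x, y} \<subseteq> F" using xy_mem by simp
  show "F \<subseteq> adjoin k {x, y}" by (rule equalityD2[OF k.adjoin_eq_E])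
  show "D c = 0" if "c \<in> k" for c using derivationsD(2)[OF assms(1) that] .
  show "D x / y * k.\<delta> c = 0" if "c \<in> k" for c using k.\<delta>_const that by simp
  show "z \<in> F" by fact
  show "D u = D x / y * k.\<delta> u" if "u \<in> {x, y}" for u
  proof -
    have "D y = D x / y * k.\<delta> y"
      using derivation_y[OF assms(1)] k.y_nz k.two_nz by (simp add: k.\<delta>_y field_simps)
    then show ?thesis using that k.\<delta>_x k.y_nz by auto
  qed
qed

lemma derivation_s: "D \<in> derivations k F \<Longrightarrow> D k.s = - (k.s ^ 2 * D x)"
  using k.derivation_s derivationsD k.one_mem by blast

text \<open>The local generators are \<open>dx/y = 2 dy/f'(x)\<close> at the finite points, and at infinity, with
  \<open>s = 1/x\<close> and \<open>w = y s\<^sup>g\<^sup>+\<^sup>1\<close>, one has \<open>x\<^sup>i dx/y = - s\<^sup>g\<^sup>-\<^sup>1\<^sup>-\<^sup>i ds/w\<close>.\<close>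

lemma differential_regular_place:
  assumes p: "p \<in> polys k" "\<And>i. i \<ge> g \<Longrightarrow> coeff p i = 0" and A: "A \<in> places k F"
  shows "(\<lambda>D\<in>derivations k F. poly p x * D x / y) \<in> differentials k F A"
proof -
  interpret A: place k F A by unfold_locales fact
  have cong: "(\<lambda>D\<in>derivations k F. poly p x * D x / y) \<in> differentials k F A"
    if "h \<in> A" "t \<in> A" "\<And>D. D \<in> derivations k F \<Longrightarrow> poly p x * D x / y = h * D t" for h t
    using differentials_single[OF that(1,2), of k F] that(3)
    by (simp cong: restrict_cong)
  have kA: "polys k \<subseteq> polys A" using polys_mono[OF A.K_sub] .
  show ?thesis
  proof (cases "x \<in> A")
    case True
    then have px: "poly q x \<in> A" if "q \<in> polys k" for q
      using A.poly_mem kA that by blast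
    have "y \<in> A"
      by (rule A.square_mem) (use px[OF k.f_mem] k.y_sq xy_mem in auto)
    show ?thesis
    proof (cases "y \<in> nonunits A")
      case False
      then have "inverse y \<in> A" using A.unit_inverse \<open>y \<in> A\<close> by blast
      then show ?thesis
        using px[OF p(1)] True
        by (intro cong[of "poly p x * inverse y" x] A.mult_mem) (auto simp: field_simps)
    next
      case True
      obtain u v where uv: "u \<in> polys k" "v \<in> polys k" "u * f + v * pderiv f = 1"
        using bezout by blast
      have f': "poly (pderiv f) x \<in> A" using px k.polys_pderiv[OF k.f_mem] by blast
      \<comment> \<open>f(x) = y^2 is a nonunit here; if f'(x) were one too, then 1 = u f + v f'
        would be a nonunit.\<close>
      have "poly (pderiv f) x \<notin> nonunits A"
      proof
        assume *: "poly (pderiv f) x \<in> nonunits A"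
        have "poly f x \<in> nonunits A"
          using A.nonunits_mult[OF True \<open>y \<in> A\<close>] k.y_sq by (simp add: power2_eq_square)
        then have "poly f x * poly u x + poly (pderiv f) x * poly v x \<in> nonunits A"
          using px uv * by (intro A.nonunits_add A.nonunits_mult)
        moreover have "poly f x * poly u x + poly (pderiv f) x * poly v x = 1"
          using arg_cong[OF uv(3), of "\<lambda>q. poly q x"] by (simp add: mult.commute)
        ultimately show False using A.nonunits_K[OF k.one_mem] by simp
      qed
      then have inv: "inverse (poly (pderiv f) x) \<in> A" "poly (pderiv f) x \<noteq> 0"
        using A.unit_inverse f' A.zero_mem by (auto simp: nonunits_def)
      show ?thesis
      proof (rule cong)
        show "2 * poly p x * inverse (poly (pderiv f) x) \<in> A"
          using inv px[OF p(1)] A.numeral_mem[of "num.Bit0 num.One"] by (intro A.mult_mem)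
        show "y \<in> A" by fact
        fix D assume "D \<in> derivations k F"
        from derivation_y[OF this] have "D x = 2 * y * D y / poly (pderiv f) x"
          using inv by (simp add: field_simps)
        then show "poly p x * D x / y = 2 * poly p x * inverse (poly (pderiv f) x) * D y"
          using k.y_nz inv by (simp add: field_simps)
      qed
    qed
  next
    case False
    have "k.s \<in> nonunits A"
      using A.nonunit_inverse[of x] False xy_mem by (simp add: k.s_def inverse_eq_divide)
    then have "k.s \<in> A" by (rule A.nonunits_sub)
    have w2: "k.w ^ 2 = poly (reflect_poly f) k.s" by (rule k.inf.y_sq)
    have "k.w \<in> F" using inf.xy_mem inf_F by simp
    have rf: "reflect_poly f \<in> polys k" by (rule k.inf.f_mem)
    have "k.w \<in> A"
    proof (rule A.square_mem)
      show "k.w ^ 2 \<in> A"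
        unfolding w2 using A.poly_mem rf kA \<open>k.s \<in> A\<close> by blast
    qed fact
    \<comment> \<open>The residue of w^2 is the value of the reversed polynomial at 0, that is, the
      non-zero leading coefficient of f.\<close>
    have "k.w \<notin> nonunits A"
    proof
      assume "k.w \<in> nonunits A"
      then have "k.w ^ 2 \<in> nonunits A"
        using A.nonunits_mult \<open>k.w \<in> A\<close> by (simp add: power2_eq_square)
      moreover have "poly (reflect_poly f) k.s - poly (reflect_poly f) 0 \<in> nonunits A"
        using \<open>k.s \<in> nonunits A\<close> rf by (intro A.nonunits_poly_diff k.zero_mem) auto
      ultimately have "poly (reflect_poly f) 0 \<in> nonunits A"
        using A.nonunits_diff[of "poly (reflect_poly f) k.s"] w2 by force
      moreover have "poly (reflect_poly f) 0 \<in> k"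
        using k.poly_mem rf k.zero_mem by blast
      ultimately have "poly (reflect_poly f) 0 = 0" using A.nonunits_K by blast
      then show False using k.f_nz by simp
    qed
    then have "inverse k.w \<in> A" using A.unit_inverse \<open>k.w \<in> A\<close> by blast
    \<comment> \<open>p(x) / x^(g-1) as a polynomial in s; this is where the bound on the degree of
      p enters.\<close>
    define S where "S = (\<Sum>i<g. coeff p i * k.s ^ (g - 1 - i))"
    have "S \<in> A"
      unfolding S_def using p(1) A.K_sub \<open>k.s \<in> A\<close>
      by (intro A.sum_mem A.mult_mem A.power_mem) (auto simp: polys_def)
    have "poly p x = (\<Sum>i<g. coeff p i * x ^ i)"
    proof -
      have "degree p < g \<or> p = 0" using p(2) by (meson leading_coeff_0_iff not_le)
      then show ?thesis
      proof
        assume "degree p < g"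
        then have "(\<Sum>i<g. coeff p i * x ^ i) = (\<Sum>i\<le>degree p. coeff p i * x ^ i)"
          by (intro sum.mono_neutral_right) (auto simp: coeff_eq_0)
        then show ?thesis by (simp add: poly_altdef)
      qed simp
    qed
    also have "\<dots> = x ^ (g - 1) * S"
      unfolding S_def sum_distrib_left
    proof (intro sum.cong refl)
      fix i assume "i \<in> {..<g}"
      then have "x ^ (g - 1) = x ^ i * x ^ (g - 1 - i)" by (simp flip: power_add)
      then show "coeff p i * x ^ i = x ^ (g - 1) * (coeff p i * k.s ^ (g - 1 - i))"
        using k.x_nz by (simp add: k.s_def field_simps)
    qed
    finally have px: "poly p x = x ^ (g - 1) * S" .
    show ?thesis
    proof (rule cong)
      show "- (S * inverse k.w) \<in> A"
        using \<open>S \<in> A\<close> \<open>inverse k.w \<in> A\<close> by (intro A.uminus_mem A.mult_mem)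
      show "k.s \<in> A" by fact
      fix D assume D: "D \<in> derivations k F"
      have g: "x ^ (g + 1) = x ^ (g - 1) * x ^ 2"
        using k.g_pos by (simp flip: power_add)
      show "poly p x * D x / y = - (S * inverse k.w) * D k.s"
        unfolding derivation_s[OF D] px unfolding k.s_def k.w_def g
        using k.x_nz k.y_nz by (simp add: field_simps)
    qed
  qed
qed

lemma differential_mem:
  assumes "p \<in> polys k"
  shows "(\<lambda>D\<in>derivations k F. poly p x * D x / y) \<in> differentials k F F"
proof -
  have "poly p x / y \<in> F"
    using k.E.poly_mem[of p x] polys_mono[OF k_sub_F] assms xy_mem k.E.divide_mem by auto
  from differentials_single[OF this xy_mem(1), of k F] show ?thesis by simp
qed

lemma differential_value:
  assumes "\<omega> \<in> differentials k F F" "D \<in> derivations k F" "D' \<in> derivations k F"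
    "\<And>z. z \<in> F \<Longrightarrow> D z = c * D' z"
  shows "\<omega> D = c * \<omega> D'"
proof -
  obtain n :: nat and h t where \<omega>: "\<omega> = (\<lambda>D\<in>derivations k F. \<Sum>i<n. h i * D (t i))"
    "\<forall>i<n. h i \<in> F \<and> t i \<in> F"
    using assms(1) unfolding differentials_def by blast
  have "(\<Sum>i<n. h i * D (t i)) = (\<Sum>i<n. c * (h i * D' (t i)))"
    using assms(4) \<omega>(2) by (intro sum.cong) auto
  then show ?thesis
    using assms(2,3) by (simp add: \<omega>(1) sum_distrib_left)
qed

text \<open>The derivation D of the second chart has D s = w, while D s = - s^2 D x. Hence D x = - w
  / s^2 = - y s^(g-1), which determines the factor D x / y.\<close>

lemma inf_\<delta>_eq:
  assumes "z \<in> F"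
  shows "k.inf.\<delta> z = - (k.s ^ (g - 1)) * k.\<delta> z"
proof -
  have D: "restrict k.inf.\<delta> F \<in> derivations k F" (is "?D \<in> _")
    using inf.\<delta>_derivation by (simp add: inf_F)
  have "k.w = - (k.s ^ 2 * ?D x)"
    using derivation_s[OF D] inf.xy_mem by (simp add: inf_F k.inf.\<delta>_x)
  then have "k.s ^ 2 * ?D x = - k.w" by (metis minus_minus)
  then have "?D x = - k.w / k.s ^ 2"
    using k.s_nz by (metis nonzero_mult_div_cancel_left power_eq_0_iff)
  moreover have "k.w / k.s ^ 2 = y * k.s ^ (g - 1)"
  proof -
    have g: "x ^ (g + 1) = x ^ (g - 1) * x ^ 2"
      using k.g_pos by (simp flip: power_add)
    show ?thesis unfolding k.w_def k.s_def g using k.x_nz by (simp add: field_simps)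
  qed
  ultimately show ?thesis
    using derivation_eq[OF D assms] assms k.y_nz by simp
qed

text \<open>The value h at \<delta> is a + b y, and - s^(g-1) h = c(s) + d(s) w by regularity in the
  second chart. With m and n the degrees of c and d, and powers of x cleared, the coefficients of y
  give m + n + 2 + deg b \<le> m + n unless b = 0, and the remaining ones give deg a + 2 \<le> g + 1
  unless a = 0.\<close>

lemma regular_differential_form:
  assumes "\<omega> \<in> regular_differentials k F"
  obtains p where "p \<in> polys k" "\<forall>i\<ge>g. coeff p i = 0"
    "\<omega> = (\<lambda>D\<in>derivations k F. poly p x * D x / y)"
proof -
  have \<omega>: "\<omega> \<in> differentials k F F"
    using assms by (simp add: regular_differentials_def)
  have D: "restrict k.\<delta> F \<in> derivations k F" "restrict k.inf.\<delta> F \<in> derivations k F"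
    using \<delta>_derivation inf.\<delta>_derivation by (simp_all add: inf_F)
  define h where "h = \<omega> (restrict k.\<delta> F)"
  have "h \<in> L.R" unfolding h_def by (rule regular_value_mem[OF assms])
  then obtain a b where ab: "a \<in> polys L" "b \<in> polys L" "h = L.elt a b"
    by (elim L.R_E)
  have "\<omega> (restrict k.inf.\<delta> F) = - (k.s ^ (g - 1)) * h"
    unfolding h_def by (rule differential_value[OF \<omega> D(2,1)]) (simp add: inf_\<delta>_eq)
  moreover have "\<omega> (restrict k.inf.\<delta> F) \<in> L.inf.R"
    using inf.regular_value_mem[of \<omega>] assms by (simp add: inf_F)
  ultimately obtain c d where cd: "c \<in> polys L" "d \<in> polys L" "- (k.s ^ (g - 1)) * h = L.inf.elt c d"
    by (metis L.inf.R_E)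
  define m n where "m = degree c" and "n = degree d"
  have s: "1 / k.s = x" "k.s = 1 / x" using k.x_nz by (simp_all add: k.s_def)
  have cm: "x ^ m * poly c k.s = poly (reflect_poly c) x"
    and dn: "x ^ n * poly d k.s = poly (reflect_poly d) x"
    using k.x_nz by (simp_all add: poly_reflect m_def n_def s)
  have "h = - (x ^ (g - 1)) * L.inf.elt c d"
    unfolding cd(3)[symmetric] using k.x_nz by (simp add: k.s_def power_one_over)
  then have "h = - (x ^ (g - 1)) * (poly c k.s + poly d k.s * k.w)"
    by (simp only: L.inf.elt_def)
  also have "k.w = y / x ^ (g + 1)" by (rule k.w_def)
  also have "x ^ (g + 1) = x ^ (g - 1) * x ^ 2"
    using k.g_pos by (simp flip: power_add)
  finally have h_eq: "h = - (x ^ (g - 1)) * (poly c k.s + poly d k.s * (y / (x ^ (g - 1) * x ^ 2)))" .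
  have "x ^ (g - 1) * (poly d k.s * (y / (x ^ (g - 1) * x ^ 2))) = poly d k.s * y / x ^ 2"
    using k.x_nz by simp
  then have "h = - (x ^ (g - 1) * poly c k.s) - poly d k.s * y / x ^ 2"
    unfolding h_eq by (simp only: distrib_left mult_minus_left minus_add diff_conv_add_uminus)
  then have "x ^ 2 * h = - (x ^ 2 * (x ^ (g - 1) * poly c k.s)) - poly d k.s * y"
    using k.x_nz by (simp add: right_diff_distrib)
  then have "x ^ 2 * h = - (x ^ (g + 1) * poly c k.s) - poly d k.s * y"
    unfolding \<open>x ^ (g + 1) = x ^ (g - 1) * x ^ 2\<close> by (simp add: mult_ac)
  \<comment> \<open>The factor x^(m+n) clears the powers of s in c(s) and d(s); the earlier factor
    x^2 was the denominator left in x^(g-1) w = y / x^2.\<close>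
  then have "x ^ (m + n) * (x ^ 2 * h) =
      - (x ^ (n + g + 1) * (x ^ m * poly c k.s)) - x ^ m * (x ^ n * poly d k.s) * y"
    by (simp only: power_add) (simp add: algebra_simps)
  moreover have "L.elt (monom 1 (m + n + 2) * a) (monom 1 (m + n + 2) * b) = x ^ (m + n) * (x ^ 2 * h)"
    unfolding ab(3) by (simp add: L.elt_def poly_monom power_add power2_eq_square algebra_simps)
  moreover have "L.elt (- (monom 1 (n + g + 1) * reflect_poly c)) (- (monom 1 m * reflect_poly d)) =
      - (x ^ (n + g + 1) * (x ^ m * poly c k.s)) - x ^ m * (x ^ n * poly d k.s) * y"
    unfolding cm dn by (simp add: L.elt_def poly_monom)
  ultimately have "L.elt (monom 1 (m + n + 2) * a) (monom 1 (m + n + 2) * b) =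
      L.elt (- (monom 1 (n + g + 1) * reflect_poly c)) (- (monom 1 m * reflect_poly d))"
    by simp
  then have eq: "monom 1 (m + n + 2) * a = - (monom 1 (n + g + 1) * reflect_poly c)"
      "monom 1 (m + n + 2) * b = - (monom 1 m * reflect_poly d)"
    using L.elt_inj[of "monom 1 (m + n + 2) * a" "monom 1 (m + n + 2) * b"
        "- (monom 1 (n + g + 1) * reflect_poly c)" "- (monom 1 m * reflect_poly d)"] ab cd
    by (auto simp: L.polys_mems L.one_mem)
  have deg: "degree (monom 1 j * q) = j + degree q" if "q \<noteq> 0" for j and q :: "'a poly"
    using that by (subst degree_mult_eq) (auto simp: degree_monom_eq)
  have "b = 0"
  proof (rule ccontr)
    assume "b \<noteq> 0"
    then have "m + n + 2 + degree b = degree (monom 1 m * reflect_poly d)"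
      using arg_cong[OF eq(2), of degree] deg by simp
    also have "\<dots> \<le> m + n"
      using degree_mult_le[of "monom 1 m" "reflect_poly d"] degree_reflect_poly_le[of d]
        degree_monom_le[of "1::'a" m] by (simp add: n_def)
    finally show False by simp
  qed
  have coeff_a: "coeff a i = 0" if "i \<ge> g" for i
  proof (cases "a = 0")
    case False
    then have "m + n + 2 + degree a = degree (monom 1 (n + g + 1) * reflect_poly c)"
      using arg_cong[OF eq(1), of degree] deg by simp
    also have "\<dots> \<le> n + g + 1 + m"
      using degree_mult_le[of "monom 1 (n + g + 1)" "reflect_poly c"] degree_reflect_poly_le[of c]
        degree_monom_le[of "1::'a" "n + g + 1"] by (simp add: m_def)
    finally show ?thesis using that by (intro coeff_eq_0) simp
  qed simp
  have h: "h = poly a x" using ab \<open>b = 0\<close> by (simp add: L.elt_def)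
  have val: "\<omega> D = D x / y * h" if "D \<in> derivations k F" for D
    unfolding h_def by (rule differential_value[OF \<omega> that D(1)]) (simp add: derivation_eq[OF that])
  \<comment> \<open>So far the coefficients of a are only known to be in L; that h is in F brings
    them down to k.\<close>
  have "h \<in> F"
  proof -
    obtain n :: nat and u t where \<omega>: "\<omega> = (\<lambda>D\<in>derivations k F. \<Sum>i<n. u i * D (t i))"
      "\<forall>i<n. u i \<in> F \<and> t i \<in> F"
      using \<omega> unfolding differentials_def by blast
    show ?thesis
      unfolding h_def \<omega>(1) using D(1) \<omega>(2)
      by (auto intro!: k.E.sum_mem k.E.mult_mem k.\<delta>_mem)
  qed
  then have "a \<in> polys k"
    using poly_descent ab(1) h by simp
  moreover have "\<omega> = (\<lambda>D\<in>derivations k F. poly a x * D x / y)"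
  proof
    fix D
    show "\<omega> D = (\<lambda>D\<in>derivations k F. poly a x * D x / y) D"
    proof (cases "D \<in> derivations k F")
      case False
      then show ?thesis using \<omega> by (auto simp: differentials_def)
    qed (simp add: val h mult.commute)
  qed
  ultimately show thesis using that coeff_a by blast
qed

lemma genus: "has_genus k F g"
proof -
  define w where "w i D = x ^ i * D x / y" for i and D :: "'a \<Rightarrow> 'a"
  define P where "P c = (\<Sum>i<g. monom (c i) i)" for c :: "nat \<Rightarrow> 'a"
  have coeff_P: "coeff (P c) i = (if i < g then c i else 0)" for c i
    by (simp add: P_def coeff_sum)
  have P_mem: "P c \<in> polys k" if "c \<in> {..<g} \<rightarrow>\<^sub>E k" for c
    using that k.zero_mem by (auto simp: polys_def coeff_P PiE_def)
  have sum_w: "(\<Sum>i<g. c i * w i D) = poly (P c) x * D x / y" for c D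
    by (simp add: P_def w_def poly_sum poly_monom sum_distrib_right sum_divide_distrib mult.assoc)
  have "bij_betw (\<lambda>c. \<lambda>D\<in>derivations k F. \<Sum>i<g. c i * w i D) ({..<g} \<rightarrow>\<^sub>E k) (regular_differentials k F)"
    unfolding sum_w
  proof (rule bij_betw_imageI)
    show "inj_on (\<lambda>c. \<lambda>D\<in>derivations k F. poly (P c) x * D x / y) ({..<g} \<rightarrow>\<^sub>E k)"
    proof (rule inj_onI)
      fix c c' assume c: "c \<in> {..<g} \<rightarrow>\<^sub>E k" "c' \<in> {..<g} \<rightarrow>\<^sub>E k"
        and eq: "(\<lambda>D\<in>derivations k F. poly (P c) x * D x / y) = (\<lambda>D\<in>derivations k F. poly (P c') x * D x / y)"
      \<comment> \<open>Because \<delta> x = y, the value of p(x) dx / y at \<delta> is p(x)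
        itself.\<close>
      have "poly (P c) x = poly (P c') x"
        using fun_cong[OF eq, of "restrict k.\<delta> F"] \<delta>_derivation xy_mem k.y_nz
        by (simp add: k.\<delta>_x)
      then have "P c - P c' = 0"
        using c P_mem by (intro transcD[OF k.transc]) (auto intro!: k.polys_diff)
      then have "coeff (P c) i = coeff (P c') i" for i by simp
      then have "c i = c' i" if "i < g" for i using that by (metis coeff_P)
      then show "c = c'" using c by (intro PiE_ext) auto
    qed
    show "(\<lambda>c. \<lambda>D\<in>derivations k F. poly (P c) x * D x / y) ` ({..<g} \<rightarrow>\<^sub>E k) = regular_differentials k F"
    proof (intro equalityI subsetI)
      fix \<omega> assume "\<omega> \<in> (\<lambda>c. \<lambda>D\<in>derivations k F. poly (P c) x * D x / y) ` ({..<g} \<rightarrow>\<^sub>E k)"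
      then show "\<omega> \<in> regular_differentials k F"
        using P_mem differential_mem differential_regular_place
        by (auto simp: regular_differentials_def coeff_P)
    next
      fix \<omega> assume "\<omega> \<in> regular_differentials k F"
      from regular_differential_form[OF this] obtain p where
        p: "p \<in> polys k" "\<forall>i\<ge>g. coeff p i = 0"
        "\<omega> = (\<lambda>D\<in>derivations k F. poly p x * D x / y)"
        by metis
      have "P (restrict (coeff p) {..<g}) = p"
        using p(2) by (intro poly_eqI) (simp add: coeff_P)
      moreover have "restrict (coeff p) {..<g} \<in> {..<g} \<rightarrow>\<^sub>E k"
        using p(1) by (auto simp: polys_def)
      ultimately show "\<omega> \<in> (\<lambda>c. \<lambda>D\<in>derivations k F. poly (P c) x * D x / y) ` ({..<g} \<rightarrow>\<^sub>E k)"
        using p(3) by (intro image_eqI[of _ _ "restrict (coeff p) {..<g}"]) simp_all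
    qed
  qed
  then show ?thesis unfolding has_genus_def by blast
qed

text \<open>Both are witnessed by x: clearing denominators by polynomials in x gives F = k(x) + k(x)
  y, and y is not in k(x).\<close>

lemma is_curve: "curve k F"
  and is_hyperelliptic: "hyperelliptic_curve k F"
proof -
  define Kx where "Kx = adjoin k {x}"
  have sub: "subfld Kx" unfolding Kx_def by (rule subfld_adjoin)
  then interpret Kx: subfld Kx .
  have "k \<subseteq> Kx" "x \<in> Kx"
    using adjoin_supset[where k = k and S = "{x}"] by (auto simp: Kx_def)
  then have px: "poly p x \<in> Kx" if "p \<in> polys k" for p
    using Kx.poly_mem polys_mono that by blast
  have frac: "\<exists>a\<in>polys k. \<exists>b\<in>polys k. b \<noteq> 0 \<and> z = poly a x / poly b x" if "z \<in> Kx" for z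
  proof -
    have nz: "poly b x \<noteq> 0" if "b \<in> polys k" "b \<noteq> 0" for b
      using k.transc transcD that by blast
    have "subfld {poly a x / poly b x | a b. a \<in> polys k \<and> b \<in> polys k \<and> b \<noteq> 0}" (is "subfld ?S")
    proof
      show "1 \<in> ?S" using k.polys_1 by force
      fix u assume "u \<in> ?S"
      then obtain a b where ab: "a \<in> polys k" "b \<in> polys k" "b \<noteq> 0" "u = poly a x / poly b x" by blast
      then have "- u = poly (- a) x / poly b x" by simp
      then show "- u \<in> ?S" using ab k.polys_uminus by blast
      show "inverse u \<in> ?S"
      proof (cases "a = 0")
        case True
        then have "inverse u = poly 0 x / poly 1 x" using ab by simp
        then show ?thesis using k.polys_0 k.polys_1 one_neq_zero by blast
      next
        case False
        have "inverse u = poly b x / poly a x" using ab by simp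
        then show ?thesis using ab False by blast
      qed
      fix v assume "v \<in> ?S"
      then obtain c d where cd: "c \<in> polys k" "d \<in> polys k" "d \<noteq> 0" "v = poly c x / poly d x" by blast
      have "u + v = poly (a * d + c * b) x / poly (b * d) x" "u * v = poly (a * c) x / poly (b * d) x"
        unfolding ab(4) cd(4) using nz[OF ab(2,3)] nz[OF cd(2,3)] by (simp_all add: field_simps)
      moreover have "b * d \<noteq> 0" using ab cd by simp
      ultimately show "u + v \<in> ?S" "u * v \<in> ?S"
        using ab cd k.polys_add k.polys_mult by blast+
    qed
    then have "Kx \<subseteq> ?S"
      unfolding Kx_def
    proof (rule adjoin_least)
      show "k \<subseteq> ?S"
      proof
        fix c assume "c \<in> k"
        then have "[:c:] \<in> polys k" "c = poly [:c:] x / poly 1 x"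
          by (auto intro: k.polys_pCons k.polys_0)
        then show "c \<in> ?S" using k.polys_1 one_neq_zero by blast
      qed
      have "[:0, 1:] \<in> polys k" "x = poly [:0, 1:] x / poly 1 x"
        by (auto intro!: k.polys_pCons k.polys_0 k.zero_mem k.one_mem)
      then show "{x} \<subseteq> ?S" using k.polys_1 one_neq_zero by blast
    qed
    then show ?thesis using that by blast
  qed
  have F_eq: "F = {a + b * y | a b. a \<in> Kx \<and> b \<in> Kx}"
  proof (intro equalityI subsetI)
    fix z assume "z \<in> F"
    then obtain a b c where *: "a \<in> polys k" "b \<in> polys k" "c \<in> polys k" "c \<noteq> 0"
      "z * poly c x = k.elt a b" by (rule k.E_E_poly)
    then have "poly c x \<noteq> 0" using k.transc transcD by blast
    then have "z = poly a x / poly c x + poly b x / poly c x * y"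
      using *(5) by (simp add: k.elt_def field_simps)
    then show "z \<in> {a + b * y | a b. a \<in> Kx \<and> b \<in> Kx}"
      using px * Kx.divide_mem by blast
  next
    have "Kx \<subseteq> F"
      unfolding Kx_def using k_sub_F xy_mem by (intro adjoin_least k.E.subfld_axioms) auto
    then show "z \<in> F" if "z \<in> {a + b * y | a b. a \<in> Kx \<and> b \<in> Kx}" for z
      using that xy_mem k.E.add_mem k.E.mult_mem by blast
  qed
  have "y \<notin> Kx"
  proof
    assume "y \<in> Kx"
    then obtain a b where *: "a \<in> polys k" "b \<in> polys k" "b \<noteq> 0" "y = poly a x / poly b x"
      using frac by blast
    then have "poly b x \<noteq> 0" using k.transc transcD by blast
    then have "poly b x * y = poly a x" using * by simp
    then have "k.elt (- a) b = 0" by (simp add: k.elt_def)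
    then show False using k.elt_eq_0[of "- a" b] * k.polys_uminus by blast
  qed
  from dimension_two[OF sub this] have dim: "ring.dimension Omega 2 Kx F"
    unfolding F_eq .
  interpret Omega: Ring.field "Omega :: 'a ring" by (rule field_from_type_algebra)
  have fdim: "ring.finite_dimension Omega Kx F"
    using dim by (rule Omega.finite_dimensionI)
  have tr: "(ring.transcendental Omega over k) x"
    using k.transc transcendental_Omega_iff k.subfld_axioms by blast
  have "z \<in> k" if "z \<in> F" "(ring.algebraic Omega over k) z" for z
  proof -
    have "\<not> transc k z"
      using that(2) transcendental_Omega_iff[OF k.subfld_axioms, of z] by (simp add: over_def)
    then obtain p where "p \<in> polys k" "p \<noteq> 0" "poly p z = 0" by (auto simp: transc_def)
    then have "z \<in> L" using closed polys_mono[OF k_sub_L] by blast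
    then show ?thesis using constants that by blast
  qed
  then show "curve k F"
    unfolding curve_def using k_sub_F xy_mem tr fdim k.subfld_axioms k.E.subfld_axioms
    by (auto simp: subfield_Omega_iff over_def Kx_def)
  then show "hyperelliptic_curve k F"
    unfolding hyperelliptic_curve_def using xy_mem tr dim by (auto simp: over_def Kx_def)
qed

end

section \<open>Counting rational points\<close>

text \<open>This is \<open>rational_points\<close> after the base change, for a function field that
  already has K as its constants.\<close>

definition rational_places :: "'a::field set \<Rightarrow> 'a set \<Rightarrow> 'a set set"
  where "rational_places K F = {A \<in> places K F. \<forall>z\<in>A. \<exists>c\<in>K. z - c \<in> nonunits A}"

definition affine_points :: "'a::field set \<Rightarrow> 'a poly \<Rightarrow> ('a \<times> 'a) set"
  where "affine_points K f = {(\<alpha>, \<beta>). \<alpha> \<in> K \<and> \<beta> \<in> K \<and> \<beta> ^ 2 = poly f \<alpha>}"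

context double_cover_field
begin

lemma point_if_affine: "(\<alpha>, \<beta>) \<in> affine_points L f \<Longrightarrow> point L x y f \<alpha> \<beta>"
  by unfold_locales (auto simp: affine_points_def)

lemma O_pt_rational:
  assumes "(\<alpha>, \<beta>) \<in> affine_points L f"
  shows "point.O_pt L x y \<alpha> \<beta> \<in> rational_places L E"
    and "x - \<alpha> \<in> nonunits (point.O_pt L x y \<alpha> \<beta>)"
    and "y - \<beta> \<in> nonunits (point.O_pt L x y \<alpha> \<beta>)"
    and "x \<in> point.O_pt L x y \<alpha> \<beta>"
proof -
  interpret point L x y f \<alpha> \<beta> by (rule point_if_affine[OF assms])
  show "O_pt \<in> rational_places L E" "x - \<alpha> \<in> nonunits O_pt" "y - \<beta> \<in> nonunits O_pt" "x \<in> O_pt"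
    using O_residue O_place x_diff_nonunit y_diff_nonunit R_sub_O x_mem_R
    by (auto simp: rational_places_def)
qed

lemma O_pt_inj:
  assumes "(\<alpha>, \<beta>) \<in> affine_points L f" "(\<alpha>', \<beta>') \<in> affine_points L f"
    and eq: "point.O_pt L x y \<alpha> \<beta> = point.O_pt L x y \<alpha>' \<beta>'"
  shows "\<alpha> = \<alpha>' \<and> \<beta> = \<beta>'"
proof -
  interpret point L x y f \<alpha> \<beta> by (rule point_if_affine[OF assms(1)])
  have nu: "x - \<alpha>' \<in> nonunits O_pt" "y - \<beta>' \<in> nonunits O_pt"
    using O_pt_rational(2,3)[OF assms(2)] eq by simp_all
  have "\<alpha> - \<alpha>' \<in> nonunits O_pt"
    using O.nonunits_diff[OF nu(1) x_diff_nonunit] by simp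
  moreover have "\<beta> - \<beta>' \<in> nonunits O_pt"
    using O.nonunits_diff[OF nu(2) y_diff_nonunit] by simp
  moreover have "\<alpha> - \<alpha>' \<in> L" "\<beta> - \<beta>' \<in> L"
    using assms(1,2) by (auto simp: affine_points_def diff_mem)
  ultimately have "\<alpha> - \<alpha>' = 0" "\<beta> - \<beta>' = 0"
    using O.nonunits_K by blast+
  then show ?thesis by simp
qed

text \<open>With x also y is in A, by \<open>square_mem\<close>. The residues satisfy the equation
  because f(\<alpha>) - \<beta>^2 is a constant and a nonunit, hence 0.\<close>

lemma rational_place_affine:
  assumes "A \<in> rational_places L E" "x \<in> A"
  obtains \<alpha> \<beta> where "(\<alpha>, \<beta>) \<in> affine_points L f" "A = point.O_pt L x y \<alpha> \<beta>"
proof -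
  have A: "A \<in> places L E" "\<And>z. z \<in> A \<Longrightarrow> \<exists>c\<in>L. z - c \<in> nonunits A"
    using assms by (auto simp: rational_places_def)
  interpret A: place L E A by unfold_locales fact
  have fA: "poly f x \<in> A"
    using A.poly_mem polys_mono[OF A.K_sub] f_mem assms(2) by blast
  have "y \<in> A"
  proof (rule A.square_mem)
    show "y ^ 2 \<in> A" unfolding y_sq by (rule fA)
    show "y \<in> E" using y_mem_R R_sub_E by blast
  qed
  obtain \<alpha> where \<alpha>: "\<alpha> \<in> L" "x - \<alpha> \<in> nonunits A" using A(2)[OF assms(2)] by blast
  obtain \<beta> where \<beta>: "\<beta> \<in> L" "y - \<beta> \<in> nonunits A" using A(2)[OF \<open>y \<in> A\<close>] by blast
  have "(y - \<beta>) * (y + \<beta>) \<in> nonunits A"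
    using \<beta> \<open>y \<in> A\<close> A.K_sub by (intro A.nonunits_mult A.add_mem) auto
  moreover have "(y - \<beta>) * (y + \<beta>) = poly f x - \<beta> ^ 2"
    unfolding y_sq[symmetric] by (simp add: algebra_simps power2_eq_square)
  ultimately have "(poly f x - \<beta> ^ 2) - (poly f x - poly f \<alpha>) \<in> nonunits A"
    using A.nonunits_diff A.nonunits_poly_diff[OF f_mem \<alpha>] by metis
  then have "poly f \<alpha> - \<beta> ^ 2 \<in> nonunits A" by simp
  then have "poly f \<alpha> - \<beta> ^ 2 = 0"
    using \<alpha> \<beta> f_mem by (intro A.nonunits_K) (auto intro!: mems poly_mem)
  then have "(\<alpha>, \<beta>) \<in> affine_points L f" using \<alpha> \<beta> by (simp add: affine_points_def)
  moreover from point_if_affine[OF this] interpret point L x y f \<alpha> \<beta> .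
  have "A = O_pt" by (rule place_eq_O) (use A \<alpha> \<beta> in auto)
  ultimately show thesis using that by blast
qed

end

lemma (in hyperelliptic_model) card_rational_places:
  assumes "finite L" "lead_coeff f = 1"
  shows "card (rational_places L E) = card (affine_points L f) + 2"
proof -
  define P where "P = (\<lambda>(\<alpha>, \<beta>). point.O_pt L x y \<alpha> \<beta>) ` affine_points L f"
  define Q where "Q = (\<lambda>\<beta>. point.O_pt L s w 0 \<beta>) ` {1, - 1}"
  \<comment> \<open>At 0 the reversed polynomial takes the value 1, the leading coefficient of f, so
    the points with s = 0 are those with w = 1 and w = - 1.\<close>
  have inf_pt: "(0, \<beta>) \<in> affine_points L (reflect_poly f) \<longleftrightarrow> \<beta> = 1 \<or> \<beta> = - 1" for \<beta>
    using assms(2) ring_mems by (auto simp: affine_points_def power2_eq_1_iff)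
  have "finite (affine_points L f)"
    by (rule finite_subset[of _ "L \<times> L"]) (auto simp: affine_points_def assms)
  have "rational_places L E = P \<union> Q"
  proof (intro equalityI subsetI)
    fix A assume A: "A \<in> rational_places L E"
    then have pl: "A \<in> places L E" by (simp add: rational_places_def)
    interpret A: place L E A by unfold_locales (rule pl)
    show "A \<in> P \<union> Q"
    proof (cases "x \<in> A")
      case True
      then show ?thesis using rational_place_affine[OF A] by (auto simp: P_def)
    next
      case False
      then have s: "s \<in> nonunits A"
        using A.nonunit_inverse[of x] x_mem_R R_sub_E by (auto simp: s_def inverse_eq_divide)
      then obtain \<alpha> \<beta> where pt: "(\<alpha>, \<beta>) \<in> affine_points L (reflect_poly f)" "A = point.O_pt L s w \<alpha> \<beta>"
        using inf.rational_place_affine[of A] A A.nonunits_sub by (auto simp: inf_E)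
      have "s - (s - \<alpha>) \<in> nonunits A"
        by (rule A.nonunits_diff[OF s]) (use inf.O_pt_rational(2)[OF pt(1)] pt(2) in simp)
      then have "\<alpha> \<in> nonunits A" by simp
      then have "\<alpha> = 0" using A.nonunits_K pt by (auto simp: affine_points_def)
      then show ?thesis using pt inf_pt by (auto simp: Q_def)
    qed
  next
    fix A assume "A \<in> P \<union> Q"
    then show "A \<in> rational_places L E"
      using O_pt_rational(1) inf.O_pt_rational(1)[of 0] inf_pt by (auto simp: P_def Q_def inf_E)
  qed
  moreover have "card P = card (affine_points L f)"
    unfolding P_def by (rule card_image) (auto intro!: inj_onI dest: O_pt_inj)
  moreover have "card Q = 2"
  proof -
    have "(1 :: 'a) \<noteq> - 1"
    proof
      assume "(1 :: 'a) = - 1"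
      then have "(1 :: 'a) + 1 = 1 + - 1" by (rule arg_cong)
      then show False using two_nz by simp
    qed
    moreover have "inj_on (\<lambda>\<beta>. point.O_pt L s w 0 \<beta>) {1, - 1}"
    proof (rule inj_onI)
      fix \<beta> \<beta>' :: 'a
      assume "\<beta> \<in> {1, - 1}" "\<beta>' \<in> {1, - 1}"
      then have "(0, \<beta>) \<in> affine_points L (reflect_poly f)" "(0, \<beta>') \<in> affine_points L (reflect_poly f)"
        using inf_pt by blast+
      then show "point.O_pt L s w 0 \<beta> = point.O_pt L s w 0 \<beta>' \<Longrightarrow> \<beta> = \<beta>'"
        using inf.O_pt_inj by blast
    qed
    ultimately show ?thesis by (simp add: Q_def card_image)
  qed
  moreover have "P \<inter> Q = {}"
  proof -
    have "x \<in> A" if "A \<in> P" for A using that O_pt_rational(4) by (auto simp: P_def)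
    moreover have "x \<notin> A" if AQ: "A \<in> Q" for A
    proof -
      obtain \<beta> where "A = point.O_pt L s w 0 \<beta>" "\<beta> = 1 \<or> \<beta> = - 1"
        using AQ unfolding Q_def by blast
      then have "A = point.O_pt L s w 0 \<beta>" "(0, \<beta>) \<in> affine_points L (reflect_poly f)"
        using inf_pt by blast+
      then have "s \<in> nonunits A" using inf.O_pt_rational(2)[of 0 \<beta>] by simp
      then show ?thesis using x_nz by (auto simp: nonunits_def s_def)
    qed
    ultimately show ?thesis by blast
  qed
  moreover have "finite P" "finite Q"
    using \<open>finite (affine_points L f)\<close> by (auto simp: P_def Q_def)
  ultimately show ?thesis by (simp add: card_Un_disjoint)
qed

lemma adjoin_constants:
  assumes "double_cover_field k x y f" "double_cover_field K x y f" "k \<subseteq> K"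
  shows "adjoin K (double_cover_field.E k x y) = double_cover_field.E K x y"
proof -
  interpret k: double_cover_field k x y f by fact
  interpret K: double_cover_field K x y f by fact
  have K: "K \<subseteq> K.E" "x \<in> K.E" "y \<in> K.E"
    using K.L_sub_R K.x_mem_R K.y_mem_R K.R_sub_E by auto
  show ?thesis
  proof
    have "k.E \<subseteq> K.E"
      using K assms(3) by (intro k.E_least K.E.subfld_axioms) auto
    then show "adjoin K k.E \<subseteq> K.E"
      using K by (intro adjoin_least K.E.subfld_axioms) auto
    have "x \<in> k.E" "y \<in> k.E"
      using k.x_mem_R k.y_mem_R k.R_sub_E by auto
    then show "K.E \<subseteq> adjoin K k.E"
      using adjoin_supset[where k = K and S = k.E]
      by (intro K.E_least subfld_adjoin) auto
  qed
qed

lemma card_rational_points: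
  assumes "double_cover_field k x y f" "hyperelliptic_model K x y f g" "k \<subseteq> K"
    and "finite K" "lead_coeff f = 1"
  shows "card (rational_points K (double_cover_field.E k x y)) = card (affine_points K f) + 2"
proof -
  interpret K: hyperelliptic_model K x y f g by fact
  show ?thesis
    using K.card_rational_places assms
    by (simp add: rational_points_def adjoin_constants[OF assms(1) K.double_cover_field_axioms]
        flip: rational_places_def)
qed

lemma (in double_cover_field) double_cover_eq_E: "double_cover L x f = E"
proof -
  have sub: "subfld (adjoin L {x, y})" by (rule subfld_adjoin)
  have roots: "{x} \<union> {z. z ^ 2 = poly f x} = {x, y, - y}"
    using power2_eq_iff[of _ y] by (auto simp: y_sq)
  show ?thesis
    unfolding double_cover_def adjoin_eq_E[symmetric] roots
  proof
    show "adjoin L {x, y, - y} \<subseteq> adjoin L {x, y}"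
      using subrng.uminus_mem[OF subfld.axioms(1)[OF sub], of y]
        adjoin_supset[where k = L and S = "{x, y}"]
      by (intro adjoin_least sub) auto
    show "adjoin L {x, y} \<subseteq> adjoin L {x, y, - y}"
      using adjoin_supset[where k = L and S = "{x, y, - y}"]
      by (intro adjoin_least subfld_adjoin) auto
  qed
qed

section \<open>Finite fields\<close>

lemma poly_power_CHAR:
  fixes p :: "'a::field poly"
  assumes "prime CHAR('a)" "q = CHAR('a) ^ n" "\<And>i. coeff p i ^ q = coeff p i"
  shows "poly p z ^ q = poly p (z ^ q)"
proof -
  have "poly p z ^ q = (\<Sum>i\<le>degree p. (coeff p i * z ^ i) ^ q)"
    unfolding poly_altdef by (rule freshmans_dream_sum'[OF assms(1,2)])
  also have "\<dots> = (\<Sum>i\<le>degree p. coeff p i * (z ^ q) ^ i)"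
    by (intro sum.cong refl) (simp add: power_mult_distrib assms(3) mult.commute flip: power_mult)
  finally show ?thesis by (simp add: poly_altdef)
qed

lemma inj_power_CHAR:
  fixes u v :: "'a::field"
  assumes "prime CHAR('a)" "q = CHAR('a) ^ n" "u ^ q = v ^ q"
  shows "u = v"
proof -
  have "(u - v) ^ q + v ^ q = u ^ q"
    using freshmans_dream'[OF assms(1,2), of "u - v" v] by simp
  then have "(u - v) ^ q = 0" using assms(3) by simp
  then show ?thesis by simp
qed

lemma subfld_GF:
  assumes "prime CHAR('a::field)" "q = CHAR('a) ^ n"
  shows "subfld (GF q :: 'a set)"
proof
  have "q > 0" using assms prime_gt_0_nat by simp
  show "a + b \<in> GF q" if "a \<in> GF q" "b \<in> GF q" for a b :: 'a
    using that freshmans_dream'[OF assms] by (simp add: GF_def)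
  show "- a \<in> GF q" if "a \<in> GF q" for a :: 'a
  proof -
    have "(- a) ^ q + a ^ q = 0"
      using freshmans_dream'[OF assms, of "- a" a] \<open>q > 0\<close> by (simp add: power_0_left)
    then show ?thesis using that by (simp add: GF_def add_eq_0_iff2)
  qed
qed (auto simp: GF_def power_mult_distrib power_inverse)

text \<open>The elements are the roots of X^q - X. For q = 529 the opposite inequality comes from
  the injectivity of \<phi>.\<close>

lemma finite_GF:
  assumes "q > 1"
  shows "finite (GF q :: 'a::field set)" "card (GF q :: 'a set) \<le> q"
proof -
  define p :: "'a poly" where "p = monom 1 q - [:0, 1:]"
  have "coeff p q = 1" using assms by (simp add: p_def coeff_pCons split: nat.split)
  then have "p \<noteq> 0" by auto
  have "degree p \<le> q"
    unfolding p_def using assms by (intro degree_diff_le) (auto simp: degree_monom_le)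
  have "GF q = {z. poly p z = 0}" by (auto simp: GF_def p_def poly_monom)
  then show "finite (GF q :: 'a::field set)" "card (GF q :: 'a set) \<le> q"
    using poly_roots_finite[OF \<open>p \<noteq> 0\<close>] card_poly_roots_bound[OF \<open>p \<noteq> 0\<close>] \<open>degree p \<le> q\<close>
    by (auto simp: Collect_conj_eq)
qed

text \<open>The algebraic closure of the prime field. The exponent 0 is excluded because
  \<open>GF 1\<close> is the whole type.\<close>

definition GF_closure :: "nat \<Rightarrow> 'a::field set"
  where "GF_closure p = (\<Union>n\<in>{0<..}. GF (p ^ n))"

lemma GF_power_mono:
  assumes "z \<in> GF q"
  shows "z ^ (q ^ n) = z"
  using assms by (induction n) (auto simp: GF_def power_mult mult.commute)

lemma GF_mult:
  assumes "z \<in> GF (p ^ m)"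
  shows "z \<in> GF (p ^ (m * n))"
  using GF_power_mono[OF assms, of n] by (simp add: GF_def power_mult)

context
  fixes p :: nat
  assumes prime_p: "prime p" and char_p: "CHAR('a::field) = p"
begin

lemma subfld_GF_p: "subfld (GF (p ^ n) :: 'a set)"
  using subfld_GF[where 'a = 'a] prime_p char_p by blast

lemma subfld_GF_closure: "subfld (GF_closure p :: 'a set)"
proof -
  have two: "\<exists>n>0. a \<in> GF (p ^ n) \<and> b \<in> GF (p ^ n)" if ab: "a \<in> GF_closure p" "b \<in> GF_closure p" for a b :: 'a
  proof -
    obtain m n where "m > 0" "n > 0" "a \<in> GF (p ^ m)" "b \<in> GF (p ^ n)"
      using ab by (auto simp: GF_closure_def)
    then show ?thesis
      using GF_mult[of a p m n] GF_mult[of b p n m] by (intro exI[of _ "m * n"]) (auto simp: mult.commute)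
  qed
  have sub: "GF (p ^ n) \<subseteq> (GF_closure p :: 'a set)" if "n > 0" for n
    using that by (auto simp: GF_closure_def)
  show ?thesis
  proof
    show "1 \<in> (GF_closure p :: 'a set)"
      by (auto simp: GF_closure_def GF_def)
    show "a + b \<in> GF_closure p" "a * b \<in> GF_closure p"
      if "a \<in> GF_closure p" "b \<in> GF_closure p" for a b :: 'a
      using two[OF that] sub subrng.add_mem subrng.mult_mem subfld_GF_p subfld.axioms(1)
      by (metis subsetD)+
    show "- a \<in> GF_closure p" "inverse a \<in> GF_closure p" if "a \<in> GF_closure p" for a :: 'a
      using two[OF that that] sub subrng.uminus_mem subfld.inverse_mem subfld_GF_p subfld.axioms(1)
      by (metis subsetD)+
  qed
qed

text \<open>If \<open>r\<close> has coefficients in \<open>GF q\<close>, then the powers \<open>z\<^sup>q\<^sup>j\<close> of a root \<open>z\<close> are roots, hence two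
  of them coincide.\<close>

lemma GF_closure_closed:
  assumes "r \<in> polys (GF_closure p :: 'a set)" "r \<noteq> 0" "poly r z = 0"
  shows "z \<in> GF_closure p"
proof -
  \<comment> \<open>Finitely many coefficients lie in one common finite field: exponents are
    multiplied, as GF (p^n) is contained in GF (p^(n m)).\<close>
  have "\<exists>n>0. \<forall>i<N. coeff r i \<in> GF (p ^ n)" for N
  proof (induction N)
    case (Suc N)
    then obtain n where n: "n > 0" "\<forall>i<N. coeff r i \<in> GF (p ^ n)" by blast
    obtain m where m: "m > 0" "coeff r N \<in> GF (p ^ m)"
      using assms(1) by (auto simp: polys_def GF_closure_def)
    have "coeff r i \<in> GF (p ^ (n * m))" if "i < Suc N" for i
      using that n m GF_mult[of "coeff r i" p n m] GF_mult[of "coeff r N" p m n]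
      by (cases "i = N") (auto simp: mult.commute)
    then show ?case using n m by (intro exI[of _ "n * m"]) auto
  qed auto
  then obtain n where n: "n > 0" "\<forall>i<Suc (degree r). coeff r i \<in> GF (p ^ n)" by blast
  define q where "q = p ^ n"
  have "q > 0" using prime_p prime_gt_0_nat by (simp add: q_def)
  have "coeff r i ^ q = coeff r i" for i
    using n \<open>q > 0\<close> by (cases "i \<le> degree r") (auto simp: GF_def q_def coeff_eq_0)
  then have step: "poly r u ^ q = poly r (u ^ q)" for u
    using poly_power_CHAR[of q n r u] prime_p char_p by (simp add: q_def)
  have root: "poly r (z ^ (q ^ j)) = 0" for j
  proof (induction j)
    case (Suc j)
    then show ?case
      using step[of "z ^ (q ^ j)"] \<open>q > 0\<close> unfolding power_Suc2 power_mult by (simp add: power_0_left)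
  qed (simp add: assms)
  have "range (\<lambda>j. z ^ (q ^ j)) \<subseteq> {u. poly r u = 0}" using root by auto
  then have "finite (range (\<lambda>j. z ^ (q ^ j)))"
    using poly_roots_finite[OF assms(2)] finite_subset by blast
  then have "\<not> inj (\<lambda>j. z ^ (q ^ j))"
    using finite_imageD infinite_UNIV_nat by blast
  then obtain i j where ij: "i < j" "z ^ (q ^ i) = z ^ (q ^ j)"
    unfolding inj_def by (metis nat_neq_iff)
  \<comment> \<open>The q^i-th power map is injective, being an iterated Frobenius, so the
    coincidence at i and j moves back to one at 0 and j - i.\<close>
  have "q ^ j = q ^ (j - i) * q ^ i" using ij by (simp flip: power_add)
  then have "(z ^ (q ^ (j - i))) ^ (q ^ i) = z ^ (q ^ i)"
    using ij by (simp flip: power_mult)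
  moreover have "q ^ i = CHAR('a) ^ (n * i)" using char_p by (simp add: q_def power_mult)
  ultimately have "z ^ (q ^ (j - i)) = z"
    using inj_power_CHAR[where 'a = 'a] prime_p char_p by blast
  then have "z \<in> GF (p ^ (n * (j - i)))" by (simp add: GF_def q_def power_mult)
  then show ?thesis using n ij by (auto simp: GF_closure_def)
qed

lemma GF_closure_algebraic:
  assumes "z \<in> (GF_closure p :: 'a set)" "subfld K"
  shows "\<exists>r\<in>polys K. r \<noteq> 0 \<and> poly r z = 0"
proof -
  interpret subfld K by fact
  obtain n where n: "n > 0" "z ^ (p ^ n) = z"
    using assms by (auto simp: GF_closure_def GF_def)
  have "p ^ n > 1" using n prime_p prime_gt_1_nat one_less_power by blast
  then have "coeff (monom 1 (p ^ n) - [:0, 1:] :: 'a poly) (p ^ n) = 1"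
    by (simp add: coeff_eq_0 del: less_one one_less_power One_nat_def)
  then have "monom 1 (p ^ n) - [:0, 1:] \<noteq> (0 :: 'a poly)" by (metis coeff_0 zero_neq_one)
  then show ?thesis
    using n by (intro bexI[of _ "monom 1 (p ^ n) - [:0, 1:]"])
      (auto simp: poly_monom intro!: polys_mems ring_mems)
qed

text \<open>A root of a non-zero polynomial over the closure lies in the closure, and is therefore
  algebraic over K.\<close>

lemma transc_GF_closure:
  assumes "subfld K" "transc K (x :: 'a)"
  shows "transc (GF_closure p) x"
  using assms GF_closure_closed GF_closure_algebraic unfolding transc_def by metis

end

section \<open>The fields with 23 and 529 elements\<close>

text \<open>Since 23 is 3 modulo 4, the square root I of -1 is not in GF 23 and generates GF 529
  over it.\<close>

locale char_23 =
  fixes I :: "'a::alg_closed_field"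
  assumes char: "CHAR('a) = 23" and I: "I ^ 2 = - 1"
begin

lemma prime_23: "prime (23 :: nat)"
  by simp

lemma of_int_eq_0: "(of_int n :: 'a) = 0 \<longleftrightarrow> 23 dvd n"
  using of_int_eq_0_iff_char_dvd[of n, where 'a = 'a] char by simp

lemma of_int_mod: "(of_int (n mod 23) :: 'a) = of_int n"
proof -
  have "(of_int (n - n mod 23) :: 'a) = 0"
    unfolding of_int_eq_0 by (simp add: minus_mod_eq_mult_div)
  then show ?thesis by simp
qed

lemma two_nz: "(2 :: 'a) \<noteq> 0"
  using of_int_eq_0[of 2] by simp

lemma subfld_23: "subfld (GF 23 :: 'a set)" and subfld_529: "subfld (GF (23 ^ 2) :: 'a set)"
  using subfld_GF_p[OF prime_23 char, of 1] subfld_GF_p[OF prime_23 char, of 2] by simp_all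

lemma of_int_mem_GF: "of_int n \<in> (GF 23 :: 'a set)"
  using subrng.of_int_mem subfld.axioms(1) subfld_23 by blast

lemma GF_23_529: "GF 23 \<subseteq> (GF (23 ^ 2) :: 'a set)"
  using GF_mult[of _ 23 1 2] by auto

definition \<phi> :: "int \<times> int \<Rightarrow> 'a"
  where "\<phi> z = of_int (fst z) + of_int (snd z) * I"

lemma I_23: "I ^ 23 = - I"
proof -
  have "I ^ 23 = I * (I ^ 2) ^ 11" by (simp flip: power_mult power_Suc)
  then show ?thesis unfolding I by simp
qed

lemma I_mem: "I \<in> GF (23 ^ 2)"
proof -
  have "I ^ (23 * 23) = (I ^ 23) ^ 23" by (rule power_mult)
  then show ?thesis by (simp add: GF_def I_23 power2_eq_square)
qed

lemma \<phi>_mem: "\<phi> z \<in> GF (23 ^ 2)"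
proof -
  interpret subfld "GF (23 ^ 2) :: 'a set" by (rule subfld_529)
  show ?thesis
    unfolding \<phi>_def by (intro add_mem mult_mem I_mem of_int_mem)
qed

text \<open>If b were non-zero modulo 23, then I would be in GF 23 and equal to its 23rd power,
  which is - I.\<close>

lemma \<phi>_eq_0:
  assumes "\<phi> (a, b) = 0"
  shows "23 dvd a \<and> 23 dvd b"
proof -
  interpret subfld "GF 23 :: 'a set" by (rule subfld_23)
  have "of_int b = (0 :: 'a)"
  proof (rule ccontr)
    assume *: "of_int b \<noteq> (0 :: 'a)"
    have "of_int b * I = - of_int a"
      using assms by (simp add: \<phi>_def add_eq_0_iff)
    then have "I = - of_int a / of_int b"
      using * by (metis nonzero_mult_div_cancel_left)
    then have "I \<in> GF 23" using of_int_mem by (metis divide_mem uminus_mem)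
    then have "I = - I" using I_23 by (simp add: GF_def)
    then have "2 * I = 0" by (metis add.right_inverse mult_2)
    then show False using two_nz I by simp
  qed
  then show ?thesis using assms by (auto simp: \<phi>_def simp flip: of_int_eq_0)
qed

lemma \<phi>_bij: "bij_betw \<phi> ({0..22} \<times> {0..22}) (GF (23 ^ 2))"
proof -
  have "inj_on \<phi> ({0..22} \<times> {0..22})"
  proof (rule inj_onI)
    fix z z' assume "z \<in> {0..22} \<times> {0..22}" "z' \<in> {0..22} \<times> {0..22}" "\<phi> z = \<phi> z'"
    moreover obtain a b a' b' where "z = (a, b)" "z' = (a', b')" by fastforce
    ultimately have *: "a \<in> {0..22}" "b \<in> {0..22}" "a' \<in> {0..22}" "b' \<in> {0..22}"
      "\<phi> (a - a', b - b') = 0" "z = (a, b)" "z' = (a', b')"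
      by (auto simp: \<phi>_def algebra_simps)
    have eqI: "u = v" if "23 dvd u - v" "u \<in> {0..22}" "v \<in> {0..22}" for u v :: int
      using that unfolding atLeastAtMost_iff by presburger
    from \<phi>_eq_0[OF *(5)] have "a = a'" "b = b'" using eqI *(1-4) by blast+
    then show "z = z'" using * by simp
  qed
  moreover have "\<phi> ` ({0..22} \<times> {0..22}) = GF (23 ^ 2)"
  proof (rule card_seteq)
    show "finite (GF (23 ^ 2) :: 'a set)" by (rule finite_GF) simp
    show "card (GF (23 ^ 2) :: 'a set) \<le> card (\<phi> ` ({0..22} \<times> {0..22}))"
      using finite_GF(2)[of "23 ^ 2", where 'a = 'a] card_image[OF calculation] by simp
  qed (use \<phi>_mem in blast)
  ultimately show ?thesis by (simp add: bij_betw_def)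
qed

text \<open>The 23rd power is the conjugate a - b I, so the 24th power is the norm to GF 23.\<close>

lemma \<phi>_norm: "\<phi> (a, b) ^ 24 = of_int (a * a + b * b)"
proof -
  have "\<phi> (a, b) ^ 23 = of_int a ^ 23 + (of_int b * I) ^ 23"
    unfolding \<phi>_def by (simp only: fst_conv snd_conv freshmans_dream prime_23 char)
  also have "\<dots> = of_int a - of_int b * I"
    using of_int_mem_GF by (simp add: GF_def power_mult_distrib I_23)
  finally have "\<phi> (a, b) ^ 23 * \<phi> (a, b) = (of_int a - of_int b * I) * (of_int a + of_int b * I)"
    by (simp only: \<phi>_def fst_conv snd_conv)
  also have "\<dots> = of_int a * of_int a - of_int b * of_int b * I ^ 2"
    by (simp add: algebra_simps power2_eq_square)
  finally show ?thesis by (simp add: I flip: power_Suc2)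
qed

lemma card_square_roots:
  "card {\<beta> \<in> GF (23 ^ 2). \<beta> ^ 2 = \<phi> (a, b)} =
    (let n = (a * a + b * b) mod 23 in if n = 0 then 1 else if n ^ 11 mod 23 = 1 then 2 else 0)"
proof -
  define v where "v = \<phi> (a, b)"
  define n where "n = (a * a + b * b) mod 23"
  have vn: "v ^ 24 = of_int n"
    unfolding v_def n_def of_int_mod by (rule \<phi>_norm)
  have n: "0 \<le> n" "n < 23" by (simp_all add: n_def)
  have n0: "n = 0 \<longleftrightarrow> v = 0"
    using vn of_int_eq_0[of n] n zdvd_not_zless[of n 23] by auto
  obtain \<beta> where \<beta>: "\<beta> ^ 2 = v" using nth_root_exists[of 2 v] by auto
  have roots: "{u \<in> GF (23 ^ 2). u ^ 2 = v} = {u \<in> {\<beta>, - \<beta>}. u \<in> GF (23 ^ 2)}"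
    using power2_eq_iff[of _ \<beta>] unfolding \<beta>[symmetric] by blast
  show ?thesis
  proof (cases "n = 0")
    case True
    then have "\<beta> = 0" using \<beta> n0 by simp
    then have "{u \<in> GF (23 ^ 2). u ^ 2 = v} = {0}" unfolding roots by (auto simp: GF_def)
    then show ?thesis using True by (simp add: v_def n_def Let_def)
  next
    case False
    then have "\<beta> \<noteq> 0" using \<beta> n0 by auto
    have mem: "u \<in> GF (23 ^ 2) \<longleftrightarrow> n ^ 11 mod 23 = 1" if "u ^ 2 = v" for u
    proof -
      have "u \<noteq> 0" using that False n0 by auto
      \<comment> \<open>529 = 1 + 2 * 24 * 11. So a square root u of v \<noteq> 0, taken in the
        universal domain, lies in GF 529 if and only if the 11th power of the norm of v is
        1.\<close>
      have "u ^ (23 ^ 2) = u * (u ^ 2) ^ (24 * 11)"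
        by (simp flip: power_mult power_Suc)
      also have "\<dots> = u * (of_int (n ^ 11))"
        unfolding that power_mult vn by simp
      also have "\<dots> = u \<longleftrightarrow> of_int (n ^ 11 - 1) = (0 :: 'a)"
        using \<open>u \<noteq> 0\<close> by simp
      also have "\<dots> \<longleftrightarrow> n ^ 11 mod 23 = 1"
        unfolding of_int_eq_0 mod_eq_dvd_iff[symmetric] by simp
      finally show ?thesis by (simp only: GF_def mem_Collect_eq)
    qed
    have "\<beta> \<noteq> - \<beta>"
    proof
      assume "\<beta> = - \<beta>"
      then have "2 * \<beta> = 0" by (metis add.right_inverse mult_2)
      then show False using two_nz \<open>\<beta> \<noteq> 0\<close> by simp
    qed
    moreover have "\<beta> \<in> GF (23 ^ 2) \<longleftrightarrow> n ^ 11 mod 23 = 1" "- \<beta> \<in> GF (23 ^ 2) \<longleftrightarrow> n ^ 11 mod 23 = 1"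
      using mem[OF \<beta>] mem[of "- \<beta>"] \<beta> by simp_all
    then have "{u \<in> {\<beta>, - \<beta>}. u \<in> GF (23 ^ 2)} = (if n ^ 11 mod 23 = 1 then {\<beta>, - \<beta>} else {})"
      by auto
    ultimately have "card {u \<in> {\<beta>, - \<beta>}. u \<in> GF (23 ^ 2)} = (if n ^ 11 mod 23 = 1 then 2 else 0)"
      by simp
    then show ?thesis using False unfolding roots[symmetric] by (simp add: v_def n_def Let_def)
  qed
qed

end

section \<open>Counting points by table look-up\<close>

text \<open>These are constants of their own so that an application to numerals from 0 to 22 matches
  one ground equation of \<open>tables23\<close>; all intermediate results stay in that
  range.\<close>

definition mul23 :: "int \<Rightarrow> int \<Rightarrow> int" where "mul23 a b = a * b mod 23"
definition add23 :: "int \<Rightarrow> int \<Rightarrow> int" where "add23 a b = (a + b) mod 23"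
definition sub23 :: "int \<Rightarrow> int \<Rightarrow> int" where "sub23 a b = (a - b) mod 23"

definition roots23 :: "int \<Rightarrow> int"
  where "roots23 n = (if n = 0 then 1 else if n ^ 11 mod 23 = 1 then 2 else 0)"

text \<open>The pair stands for u + v I, and the result for (a + b I) (u + v I) + c.\<close>

definition horner_step :: "int \<Rightarrow> int \<Rightarrow> int \<Rightarrow> int \<times> int \<Rightarrow> int \<times> int"
  where "horner_step a b c z = (case z of (u, v) \<Rightarrow>
    (add23 (sub23 (mul23 a u) (mul23 b v)) c, add23 (mul23 a v) (mul23 b u)))"

definition square_root_count :: "int \<times> int \<Rightarrow> int"
  where "square_root_count z = (case z of (u, v) \<Rightarrow> roots23 (add23 (mul23 u u) (mul23 v v)))"

text \<open>The coefficients are listed from the constant term upwards, so that \<open>foldr\<close>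
  is the Horner scheme at a + b I.\<close>

definition point_count :: "int list \<Rightarrow> int"
  where "point_count cs = sum_list (map (\<lambda>a. sum_list (map (\<lambda>b.
    square_root_count (foldr (horner_step a b) cs (0, 0))) [0..22])) [0..22])"

context char_23
begin

abbreviation int_poly :: "int list \<Rightarrow> 'a poly"
  where "int_poly cs \<equiv> Poly (map of_int cs)"

lemma \<phi>_horner_step: "\<phi> (horner_step a b c z) = of_int c + \<phi> (a, b) * \<phi> z"
proof (cases z)
  case (Pair u v)
  have "\<phi> (a, b) * \<phi> (u, v) = of_int a * of_int u + of_int b * of_int v * I ^ 2
      + (of_int a * of_int v + of_int b * of_int u) * I"
    by (simp add: \<phi>_def algebra_simps power2_eq_square)
  then show ?thesis
    unfolding Pair horner_step_def I
    by (simp add: \<phi>_def add23_def sub23_def mul23_def of_int_mod)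
qed

lemma \<phi>_horner: "\<phi> (foldr (horner_step a b) cs (0, 0)) = poly (int_poly cs) (\<phi> (a, b))"
  by (induction cs) (simp_all add: \<phi>_horner_step, simp add: \<phi>_def)

lemma square_root_count:
  "square_root_count z = int (card {\<beta> \<in> GF (23 ^ 2). \<beta> ^ 2 = \<phi> z})"
proof (cases z)
  case (Pair a b)
  have "add23 (mul23 a a) (mul23 b b) = (a * a + b * b) mod 23"
    by (simp add: add23_def mul23_def mod_add_eq)
  then show ?thesis
    unfolding Pair card_square_roots square_root_count_def by (simp add: roots23_def Let_def)
qed

lemma card_affine_points:
  "int (card (affine_points (GF (23 ^ 2)) (int_poly cs))) = point_count cs"
proof -
  define S where "S \<alpha> = {\<beta> \<in> GF (23 ^ 2). \<beta> ^ 2 = poly (int_poly cs) \<alpha>}" for \<alpha>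
  have fin: "finite (GF (23 ^ 2) :: 'a set)" by (rule finite_GF) simp
  have "affine_points (GF (23 ^ 2)) (int_poly cs) = Sigma (GF (23 ^ 2)) S"
    unfolding affine_points_def S_def by blast
  moreover have "card (Sigma (GF (23 ^ 2)) S) = (\<Sum>\<alpha>\<in>GF (23 ^ 2). card (S \<alpha>))"
    by (rule card_SigmaI) (use fin in \<open>auto simp: S_def\<close>)
  ultimately have "int (card (affine_points (GF (23 ^ 2)) (int_poly cs))) =
      (\<Sum>\<alpha>\<in>GF (23 ^ 2). int (card (S \<alpha>)))"
    by simp
  also have "\<dots> = (\<Sum>z\<in>{0..22} \<times> {0..22}. int (card (S (\<phi> z))))"
    by (rule sum.reindex_bij_betw[OF \<phi>_bij, symmetric])
  also have "\<dots> = (\<Sum>a\<in>{0..22}. \<Sum>b\<in>{0..22}. int (card (S (\<phi> (a, b)))))"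
    by (simp add: sum.cartesian_product)
  also have "\<dots> = point_count cs"
    unfolding point_count_def S_def square_root_count \<phi>_horner
    by (simp only: interv_sum_list_conv_sum_set_int set_upto)
  finally show ?thesis .
qed

end

lemma upto_22:
  "[0..22::int] = [0, 1, 2, 3, 4, 5, 6, 7, 8, 9, 10, 11, 12, 13, 14, 15, 16, 17, 18, 19, 20, 21, 22]"
  by (simp add: upto_rec1)

lemma horner_step_Pair:
  "horner_step a b c (u, v) = (add23 (sub23 (mul23 a u) (mul23 b v)) c, add23 (mul23 a v) (mul23 b u))"
  by (simp add: horner_step_def)

lemma square_root_count_Pair: "square_root_count (u, v) = roots23 (add23 (mul23 u u) (mul23 v v))"
  by (simp add: square_root_count_def)

text \<open>The unfolded and simplified forms of the following are the operation tables: conjunctions of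
  ground equations, by which the simplifier evaluates each operation in one rewriting step.\<close>

lemma mul23_all: "list_all (\<lambda>a. list_all (\<lambda>b. mul23 a b = a * b mod 23) [0..22]) [0..22]"
  and add23_all: "list_all (\<lambda>a. list_all (\<lambda>b. add23 a b = (a + b) mod 23) [0..22]) [0..22]"
  and sub23_all: "list_all (\<lambda>a. list_all (\<lambda>b. sub23 a b = (a - b) mod 23) [0..22]) [0..22]"
  and roots23_all: "list_all (\<lambda>a. roots23 a =
    (if a = 0 then 1 else if a ^ 11 mod 23 = 1 then 2 else 0)) [0..22]"
  by (simp_all add: list_all_iff mul23_def add23_def sub23_def roots23_def)

lemmas tables23 =
  mul23_all[unfolded upto_22, simplified] add23_all[unfolded upto_22, simplified]
  sub23_all[unfolded upto_22, simplified] roots23_all[unfolded upto_22, simplified]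

lemmas unroll = point_count_def upto_22 list.map sum_list.Cons sum_list.Nil foldr.simps comp_apply
  id_apply

lemmas evaluate = horner_step_Pair square_root_count_Pair tables23

text \<open>712 = 23^2 + 1 + 2 * 4 * 23 - 2, where 2 accounts for the points at infinity.\<close>

lemma point_count_maximal:
  "point_count [0, 10, 0, 0, 3, 0, 0, 1, 0, 0, 1] = 712"
  "point_count [0, 6, 0, 0, 18, 0, 0, 1, 0, 0, 1] = 712"
  "point_count [21, 4, 9, 3, 21, 3, 5, 1, 0, 0, 1] = 712"
  "point_count [21, 8, 16, 10, 19, 11, 9, 1, 0, 0, 1] = 712"
  "point_count [1, 6, 5, 2, 14, 9, 16, 1, 0, 0, 1] = 712"
  "point_count [21, 20, 8, 1, 21, 0, 18, 1, 0, 0, 1] = 712"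
  "point_count [6, 0, 2, 0, 2, 0, 3, 0, 1, 0, 1] = 712"
  "point_count [3, 0, 4, 0, 22, 0, 6, 0, 1, 0, 1] = 712"
  "point_count [14, 0, 15, 0, 7, 0, 8, 0, 1, 0, 1] = 712"
  "point_count [18, 11, 12, 0, 0, 2, 12, 4, 1, 0, 1] = 712"
  "point_count [17, 18, 7, 0, 11, 22, 15, 5, 1, 0, 1] = 712"
  by (simp only: unroll, simp only: evaluate)+

text \<open>344 = 23^2 + 1 - 2 * 4 * 23 - 2.\<close>

lemma point_count_minimal: "point_count [19, 0, 11, 16, 14, 3, 6, 2, 1, 0, 1] = 344"
  by (simp only: unroll, simp only: evaluate)

section \<open>The twelve curves\<close>

context char_23
begin

text \<open>The same x and y are used over three fields of constants: GF 23 as the base, its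
  algebraic closure L for the genus, and GF 529 for the points.\<close>

lemma double_cover_of_ints:
  assumes x: "transc (GF 23) x"
    and cs: "length cs = 11" "last cs = 1"
    and bezout: "int_poly us * int_poly cs + int_poly vs * pderiv (int_poly cs) = 1"
  defines "F \<equiv> double_cover (GF 23) x (int_poly cs)"
  shows "curve (GF 23) F" and "hyperelliptic_curve (GF 23) F" and "has_genus (GF 23) F 4"
    and "int (card (rational_points (GF (23 ^ 2)) F)) = point_count cs + 2"
proof -
  define f where "f = int_poly cs"
  define L where "L = (GF_closure 23 :: 'a set)"
  have int_poly_mem: "int_poly as \<in> polys (GF 23)" for as
  proof -
    interpret subfld "GF 23 :: 'a set" by (rule subfld_23)
    show ?thesis by (induction as) (auto intro: polys_mems mems)
  qed
  have "coeff f 10 = of_int (last cs)"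
    using cs(1) by (simp add: f_def coeff_Poly_eq nth_default_def last_conv_nth flip: length_greater_0_conv)
  moreover have "degree f \<le> 10"
    using cs(1) by (intro degree_le) (auto simp: f_def coeff_Poly_eq nth_default_def)
  ultimately have f: "degree f = 10" "lead_coeff f = 1"
    using cs(2) le_degree[of f 10] by auto
  \<comment> \<open>At a common root of f and f' the Bezout identity would read 0 = 1.\<close>
  have smooth: "poly (pderiv f) a \<noteq> 0" if "poly f a = 0" for a
    using arg_cong[OF bezout, of "\<lambda>p. poly p a"] that by (auto simp: f_def)
  obtain y where y: "y ^ 2 = poly f x"
    using nth_root_exists[of 2 "poly f x"] by auto
  have sub: "GF 23 \<subseteq> L" "GF (23 ^ 2) \<subseteq> L"
    unfolding L_def GF_closure_def
    using UN_upper[of 1 "{0<..}" "\<lambda>n. GF (23 ^ n)"] UN_upper[of 2 "{0<..}" "\<lambda>n. GF (23 ^ n)"] by simp_all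
  have xL: "transc L x"
    unfolding L_def by (rule transc_GF_closure[OF prime_23 char subfld_23 x])
  have model: "hyperelliptic_model K x y f 4" if "subfld K" "GF 23 \<subseteq> K" "K \<subseteq> L" for K
  proof -
    interpret subfld K by fact
    show ?thesis
    proof
      show "transc K x" using transc_mono[OF that(3) xL] .
      show "f \<in> polys K" unfolding f_def using int_poly_mem polys_mono[OF that(2)] by blast
    qed (use f y smooth two_nz in auto)
  qed
  have models: "hyperelliptic_model (GF 23) x y f 4" "hyperelliptic_model L x y f 4"
    "hyperelliptic_model (GF (23 ^ 2)) x y f 4"
    using model subfld_23 subfld_529 subfld_GF_closure[OF prime_23 char] sub GF_23_529
    by (auto simp: L_def)
  interpret hyperelliptic_extension "GF 23" L x y f 4
  proof (intro hyperelliptic_extension.intro hyperelliptic_extension_axioms.intro models)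
    show "GF 23 \<subseteq> L" by (rule sub)
    show "\<exists>p\<in>polys (GF 23). p \<noteq> 0 \<and> poly p z = 0" if "z \<in> L" for z
      using GF_closure_algebraic[OF prime_23 char _ subfld_23] that unfolding L_def .
    show "z \<in> L" if "p \<in> polys L" "p \<noteq> 0" "poly p z = 0" for p z
      using GF_closure_closed[OF prime_23 char] that unfolding L_def by blast
    show "\<exists>u\<in>polys (GF 23). \<exists>v\<in>polys (GF 23). u * f + v * pderiv f = 1"
      using bezout int_poly_mem unfolding f_def by blast
  qed
  have F: "F = double_cover_field.E (GF 23) x y"
    unfolding F_def f_def[symmetric] by (rule k.double_cover_eq_E)
  show "curve (GF 23) F" "hyperelliptic_curve (GF 23) F" "has_genus (GF 23) F 4"
    unfolding F by (rule is_curve is_hyperelliptic genus)+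
  have "card (rational_points (GF (23 ^ 2)) F) = card (affine_points (GF (23 ^ 2)) f) + 2"
    unfolding F
    by (rule card_rational_points[OF k.double_cover_field_axioms models(3) GF_23_529 _ f(2)])
       (rule finite_GF, simp)
  then show "int (card (rational_points (GF (23 ^ 2)) F)) = point_count cs + 2"
    using card_affine_points[of cs] by (simp add: f_def)
qed

lemma maximal_if_count:
  assumes "transc (GF 23) x" "length cs = 11" "last cs = 1"
    and "int_poly us * int_poly cs + int_poly vs * pderiv (int_poly cs) = 1"
    and "point_count cs = 712"
  shows "maximal_curve 23 (GF 23) (double_cover (GF 23) x (int_poly cs))"
  unfolding maximal_curve_def using double_cover_of_ints[OF assms(1-4)] GF_23_529 assms(5)
  by (intro conjI exI[of _ 4]) simp_all

lemma minimal_if_count: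
  assumes "transc (GF 23) x" "length cs = 11" "last cs = 1"
    and "int_poly us * int_poly cs + int_poly vs * pderiv (int_poly cs) = 1"
    and "point_count cs = 344"
  shows "minimal_curve 23 (GF 23) (double_cover (GF 23) x (int_poly cs))"
  unfolding minimal_curve_def using double_cover_of_ints[OF assms(1-4)] GF_23_529 assms(5)
  by (intro conjI exI[of _ 4]) simp_all

section \<open>Certificates of separability and the explicit equations\<close>

lemma numeral_eq_0: "(numeral n :: 'a) = 0 \<longleftrightarrow> (23 :: int) dvd numeral n"
  using of_int_eq_0[of "numeral n"] by simp

lemma numeral_eq_1: "(numeral n :: 'a) = 1 \<longleftrightarrow> (23 :: int) dvd numeral n - 1"
proof -
  have "(numeral n :: 'a) = 1 \<longleftrightarrow> of_int (numeral n - 1) = (0 :: 'a)"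
    by (simp only: of_int_diff of_int_numeral of_int_1 right_minus_eq)
  then show ?thesis by (simp only: of_int_eq_0)
qed

text \<open>The multipliers are the unique ones of degree at most 8 for f and at most 9 for f', as
  the extended Euclidean algorithm modulo 23 yields them. Checking them only takes multiplication
  and a divisibility test for each coefficient.\<close>

lemma bezout_identities:
  "int_poly [0, 0, 2, 0, 0, 20, 0, 0, 7] * int_poly [0, 10, 0, 0, 3, 0, 0, 1, 0, 0, 1] +
    int_poly [7, 0, 0, 8, 0, 0, 4, 0, 0, 20] * pderiv (int_poly [0, 10, 0, 0, 3, 0, 0, 1, 0, 0, 1]) = 1"
  "int_poly [0, 0, 12, 0, 0, 20, 0, 0, 10] * int_poly [0, 6, 0, 0, 18, 0, 0, 1, 0, 0, 1] +
    int_poly [4, 0, 0, 9, 0, 0, 0, 0, 0, 22] * pderiv (int_poly [0, 6, 0, 0, 18, 0, 0, 1, 0, 0, 1]) = 1"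
  "int_poly [12, 8, 6, 1, 4, 19, 5, 19, 11] * int_poly [21, 4, 9, 3, 21, 3, 5, 1, 0, 0, 1] +
    int_poly [12, 7, 13, 15, 15, 15, 21, 11, 5, 15] * pderiv (int_poly [21, 4, 9, 3, 21, 3, 5, 1, 0, 0, 1]) = 1"
  "int_poly [19, 6, 5, 20, 22, 19, 20, 9, 20] * int_poly [21, 8, 16, 10, 19, 11, 9, 1, 0, 0, 1] +
    int_poly [2, 9, 0, 15, 8, 20, 9, 21, 6, 21] * pderiv (int_poly [21, 8, 16, 10, 19, 11, 9, 1, 0, 0, 1]) = 1"
  "int_poly [7, 4, 7, 7, 20, 13, 14, 9, 16] * int_poly [1, 6, 5, 2, 14, 9, 16, 1, 0, 0, 1] +
    int_poly [22, 17, 0, 13, 8, 19, 18, 17, 6, 3] * pderiv (int_poly [1, 6, 5, 2, 14, 9, 16, 1, 0, 0, 1]) = 1"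
  "int_poly [11, 9, 6, 1, 16, 9, 14, 7, 9] * int_poly [21, 20, 8, 1, 21, 0, 18, 1, 0, 0, 1] +
    int_poly [0, 6, 10, 19, 11, 20, 17, 17, 20, 6] * pderiv (int_poly [21, 20, 8, 1, 21, 0, 18, 1, 0, 0, 1]) = 1"
  "int_poly [4, 0, 4, 0, 13, 0, 16, 0, 7] * int_poly [6, 0, 2, 0, 2, 0, 3, 0, 1, 0, 1] +
    int_poly [0, 15, 0, 4, 0, 4, 0, 7, 0, 20] * pderiv (int_poly [6, 0, 2, 0, 2, 0, 3, 0, 1, 0, 1]) = 1"
  "int_poly [8, 0, 14, 0, 21, 0, 11, 0, 7] * int_poly [3, 0, 4, 0, 22, 0, 6, 0, 1, 0, 1] +
    int_poly [0, 8, 0, 16, 0, 2, 0, 19, 0, 20] * pderiv (int_poly [3, 0, 4, 0, 22, 0, 6, 0, 1, 0, 1]) = 1"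
  "int_poly [5, 0, 5, 0, 4, 0, 8, 0, 11] * int_poly [14, 0, 15, 0, 7, 0, 8, 0, 1, 0, 1] +
    int_poly [0, 22, 0, 0, 0, 11, 0, 16, 0, 15] * pderiv (int_poly [14, 0, 15, 0, 7, 0, 8, 0, 1, 0, 1]) = 1"
  "int_poly [22, 18, 2, 16, 15, 13, 6, 3, 3] * int_poly [18, 11, 12, 0, 0, 2, 12, 4, 1, 0, 1] +
    int_poly [8, 21, 3, 0, 19, 5, 13, 9, 2, 2] * pderiv (int_poly [18, 11, 12, 0, 0, 2, 12, 4, 1, 0, 1]) = 1"
  "int_poly [17, 7, 6, 10, 15, 8, 10, 14, 19] * int_poly [17, 18, 7, 0, 11, 22, 15, 5, 1, 0, 1] +
    int_poly [7, 8, 9, 5, 17, 7, 17, 0, 17, 5] * pderiv (int_poly [17, 18, 7, 0, 11, 22, 15, 5, 1, 0, 1]) = 1"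
  "int_poly [17, 14, 18, 18, 15, 1, 2, 3, 2] * int_poly [19, 0, 11, 16, 14, 3, 6, 2, 1, 0, 1] +
    int_poly [13, 3, 7, 11, 0, 12, 8, 20, 2, 9] * pderiv (int_poly [19, 0, 11, 16, 14, 3, 6, 2, 1, 0, 1]) = 1"
  by (simp_all add: pderiv_pCons one_pCons numeral_eq_0 numeral_eq_1)

lemma X_power_numeral: "\<X> ^ numeral n = pCons 0 (\<X> ^ pred_numeral n)"
  by (simp add: numeral_eq_Suc)

lemma curve_equations:
  "\<X>^10 + \<X>^7 + 3 * \<X>^4 + 10 * \<X> = int_poly [0, 10, 0, 0, 3, 0, 0, 1, 0, 0, 1]"
  "\<X>^10 + \<X>^7 + 18 * \<X>^4 + 6 * \<X> = int_poly [0, 6, 0, 0, 18, 0, 0, 1, 0, 0, 1]"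
  "\<X>^10 + \<X>^7 + 5 * \<X>^6 + 3 * \<X>^5 + 21 * \<X>^4 + 3 * \<X>^3 + 9 * \<X>^2 + 4 * \<X> + 21 = int_poly [21, 4, 9, 3, 21, 3, 5, 1, 0, 0, 1]"
  "\<X>^10 + \<X>^7 + 9 * \<X>^6 + 11 * \<X>^5 + 19 * \<X>^4 + 10 * \<X>^3 + 16 * \<X>^2 + 8 * \<X> + 21 = int_poly [21, 8, 16, 10, 19, 11, 9, 1, 0, 0, 1]"
  "\<X>^10 + \<X>^7 + 16 * \<X>^6 + 9 * \<X>^5 + 14 * \<X>^4 + 2 * \<X>^3 + 5 * \<X>^2 + 6 * \<X> + 1 = int_poly [1, 6, 5, 2, 14, 9, 16, 1, 0, 0, 1]"
  "\<X>^10 + \<X>^7 + 18 * \<X>^6 + 21 * \<X>^4 + \<X>^3 + 8 * \<X>^2 + 20 * \<X> + 21 = int_poly [21, 20, 8, 1, 21, 0, 18, 1, 0, 0, 1]"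
  "\<X>^10 + \<X>^8 + 3 * \<X>^6 + 2 * \<X>^4 + 2 * \<X>^2 + 6 = int_poly [6, 0, 2, 0, 2, 0, 3, 0, 1, 0, 1]"
  "\<X>^10 + \<X>^8 + 6 * \<X>^6 + 22 * \<X>^4 + 4 * \<X>^2 + 3 = int_poly [3, 0, 4, 0, 22, 0, 6, 0, 1, 0, 1]"
  "\<X>^10 + \<X>^8 + 8 * \<X>^6 + 7 * \<X>^4 + 15 * \<X>^2 + 14 = int_poly [14, 0, 15, 0, 7, 0, 8, 0, 1, 0, 1]"
  "\<X>^10 + \<X>^8 + 4 * \<X>^7 + 12 * \<X>^6 + 2 * \<X>^5 + 12 * \<X>^2 + 11 * \<X> + 18 = int_poly [18, 11, 12, 0, 0, 2, 12, 4, 1, 0, 1]"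
  "\<X>^10 + \<X>^8 + 5 * \<X>^7 + 15 * \<X>^6 + 22 * \<X>^5 + 11 * \<X>^4 + 7 * \<X>^2 + 18 * \<X> + 17 = int_poly [17, 18, 7, 0, 11, 22, 15, 5, 1, 0, 1]"
  "\<X>^10 + \<X>^8 + 2 * \<X>^7 + 6 * \<X>^6 + 3 * \<X>^5 + 14 * \<X>^4 + 16 * \<X>^3 + 11 * \<X>^2 + 19 = int_poly [19, 0, 11, 16, 14, 3, 6, 2, 1, 0, 1]"
  by (simp_all add: X_power_numeral numeral_poly one_pCons)

end

theorem corollary3p3p4:
  fixes x :: "'a::alg_closed_field"
  assumes "CHAR('a) = 23"
    and "(ring.transcendental Omega over GF 23) x"
  shows
    "(\<exists>F :: 'a set. hyperelliptic_curve (GF 23) F \<and> has_genus (GF 23) F 4 \<and>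
        maximal_curve 23 (GF 23) F) \<and>
     (\<exists>F :: 'a set. hyperelliptic_curve (GF 23) F \<and> has_genus (GF 23) F 4 \<and>
        minimal_curve 23 (GF 23) F) \<and>
     (\<forall>f \<in> {\<X>^10 + \<X>^7 + 3 * \<X>^4 + 10 * \<X>,
            \<X>^10 + \<X>^7 + 18 * \<X>^4 + 6 * \<X>,
            \<X>^10 + \<X>^7 + 5 * \<X>^6 + 3 * \<X>^5 + 21 * \<X>^4 + 3 * \<X>^3 + 9 * \<X>^2 + 4 * \<X> + 21,
            \<X>^10 + \<X>^7 + 9 * \<X>^6 + 11 * \<X>^5 + 19 * \<X>^4 + 10 * \<X>^3 + 16 * \<X>^2 + 8 * \<X> + 21,
            \<X>^10 + \<X>^7 + 16 * \<X>^6 + 9 * \<X>^5 + 14 * \<X>^4 + 2 * \<X>^3 + 5 * \<X>^2 + 6 * \<X> + 1,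
            \<X>^10 + \<X>^7 + 18 * \<X>^6 + 21 * \<X>^4 + \<X>^3 + 8 * \<X>^2 + 20 * \<X> + 21,
            \<X>^10 + \<X>^8 + 3 * \<X>^6 + 2 * \<X>^4 + 2 * \<X>^2 + 6,
            \<X>^10 + \<X>^8 + 6 * \<X>^6 + 22 * \<X>^4 + 4 * \<X>^2 + 3,
            \<X>^10 + \<X>^8 + 8 * \<X>^6 + 7 * \<X>^4 + 15 * \<X>^2 + 14,
            \<X>^10 + \<X>^8 + 4 * \<X>^7 + 12 * \<X>^6 + 2 * \<X>^5 + 12 * \<X>^2 + 11 * \<X> + 18,
            \<X>^10 + \<X>^8 + 5 * \<X>^7 + 15 * \<X>^6 + 22 * \<X>^5 + 11 * \<X>^4 + 7 * \<X>^2 + 18 * \<X> + 17}.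
        hyperelliptic_curve (GF 23) (double_cover (GF 23) x f) \<and>
        has_genus (GF 23) (double_cover (GF 23) x f) 4 \<and>
        maximal_curve 23 (GF 23) (double_cover (GF 23) x f)) \<and>
     (\<forall>f \<in> {\<X>^10 + \<X>^8 + 2 * \<X>^7 + 6 * \<X>^6 + 3 * \<X>^5 + 14 * \<X>^4 + 16 * \<X>^3 + 11 * \<X>^2 + 19}.
        hyperelliptic_curve (GF 23) (double_cover (GF 23) x f) \<and>
        has_genus (GF 23) (double_cover (GF 23) x f) 4 \<and>
        minimal_curve 23 (GF 23) (double_cover (GF 23) x f))"
proof -
  obtain I :: 'a where "I ^ 2 = - 1"
    using nth_root_exists[of 2 "- 1 :: 'a"] by auto
  with assms(1) interpret char_23 I by unfold_locales
  have x: "transc (GF 23) x"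
    using assms(2) transcendental_Omega_iff subfld_23 by blast
  \<comment> \<open>\<open>rotated 2\<close> moves the Bezout premise to the front, so that
    resolution with each identity fixes \<open>us\<close>, \<open>vs\<close> and
    \<open>cs\<close>.\<close>
  note curves = bezout_identities[THEN double_cover_of_ints(2)[OF x, rotated 2]]
    bezout_identities[THEN double_cover_of_ints(3)[OF x, rotated 2]]
  note maximal =
    maximal_if_count[OF x _ _ bezout_identities(1) point_count_maximal(1)]
    maximal_if_count[OF x _ _ bezout_identities(2) point_count_maximal(2)]
    maximal_if_count[OF x _ _ bezout_identities(3) point_count_maximal(3)]
    maximal_if_count[OF x _ _ bezout_identities(4) point_count_maximal(4)]
    maximal_if_count[OF x _ _ bezout_identities(5) point_count_maximal(5)]
    maximal_if_count[OF x _ _ bezout_identities(6) point_count_maximal(6)]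
    maximal_if_count[OF x _ _ bezout_identities(7) point_count_maximal(7)]
    maximal_if_count[OF x _ _ bezout_identities(8) point_count_maximal(8)]
    maximal_if_count[OF x _ _ bezout_identities(9) point_count_maximal(9)]
    maximal_if_count[OF x _ _ bezout_identities(10) point_count_maximal(10)]
    maximal_if_count[OF x _ _ bezout_identities(11) point_count_maximal(11)]
  note minimal = minimal_if_count[OF x _ _ bezout_identities(12) point_count_minimal]
  note facts = curves maximal minimal
  have 1: "hyperelliptic_curve (GF 23) (double_cover (GF 23) x f) \<and>
      has_genus (GF 23) (double_cover (GF 23) x f) 4 \<and>
      maximal_curve 23 (GF 23) (double_cover (GF 23) x f)"
    if "f \<in> {int_poly [0, 10, 0, 0, 3, 0, 0, 1, 0, 0, 1],
      int_poly [0, 6, 0, 0, 18, 0, 0, 1, 0, 0, 1],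
      int_poly [21, 4, 9, 3, 21, 3, 5, 1, 0, 0, 1],
      int_poly [21, 8, 16, 10, 19, 11, 9, 1, 0, 0, 1],
      int_poly [1, 6, 5, 2, 14, 9, 16, 1, 0, 0, 1],
      int_poly [21, 20, 8, 1, 21, 0, 18, 1, 0, 0, 1],
      int_poly [6, 0, 2, 0, 2, 0, 3, 0, 1, 0, 1],
      int_poly [3, 0, 4, 0, 22, 0, 6, 0, 1, 0, 1],
      int_poly [14, 0, 15, 0, 7, 0, 8, 0, 1, 0, 1],
      int_poly [18, 11, 12, 0, 0, 2, 12, 4, 1, 0, 1],
      int_poly [17, 18, 7, 0, 11, 22, 15, 5, 1, 0, 1]}" for f
    using that by (elim insertE emptyE; simp only:; intro conjI facts; simp)
  have 2: "hyperelliptic_curve (GF 23) (double_cover (GF 23) x f) \<and>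
      has_genus (GF 23) (double_cover (GF 23) x f) 4 \<and>
      minimal_curve 23 (GF 23) (double_cover (GF 23) x f)"
    if "f \<in> {int_poly [19, 0, 11, 16, 14, 3, 6, 2, 1, 0, 1]}" for f
    using that by (elim insertE emptyE; simp only:; intro conjI facts; simp)
  show ?thesis
    unfolding curve_equations using 1 2 by (intro conjI ballI) blast+
qed

end
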